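(* Let $d\ge1$ and let $L_A$ and $L_B$ be two independent (homogeneous) Poisson point processes on $\mathbb{R}^d$, with respective intensities $\alpha,\beta\in(0,\infty)$. Consider colored friendly frogs with colored points on $(L_A,L_B)$. With probability $1$, the game is a win for Bob if $\alpha\le\beta$, and a win for Alice if $\alpha>\beta$.
   Context: Distances are Euclidean. The realizations of the Poisson processes are regarded as random (countable) sets of points. Colored friendly frogs on colored points $(L_A,L_B)$, where $L_A,L_B$ are disjoint subsets of $\mathbb{R}^d$ (amber points and blue points, respectively), is the following two-player game. First Alice places an amber frog on some point of $L_A$. Then Bob places a blue frog on some point of $L_B$. Then the players alternately move, starting with Alice. A move consists of the player moving their own frog (Alice may only move the amber frog, and only to points of $L_A$; Bob may only move the blue frog, and only to points of $L_B$) in such a way that the distance between the two frogs is strictly decreased. A player who cannot move loses, and the other player wins. A strategy for a player assigns a legal move (if one exists) to each position; a winning strategy is one that results in a win for that player whatever strategy the other player uses. The game is a win for a player if that player has a winning strategy. The players know the realizations of $L_A$ and $L_B$. *)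

theory Defs
  imports "HOL-Probability.Probability"
begin

definition locally_finite_set :: "'a::metric_space set \<Rightarrow> bool" where
  "locally_finite_set X \<longleftrightarrow> (\<forall>B. bounded B \<longrightarrow> finite (X \<inter> B))"

text \<open>
  The measurable space of locally finite point sets, with the \<open>\<sigma>\<close>-algebra generated by the
  counts \<open>X \<mapsto> card (X \<inter> A)\<close>.  Only bounded \<open>A\<close> are used, so all
  intersections are finite and \<^const>\<open>card\<close> is the true number of points.
\<close>

definition configurations :: "'a::euclidean_space set measure" where
  "configurations = sigma {X. locally_finite_set X}
     {{X. locally_finite_set X \<and> card (X \<inter> A) = k} | A k. A \<in> sets borel \<and> bounded A}"

text \<open>
  The Poisson probabilities are written out instead of using \<^const>\<open>poisson_pmf\<close>, which
  requires a strictly positive rate, whereas \<open>A\<close> may be a null set (then \<open>0 ^ 0 = 1\<close>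
  gives the point mass at \<open>0\<close>).
\<close>

definition poisson_process :: "'w measure \<Rightarrow> real \<Rightarrow> ('w \<Rightarrow> 'a::euclidean_space set) \<Rightarrow> bool" where
  "poisson_process M r L \<longleftrightarrow>
     L \<in> measurable M configurations \<and>
     (\<forall>A k. A \<in> sets borel \<and> bounded A \<longrightarrow>
        measure M {\<omega> \<in> space M. card (L \<omega> \<inter> A) = k} =
          (r * measure lborel A) ^ k / fact k * exp (- (r * measure lborel A))) \<and>
     (\<forall>(n::nat) A. (\<forall>i<n. A i \<in> sets borel \<and> bounded (A i)) \<and> disjoint_family_on A {..<n} \<longrightarrow>
        prob_space.indep_vars M (\<lambda>_. count_space UNIV) (\<lambda>i \<omega>. card (L \<omega> \<inter> A i)) {..<n})"

datatype player = Alice | Bob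

fun opponent :: "player \<Rightarrow> player" where
  "opponent Alice = Bob"
| "opponent Bob = Alice"

text \<open>
  In \<open>Frogs p a b\<close>, it is \<open>p\<close>'s turn, the amber frog is at \<open>a\<close> and the blue frog at \<open>b\<close>.
  The two initial placements are treated as moves, from \<open>Empty_Board\<close> (by Alice) and
  from \<open>Amber_Placed\<close> (by Bob).
\<close>

datatype 'a position = Empty_Board | Amber_Placed 'a | Frogs player 'a 'a

fun mover :: "'a position \<Rightarrow> player" where
  "mover Empty_Board = Alice"
| "mover (Amber_Placed a) = Bob"
| "mover (Frogs p a b) = p"

fun legal_moves :: "'a::metric_space set \<Rightarrow> 'a set \<Rightarrow> 'a position \<Rightarrow> 'a position set" where
  "legal_moves LA LB Empty_Board = {Amber_Placed a | a. a \<in> LA}"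
| "legal_moves LA LB (Amber_Placed a) = {Frogs Alice a b | b. b \<in> LB}"
| "legal_moves LA LB (Frogs Alice a b) = {Frogs Bob a' b | a'. a' \<in> LA \<and> dist a' b < dist a b}"
| "legal_moves LA LB (Frogs Bob a b) = {Frogs Alice a b' | b'. b' \<in> LB \<and> dist a b' < dist a b}"

definition strategy ::
  "'a::metric_space set \<Rightarrow> 'a set \<Rightarrow> player \<Rightarrow> ('a position \<Rightarrow> 'a position) \<Rightarrow> bool" where
  "strategy LA LB p s \<longleftrightarrow>
     (\<forall>x. mover x = p \<and> legal_moves LA LB x \<noteq> {} \<longrightarrow> s x \<in> legal_moves LA LB x)"

text \<open>
  The values of \<open>play\<close> after the first position without a legal move are meaningless.
\<close>

primrec play :: "(player \<Rightarrow> 'a position \<Rightarrow> 'a position) \<Rightarrow> nat \<Rightarrow> 'a position" where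
  "play \<sigma> 0 = Empty_Board"
| "play \<sigma> (Suc n) = \<sigma> (mover (play \<sigma> n)) (play \<sigma> n)"

text \<open>An infinite play is won by neither player.\<close>

definition wins_play ::
  "'a::metric_space set \<Rightarrow> 'a set \<Rightarrow> player \<Rightarrow> (player \<Rightarrow> 'a position \<Rightarrow> 'a position) \<Rightarrow> bool" where
  "wins_play LA LB p \<sigma> \<longleftrightarrow>
     (\<exists>n. (\<forall>k<n. legal_moves LA LB (play \<sigma> k) \<noteq> {}) \<and>
          legal_moves LA LB (play \<sigma> n) = {} \<and> mover (play \<sigma> n) = opponent p)"

definition winning_strategy ::
  "'a::metric_space set \<Rightarrow> 'a set \<Rightarrow> player \<Rightarrow> ('a position \<Rightarrow> 'a position) \<Rightarrow> bool" where
  "winning_strategy LA LB p s \<longleftrightarrow> strategy LA LB p s \<and>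
     (\<forall>t. strategy LA LB (opponent p) t \<longrightarrow> wins_play LA LB p (\<lambda>q. if q = p then s else t))"

definition game_win_for :: "player \<Rightarrow> 'a::metric_space set \<Rightarrow> 'a set \<Rightarrow> bool" where
  "game_win_for p LA LB \<longleftrightarrow> (\<exists>s. winning_strategy LA LB p s)"

end

theory Submission
  imports Defs
begin

text \<open>
  Call a pair of an amber and a blue point stable if no closer pair sharing one of its two points is
  stable; this recursion is well founded because almost surely there are no infinite alternating
  chains with decreasing distances.  The stable pairs form a matching.  If every amber point is
  matched, Bob wins by always jumping to the partner of Alice's point; if some amber point is
  unmatched, Alice starts there and then always jumps to the partner of Bob's point.

  By mass transport, matched amber and matched blue points have equal intensity on every
  translation invariant event, and on such an event \<open>S\<close> the mean number of amber (blue) points per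
  unit cell is \<open>\<alpha> * prob S\<close> (\<open>\<beta> * prob S\<close>).  Since unmatched points of both colours cannot
  coexist, applying this to the event that some amber point is unmatched shows that it is null
  if \<open>\<alpha> \<le> \<beta>\<close>, and applying it to the complement shows that the complement is null if \<open>\<alpha> > \<beta>\<close>.

  The step lengths of an infinite descending chain converge, so a tail of it is an infinite cluster of
  points joined at distances in a thin annulus, which a first moment bound on self-avoiding paths
  excludes.  The same bound for paths of two steps rules out ties between distances.

  Measurability of the matching is obtained by comparing it with the matching of the finitely many
  grid cells of side \<open>1 / 2 ^ n\<close> near the origin that contain points.
\<close>

section \<open>Stable pairs and the game\<close>

text \<open>Stability occurs negatively in its own recursion. Splitting it into two mutually
  inductive predicates gives it a meaning for arbitrary sets; pairs of points satisfying neither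
  predicate can exist only where the descent is not well founded.

  Nothing is known beforehand about the probability of the event that some amber point is unmatched,
  and no zero-one law is used. The bound on the deviation of a Poisson count holds on every event,
  however it depends on the points, and this yields the mean counts on invariant events. In the
  critical case of equal intensities the comparison gives only equality of two means; this suffices
  because one of the two counts dominates the other almost surely.

  Stability is not visibly measurable, since it may depend on points arbitrarily far away. Hence the
  transported mass is defined everywhere as a lower limit of functions of finitely many cells, and
  is identified with the matching only outside a null set.\<close>

inductive stable_pair :: "'a::metric_space set \<Rightarrow> 'a set \<Rightarrow> 'a \<Rightarrow> 'a \<Rightarrow> bool"
  and unstable_pair :: "'a::metric_space set \<Rightarrow> 'a set \<Rightarrow> 'a \<Rightarrow> 'a \<Rightarrow> bool"
  for X Y :: "'a set" where
  stable_pairI: "stable_pair X Y a b"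
    if "a \<in> X" "b \<in> Y"
      "\<And>a'. a' \<in> X \<Longrightarrow> dist a' b < dist a b \<Longrightarrow> unstable_pair X Y a' b"
      "\<And>b'. b' \<in> Y \<Longrightarrow> dist a b' < dist a b \<Longrightarrow> unstable_pair X Y a b'"
| unstable_pair_left: "unstable_pair X Y a b"
    if "stable_pair X Y a' b" "a \<in> X" "b \<in> Y" "dist a' b < dist a b"
| unstable_pair_right: "unstable_pair X Y a b"
    if "stable_pair X Y a b'" "a \<in> X" "b \<in> Y" "dist a b' < dist a b"

lemma stable_pair_mem:
  assumes "stable_pair X Y a b"
  shows "a \<in> X" "b \<in> Y"
  using assms by (auto elim: stable_pair.cases)

text \<open>Both implications say the same, yet each has its use: the mutual induction attaches one
  to derivations of \<open>stable_pair\<close> and the other to derivations of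
  \<open>unstable_pair\<close>. Derivations are well founded by themselves, so this half of the
  dichotomy holds for arbitrary sets.\<close>

lemma stable_unstable_exclusive:
  "(stable_pair X Y a b \<longrightarrow> \<not> unstable_pair X Y a b) \<and>
   (unstable_pair X Y a b \<longrightarrow> \<not> stable_pair X Y a b)"
proof -
  have "(stable_pair X Y a b \<longrightarrow> \<not> unstable_pair X Y a b) \<and>
     (unstable_pair X Y c d \<longrightarrow> \<not> stable_pair X Y c d)" for a b c d
  proof (induction rule: stable_pair_unstable_pair.induct)
    case (stable_pairI a b)
    show ?case
    proof
      assume "unstable_pair X Y a b"
      then show False by cases (use stable_pairI stable_pair_mem in blast)+
    qed
  next
    case (unstable_pair_left a' b a)
    show ?case
    proof
      assume "stable_pair X Y a b"
      then show False by cases (use unstable_pair_left stable_pair_mem in blast)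
    qed
  next
    case (unstable_pair_right a b' b)
    show ?case
    proof
      assume "stable_pair X Y a b"
      then show False by cases (use unstable_pair_right stable_pair_mem in blast)
    qed
  qed
  then show ?thesis by blast
qed

text \<open>A strictly closer stable pair sharing a point makes a pair unstable, which a stable pair
  cannot be.\<close>

lemma stable_pair_closest:
  assumes "stable_pair X Y a b"
  shows "stable_pair X Y a' b \<Longrightarrow> dist a b \<le> dist a' b"
    and "stable_pair X Y a b' \<Longrightarrow> dist a b \<le> dist a b'"
  using assms stable_unstable_exclusive[of X Y]
  by (meson not_le stable_pair_mem unstable_pair_left unstable_pair_right)+

lemma stable_pair_swap: "stable_pair X Y a b \<longleftrightarrow> stable_pair Y X b a"
proof -
  have *: "(stable_pair X Y a b \<longrightarrow> stable_pair Y X b a) \<and>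
     (unstable_pair X Y c d \<longrightarrow> unstable_pair Y X d c)" for X Y :: "'a set" and a b c d
  proof (induction rule: stable_pair_unstable_pair.induct)
    case (stable_pairI a b)
    then show ?case
      by (intro stable_pair_unstable_pair.stable_pairI) (auto simp: dist_commute)
  next
    case (unstable_pair_left a' b a)
    then show ?case
      by (auto intro!: stable_pair_unstable_pair.unstable_pair_right simp: dist_commute)
  next
    case (unstable_pair_right a b' b)
    then show ?case
      by (auto intro!: stable_pair_unstable_pair.unstable_pair_left simp: dist_commute)
  qed
  show ?thesis using *[of X Y a b] *[of Y X b a] by blast
qed

text \<open>The turn is forgotten and the same frog may move twice in a row. Thus one relation
  governs both the recursion behind stability and the moves of the game.\<close>

definition descent :: "'a::metric_space set \<Rightarrow> 'a set \<Rightarrow> (('a \<times> 'a) \<times> ('a \<times> 'a)) set" where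
  "descent X Y = {((a', b'), (a, b)). a' \<in> X \<and> a \<in> X \<and> b' \<in> Y \<and> b \<in> Y \<and>
     (a' = a \<or> b' = b) \<and> dist a' b' < dist a b}"

text \<open>The other half of the dichotomy: if no closer stable pair shares a point, then by
  induction every closer pair sharing a point is unstable, which is what \<open>stable_pairI\<close>
  asks for.\<close>

lemma stable_or_unstable:
  assumes "wf (descent X Y)" "a \<in> X" "b \<in> Y"
  shows "stable_pair X Y a b \<or> unstable_pair X Y a b"
proof -
  have "fst p \<in> X \<longrightarrow> snd p \<in> Y \<longrightarrow>
      stable_pair X Y (fst p) (snd p) \<or> unstable_pair X Y (fst p) (snd p)" for p
    using assms(1)
  proof (induction p rule: wf_induct_rule)
    case (less p)
    obtain a b where p: "p = (a, b)" by (cases p)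
    show ?case
    proof (intro impI)
      assume mem: "fst p \<in> X" "snd p \<in> Y"
      have IH: "stable_pair X Y a' b' \<or> unstable_pair X Y a' b'"
        if "a' \<in> X" "b' \<in> Y" "a' = a \<or> b' = b" "dist a' b' < dist a b" for a' b'
        using less[of "(a', b')"] that mem by (auto simp: descent_def p)
      show "stable_pair X Y (fst p) (snd p) \<or> unstable_pair X Y (fst p) (snd p)"
      proof (cases "\<exists>a' b'. (a' = a \<or> b' = b) \<and> dist a' b' < dist a b \<and> stable_pair X Y a' b'")
        case True
        then show ?thesis
          using mem by (auto simp: p intro: unstable_pair_left unstable_pair_right)
      next
        case False
        then have "stable_pair X Y a b"
          using mem IH by (intro stable_pairI) (auto simp: p)
        then show ?thesis by (simp add: p)
      qed
    qed
  qed
  from this[of "(a, b)"] assms show ?thesis by simp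
qed

lemma unstable_pair_cases:
  assumes "wf (descent X Y)" "a \<in> X" "b \<in> Y" "\<not> stable_pair X Y a b"
  obtains a' where "stable_pair X Y a' b" "dist a' b < dist a b"
    | b' where "stable_pair X Y a b'" "dist a b' < dist a b"
proof -
  have "unstable_pair X Y a b" using stable_or_unstable[OF assms(1-3)] assms(4) by blast
  then show thesis using that by (auto elim: unstable_pair.cases)
qed

section \<open>From stable pairs to winning strategies\<close>

lemma mover_legal_move: "y \<in> legal_moves X Y x \<Longrightarrow> mover y = opponent (mover x)"
  by (cases "(X, Y, x)" rule: legal_moves.cases) auto

lemma play_terminates:
  assumes "wf (descent X Y)"
    and legal: "\<And>n. legal_moves X Y (play \<sigma> n) \<noteq> {} \<Longrightarrow> play \<sigma> (Suc n) \<in> legal_moves X Y (play \<sigma> n)"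
  shows "\<exists>n. legal_moves X Y (play \<sigma> n) = {}"
proof (rule ccontr)
  assume "\<not> ?thesis"
  then have step: "play \<sigma> (Suc n) \<in> legal_moves X Y (play \<sigma> n)" for n
    using legal by blast
  \<comment> \<open>The two placements start from indices 0 and 1, so the chain in
    \<open>descent\<close> begins at index 2 and the default \<open>undefined\<close> is never
    read.\<close>
  define frogs where "frogs x = (case x of Frogs p a b \<Rightarrow> (a, b) | _ \<Rightarrow> undefined)"
    for x :: "'a position"
  have frogs_simp: "frogs (Frogs p a b) = (a, b)" for p a b
    by (simp add: frogs_def)
  have on_board: "\<exists>p. \<exists>a\<in>X. \<exists>b\<in>Y. play \<sigma> (n + 2) = Frogs p a b" for n
  proof (induction n)
    case 0
    obtain a where a: "a \<in> X" "play \<sigma> (Suc 0) = Amber_Placed a"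
      using step[of 0] by auto
    have "play \<sigma> (Suc (Suc 0)) \<in> legal_moves X Y (Amber_Placed a)"
      using step[of "Suc 0"] by (simp only: a)
    then show ?case using a by (auto simp: numeral_2_eq_2 simp del: play.simps)
  next
    case (Suc n)
    then obtain p a b where *: "a \<in> X" "b \<in> Y" "play \<sigma> (n + 2) = Frogs p a b" by blast
    have "play \<sigma> (Suc (n + 2)) \<in> legal_moves X Y (Frogs p a b)"
      using step[of "n + 2"] by (simp only: *)
    then show ?case using * by (cases p) (auto simp del: play.simps)
  qed
  have "(frogs (play \<sigma> (Suc n + 2)), frogs (play \<sigma> (n + 2))) \<in> descent X Y" for n
  proof -
    obtain p a b where *: "a \<in> X" "b \<in> Y" "play \<sigma> (n + 2) = Frogs p a b"
      using on_board[of n] by blast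
    have "play \<sigma> (Suc (n + 2)) \<in> legal_moves X Y (Frogs p a b)"
      using step[of "n + 2"] by (simp only: *)
    then show ?thesis using *
      by (cases p) (auto simp: descent_def frogs_simp simp del: play.simps)
  qed
  then show False
    using assms(1) unfolding wf_iff_no_infinite_down_chain
    by (auto simp del: play.simps dest!: spec[where x = "\<lambda>n. frogs (play \<sigma> (n + 2))"])
qed

text \<open>
  \<open>G\<close> collects the positions from which \<open>p\<close> intends to win with the opponent to move.
\<close>

lemma game_win_forI:
  assumes wf: "wf (descent X Y)"
    and turn: "\<And>x. x \<in> G \<Longrightarrow> mover x = opponent p"
    and reply: "\<And>x y. x \<in> G \<Longrightarrow> y \<in> legal_moves X Y x \<Longrightarrow> \<exists>z\<in>legal_moves X Y y. z \<in> G"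
    and start: "Empty_Board \<in> G \<or> p = Alice \<and> (\<exists>z\<in>legal_moves X Y Empty_Board. z \<in> G)"
  shows "game_win_for p X Y"
proof -
  \<comment> \<open>A strategy has to be legal at every position of its owner, also at those never
    reached, so outside the plan \<open>s\<close> still picks some legal move.\<close>
  define s where "s x = (if \<exists>z\<in>legal_moves X Y x. z \<in> G
      then SOME z. z \<in> legal_moves X Y x \<and> z \<in> G else SOME z. z \<in> legal_moves X Y x)" for x
  have s_good: "s x \<in> legal_moves X Y x \<and> s x \<in> G" if "\<exists>z\<in>legal_moves X Y x. z \<in> G" for x
    using someI_ex[of "\<lambda>z. z \<in> legal_moves X Y x \<and> z \<in> G"] that unfolding s_def by auto
  have s_legal: "s x \<in> legal_moves X Y x" if "legal_moves X Y x \<noteq> {}" for x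
    using s_good[of x] someI_ex[of "\<lambda>z. z \<in> legal_moves X Y x"] that
    unfolding s_def by auto
  have "wins_play X Y p (\<lambda>q. if q = p then s else t)" if t: "strategy X Y (opponent p) t" for t
  proof -
    let ?\<sigma> = "\<lambda>q. if q = p then s else t"
    have opp: "q \<noteq> p \<longleftrightarrow> q = opponent p" for q
      by (cases q; cases p) auto
    have legal: "play ?\<sigma> (Suc n) \<in> legal_moves X Y (play ?\<sigma> n)"
      if "legal_moves X Y (play ?\<sigma> n) \<noteq> {}" for n
      using that s_legal t by (auto simp: strategy_def opp)
    define n where "n = (LEAST n. legal_moves X Y (play ?\<sigma> n) = {})"
    have n: "legal_moves X Y (play ?\<sigma> n) = {}"
      using play_terminates[OF wf legal] unfolding n_def by (rule LeastI_ex)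
    have before: "legal_moves X Y (play ?\<sigma> k) \<noteq> {}" if "k < n" for k
      using not_less_Least[of k] that unfolding n_def by blast
    \<comment> \<open>Whenever \<open>p\<close> is to move there is a move into \<open>G\<close>, so
      the position in which the play gets stuck has the opponent to move.\<close>
    have inv: "if mover (play ?\<sigma> k) = p then \<exists>z\<in>legal_moves X Y (play ?\<sigma> k). z \<in> G
        else play ?\<sigma> k \<in> G" if "k \<le> n" for k
      using that
    proof (induction k)
      case 0
      then show ?case using start turn[of Empty_Board] by (cases p) auto
    next
      case (Suc k)
      then have move: "play ?\<sigma> (Suc k) \<in> legal_moves X Y (play ?\<sigma> k)"
        using legal before by simp
      note turns = mover_legal_move[OF move]
      show ?case
      proof (cases "mover (play ?\<sigma> k) = p")
        case True
        then have "play ?\<sigma> (Suc k) \<in> G" using Suc s_good by auto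
        then show ?thesis using turn[of "play ?\<sigma> (Suc k)"] opp by auto
      next
        case False
        then have "play ?\<sigma> k \<in> G" using Suc by auto
        then have "\<exists>z\<in>legal_moves X Y (play ?\<sigma> (Suc k)). z \<in> G" using reply move by blast
        moreover have "mover (play ?\<sigma> (Suc k)) = p"
          using False turns by (cases p; cases "mover (play ?\<sigma> k)") auto
        ultimately show ?thesis by simp
      qed
    qed
    have "mover (play ?\<sigma> n) = opponent p"
      using inv[of n] n opp by (auto split: if_splits)
    then show ?thesis using n before unfolding wins_play_def by blast
  qed
  moreover have "strategy X Y p s" using s_legal by (auto simp: strategy_def)
  ultimately show ?thesis by (auto simp: game_win_for_def winning_strategy_def)
qed

text \<open>Bob always leaves a stable pair behind. When Alice moves from \<open>a\<close> to a
  closer \<open>a'\<close>, the new pair is not stable, so a still closer stable pair shares a point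
  with it. That point is not \<open>b\<close>, whose stable pairs are all at least as long as the
  old one; hence \<open>a'\<close> has a closer partner to which Bob can jump.\<close>

lemma Bob_wins:
  assumes wf: "wf (descent X Y)" and matched: "\<And>a. a \<in> X \<Longrightarrow> \<exists>b. stable_pair X Y a b"
  shows "game_win_for Bob X Y"
proof (rule game_win_forI[OF wf])
  let ?G = "insert Empty_Board {Frogs Alice a b | a b. stable_pair X Y a b}"
  show "mover x = opponent Bob" if "x \<in> ?G" for x using that by auto
  show "\<exists>z\<in>legal_moves X Y y. z \<in> ?G" if x: "x \<in> ?G" and y: "y \<in> legal_moves X Y x" for x y
  proof (cases "x = Empty_Board")
    case True
    then show ?thesis using y matched by (fastforce dest: stable_pair_mem(2))
  next
    case False
    then obtain a b a' where ab: "stable_pair X Y a b" and a': "a' \<in> X" "dist a' b < dist a b"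
        and y_eq: "y = Frogs Bob a' b"
      using x y by auto
    have b: "b \<in> Y" using ab by (rule stable_pair_mem)
    have no: "\<not> stable_pair X Y a'' b" if "dist a'' b < dist a b" for a''
      using stable_pair_closest(1)[OF ab] that by fastforce
    show ?thesis
      using wf \<open>a' \<in> X\<close> b no[OF a'(2)]
    proof (cases rule: unstable_pair_cases)
      case (1 a'')
      then show ?thesis using no a'(2) by fastforce
    next
      case (2 b')
      then show ?thesis by (auto simp: y_eq dest: stable_pair_mem(2))
    qed
  qed
qed simp

text \<open>The same reply with the colours exchanged; only the opening differs. As
  \<open>a\<^sub>0\<close> has no partner, its pair with Bob's first point can be unstable only
  because that point has a partner closer than \<open>a\<^sub>0\<close>, and Alice jumps
  there.\<close>

lemma Alice_wins:
  assumes wf: "wf (descent X Y)" and a0: "a\<^sub>0 \<in> X" "\<And>b. \<not> stable_pair X Y a\<^sub>0 b"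
  shows "game_win_for Alice X Y"
proof (rule game_win_forI[OF wf])
  let ?G = "insert (Amber_Placed a\<^sub>0) {Frogs Bob a b | a b. stable_pair X Y a b}"
  show "mover x = opponent Alice" if "x \<in> ?G" for x using that by auto
  show "\<exists>z\<in>legal_moves X Y y. z \<in> ?G" if x: "x \<in> ?G" and y: "y \<in> legal_moves X Y x" for x y
  proof (cases "x = Amber_Placed a\<^sub>0")
    case True
    then obtain b where b: "b \<in> Y" "y = Frogs Alice a\<^sub>0 b" using y by auto
    show ?thesis
      using wf a0(1) b(1) a0(2)[of b]
    proof (cases rule: unstable_pair_cases)
      case (1 a')
      then show ?thesis by (auto simp: b(2) dest: stable_pair_mem(1))
    next
      case (2 b')
      then show ?thesis using a0(2) by blast
    qed
  next
    case False
    then obtain a b b' where ab: "stable_pair X Y a b" and b': "b' \<in> Y" "dist a b' < dist a b"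
        and y_eq: "y = Frogs Alice a b'"
      using x y by auto
    have a: "a \<in> X" using ab by (rule stable_pair_mem)
    have no: "\<not> stable_pair X Y a b''" if "dist a b'' < dist a b" for b''
      using stable_pair_closest(2)[OF ab] that by fastforce
    show ?thesis
      using wf a b'(1) no[OF b'(2)]
    proof (cases rule: unstable_pair_cases)
      case (1 a')
      then show ?thesis by (auto simp: y_eq dest: stable_pair_mem(1))
    next
      case (2 b'')
      then show ?thesis using no b'(2) by fastforce
    qed
  qed
qed (use a0 in auto)

section \<open>Discretisation\<close>

text \<open>The lower corner of the half-open dyadic cube of side \<open>1 / 2 ^ n\<close>
  containing \<open>x\<close>; the corner stands for the whole cube.\<close>

definition cell :: "nat \<Rightarrow> real ^ 'd \<Rightarrow> real ^ 'd" where
  "cell n x = (\<chi> i. of_int \<lfloor>2 ^ n * x $ i\<rfloor> / 2 ^ n)"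

definition grid :: "nat \<Rightarrow> (real ^ 'd) set" where
  "grid n = {q. \<forall>i. 2 ^ n * q $ i \<in> \<int>}"

lemma cell_component [simp]: "cell n x $ i = of_int \<lfloor>2 ^ n * x $ i\<rfloor> / 2 ^ n"
  by (simp add: cell_def)

lemma cell_in_grid [simp]: "cell n x \<in> grid n"
  by (simp add: grid_def)

lemma cell_grid: "q \<in> grid n \<Longrightarrow> cell n q = q"
proof (subst vec_eq_iff, rule allI)
  fix i assume "q \<in> grid n"
  then have "2 ^ n * q $ i \<in> \<int>" by (simp add: grid_def)
  then obtain k where k: "2 ^ n * q $ i = of_int k" by (elim Ints_cases)
  then show "cell n q $ i = q $ i" by (simp add: field_simps)
qed

lemma grid_add: "p \<in> grid n \<Longrightarrow> q \<in> grid n \<Longrightarrow> p + q \<in> grid n"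
  by (simp add: grid_def distrib_left)

lemma grid_diff: "p \<in> grid n \<Longrightarrow> q \<in> grid n \<Longrightarrow> p - q \<in> grid n"
  by (simp add: grid_def right_diff_distrib)

text \<open>Dyadic cubes refine unit cubes, so rounding a point does not change the unit cell in
  which the mass transport counts it.\<close>

lemma cell_zero_cell: "cell 0 (cell n x) = cell 0 x"
proof -
  have "\<lfloor>of_int \<lfloor>2 ^ n * t\<rfloor> / (2 ^ n :: real)\<rfloor> = \<lfloor>t\<rfloor>" for t :: real
  proof (rule floor_unique)
    have "(2 ^ n * \<lfloor>t\<rfloor> :: int) \<le> \<lfloor>2 ^ n * t\<rfloor>"
      by (simp add: le_floor_iff)
    then have "(of_int (2 ^ n * \<lfloor>t\<rfloor>) :: real) \<le> of_int \<lfloor>2 ^ n * t\<rfloor>"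
      by (simp only: of_int_le_iff)
    then show "of_int \<lfloor>t\<rfloor> \<le> (of_int \<lfloor>2 ^ n * t\<rfloor> / 2 ^ n :: real)"
      by (simp add: field_simps)
    have "of_int \<lfloor>2 ^ n * t\<rfloor> \<le> 2 ^ n * t" by simp
    also have "\<dots> < 2 ^ n * (of_int \<lfloor>t\<rfloor> + 1)" by (rule mult_strict_left_mono) (linarith, simp)
    finally show "(of_int \<lfloor>2 ^ n * t\<rfloor> / 2 ^ n :: real) < of_int \<lfloor>t\<rfloor> + 1"
      by (simp add: field_simps)
  qed
  then show ?thesis by (simp add: vec_eq_iff)
qed

lemma cell_zero_add: "t \<in> grid 0 \<Longrightarrow> cell 0 (x + t) = cell 0 x + t"
  by (auto simp: grid_def vec_eq_iff elim!: Ints_cases)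

text \<open>The Euclidean norm is at most the sum of the absolute coordinates, each at most the
  mesh; hence the factor \<open>CARD('d)\<close>.\<close>

lemma dist_cell: "dist (cell n x) x \<le> CARD('d) / 2 ^ n" for x :: "real ^ 'd"
proof -
  have "\<bar>(cell n x - x) $ i\<bar> \<le> 1 / 2 ^ n" for i
  proof -
    have "\<bar>of_int \<lfloor>2 ^ n * x $ i\<rfloor> - 2 ^ n * x $ i\<bar> \<le> (1 :: real)" by linarith
    then have "\<bar>of_int \<lfloor>2 ^ n * x $ i\<rfloor> - 2 ^ n * x $ i\<bar> / 2 ^ n \<le> (1 :: real) / 2 ^ n"
      by (intro divide_right_mono) auto
    moreover have "(cell n x - x) $ i = (of_int \<lfloor>2 ^ n * x $ i\<rfloor> - 2 ^ n * x $ i) / 2 ^ n"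
      by (simp add: field_simps)
    ultimately show ?thesis by (simp add: abs_divide)
  qed
  then have "(\<Sum>i\<in>UNIV. \<bar>(cell n x - x) $ i\<bar>) \<le> (\<Sum>i\<in>(UNIV :: 'd set). 1 / 2 ^ n)"
    by (intro sum_mono)
  then show ?thesis
    using norm_le_l1_cart[of "cell n x - x"] by (simp add: dist_norm)
qed

lemma tendsto_mesh: "(\<lambda>n. c / 2 ^ n) \<longlonglongrightarrow> (0 :: real)"
  using tendsto_mult[OF tendsto_const[of c] LIMSEQ_inverse_realpow_zero[of 2]]
  by (simp add: divide_inverse power_inverse)

lemma tendsto_cell: "(\<lambda>n. cell n x) \<longlonglongrightarrow> x" for x :: "real ^ 'd"
  by (rule metric_tendsto_imp_tendsto[OF tendsto_mesh[of "CARD('d)"]])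
     (auto simp: dist_cell intro!: always_eventually)

lemma countable_grid: "countable (grid n :: (real ^ 'd) set)"
proof (rule countable_subset)
  show "grid n \<subseteq> range (\<lambda>f :: 'd \<Rightarrow> int. \<chi> i. of_int (f i) / 2 ^ n :: real ^ 'd)"
  proof
    fix q :: "real ^ 'd" assume "q \<in> grid n"
    then have "q = (\<chi> i. of_int \<lfloor>2 ^ n * q $ i\<rfloor> / 2 ^ n)"
      using cell_grid[of q n] by (simp add: cell_def)
    then show "q \<in> range (\<lambda>f :: 'd \<Rightarrow> int. \<chi> i. of_int (f i) / 2 ^ n :: real ^ 'd)"
      by (rule image_eqI[where x = "\<lambda>i. \<lfloor>2 ^ n * q $ i\<rfloor>"]) simp
  qed
qed simp

lemma finite_grid_bounded:
  assumes "bounded B" shows "finite (grid n \<inter> B :: (real ^ 'd) set)"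
proof -
  obtain R where R: "\<And>x. x \<in> B \<Longrightarrow> norm x \<le> R" using assms by (auto simp: bounded_iff)
  define N where "N = \<lceil>2 ^ n * R\<rceil>"
  let ?f = "\<lambda>f :: 'd \<Rightarrow> int. \<chi> i. of_int (f i) / 2 ^ n :: real ^ 'd"
  have "grid n \<inter> B \<subseteq> ?f ` (PiE UNIV (\<lambda>_. {- N - 1..N}))"
  proof
    fix q :: "real ^ 'd" assume q: "q \<in> grid n \<inter> B"
    then have "q = ?f (\<lambda>i. \<lfloor>2 ^ n * q $ i\<rfloor>)"
      using cell_grid[of q n] by (simp add: cell_def)
    moreover have "\<lfloor>2 ^ n * q $ i\<rfloor> \<in> {- N - 1..N}" for i
    proof -
      have "\<bar>q $ i\<bar> \<le> R" using R[of q] q component_le_norm_cart[of q i] by simp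
      then have "\<bar>2 ^ n * q $ i\<bar> \<le> 2 ^ n * R" by (simp add: abs_mult)
      then show ?thesis unfolding N_def atLeastAtMost_iff by linarith
    qed
    ultimately show "q \<in> ?f ` (PiE UNIV (\<lambda>_. {- N - 1..N}))" by (intro image_eqI) auto
  qed
  then show ?thesis by (rule finite_subset) (auto intro!: finite_imageI finite_PiE)
qed

text \<open>The cut-off leaves only finitely many possible values for each \<open>n\<close>, which
  makes functions of \<open>discr n\<close> measurable; it recedes with \<open>n\<close>, so every
  point is seen eventually.\<close>

definition discr :: "nat \<Rightarrow> (real ^ 'd) set \<Rightarrow> (real ^ 'd) set" where
  "discr n X = {q \<in> cell n ` X. norm q \<le> n}"

lemma discr_subset: "discr n X \<subseteq> grid n \<inter> cball 0 n"
  by (auto simp: discr_def)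

lemma eventually_cell_in_discr:
  assumes "x \<in> X" shows "\<forall>\<^sub>F n in sequentially. cell n x \<in> discr n X"
proof -
  have "\<forall>\<^sub>F n in sequentially. norm (cell n x) < norm x + 1"
    using tendsto_norm[OF tendsto_cell[of x]] by (rule order_tendstoD) simp
  moreover have "\<forall>\<^sub>F n in sequentially. norm x + 1 \<le> real n"
    using filterlim_real_sequentially by (simp add: filterlim_at_top)
  ultimately show ?thesis
  proof eventually_elim
    case (elim n)
    then show ?case using assms by (auto simp: discr_def)
  qed
qed

text \<open>Rounding preserves a strict inequality between distances once the mesh is fine, but it
  may turn an equality into an inequality. Excluding ties lets stability survive rounding and makes
  partners unique.\<close>

definition no_ties :: "'a::metric_space set \<Rightarrow> 'a set \<Rightarrow> bool" where
  "no_ties X Y \<longleftrightarrow> (\<forall>b\<in>Y. inj_on (\<lambda>a. dist a b) X) \<and> (\<forall>a\<in>X. inj_on (\<lambda>b. dist a b) Y)"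

lemma locally_finite_bounded:
  assumes "locally_finite_set X" "bounded {x. P x}" shows "finite {x \<in> X. P x}"
  using assms by (auto simp: locally_finite_set_def Collect_conj_eq)

lemma bounded_dist_le: "bounded {x. dist x b \<le> r}"
  by (rule bounded_subset[OF bounded_cball[of b r]]) (auto simp: dist_commute)

text \<open>Local finiteness separates the distances to \<open>b\<close> that exceed \<open>dist a b\<close> from it.\<close>

lemma eventually_cell_closer:
  fixes X :: "(real ^ 'd) set"
  assumes "locally_finite_set X"
  shows "\<forall>\<^sub>F n in sequentially. \<forall>a'\<in>X.
    dist (cell n a') (cell n b) < dist (cell n a) (cell n b) \<longrightarrow> dist a' b \<le> dist a b"
proof -
  \<comment> \<open>Comparing two rounded distances involves four roundings of less than 1/4 each,
    so whatever looks closer after rounding lies within the extra radius 1, in a finite set.\<close>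
  define T where "T = {a' \<in> X. dist a' b \<le> dist a b + 1}"
  have T: "finite T"
    unfolding T_def using assms bounded_dist_le by (rule locally_finite_bounded)
  have "\<forall>\<^sub>F n in sequentially. \<forall>a'\<in>T.
      dist (cell n a') (cell n b) < dist (cell n a) (cell n b) \<longrightarrow> dist a' b \<le> dist a b"
    unfolding eventually_ball_finite_distrib[OF T]
  proof
    fix a' assume "a' \<in> T"
    show "\<forall>\<^sub>F n in sequentially. dist (cell n a') (cell n b) < dist (cell n a) (cell n b) \<longrightarrow> dist a' b \<le> dist a b"
    proof (cases "dist a' b \<le> dist a b")
      case False
      have "(\<lambda>n. dist (cell n a') (cell n b) - dist (cell n a) (cell n b)) \<longlonglongrightarrow> dist a' b - dist a b"
        by (intro tendsto_intros tendsto_cell)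
      then have "\<forall>\<^sub>F n in sequentially. 0 < dist (cell n a') (cell n b) - dist (cell n a) (cell n b)"
        by (rule order_tendstoD) (use False in simp)
      then show ?thesis by eventually_elim simp
    qed simp
  qed
  moreover have "\<forall>\<^sub>F n in sequentially. CARD('d) / 2 ^ n < (1 / 4 :: real)"
    using tendsto_mesh by (rule order_tendstoD) simp
  ultimately show ?thesis
  proof eventually_elim
    case (elim n)
    show ?case
    proof (intro ballI impI)
      fix a' assume a': "a' \<in> X" "dist (cell n a') (cell n b) < dist (cell n a) (cell n b)"
      have "dist a' b \<le> dist a b + 1"
        using a'(2) elim(2) dist_cell[of n a] dist_cell[of n a'] dist_cell[of n b]
          dist_triangle[of a' b "cell n a'"] dist_triangle[of "cell n a'" b "cell n b"]
          dist_triangle[of "cell n a" "cell n b" a] dist_triangle[of a "cell n b" b]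
          dist_commute[of "cell n a'" a'] dist_commute[of "cell n b" b]
        by linarith
      then show "dist a' b \<le> dist a b" using elim(1) a' by (auto simp: T_def)
    qed
  qed
qed

lemma eventually_cell_dist_less:
  assumes "dist a' b' < dist a b"
  shows "\<forall>\<^sub>F n in sequentially. dist (cell n a') (cell n b') < dist (cell n a) (cell n b)"
proof -
  have "(\<lambda>n. dist (cell n a) (cell n b) - dist (cell n a') (cell n b')) \<longlonglongrightarrow> dist a b - dist a' b'"
    by (intro tendsto_intros tendsto_cell)
  then have "\<forall>\<^sub>F n in sequentially. 0 < dist (cell n a) (cell n b) - dist (cell n a') (cell n b')"
    by (rule order_tendstoD) (use assms in simp)
  then show ?thesis by eventually_elim simp
qed

text \<open>Both predicates persist by induction on their derivations. A stable pair has only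
  finitely many closer competitors by local finiteness, so their eventual instability holds at a
  common \<open>n\<close>; instability needs a single witness.\<close>

lemma stable_pair_discr:
  fixes X Y :: "(real ^ 'd) set"
  assumes X: "locally_finite_set X" and Y: "locally_finite_set Y" and ties: "no_ties X Y"
  shows "(stable_pair X Y a b \<longrightarrow>
       (\<forall>\<^sub>F n in sequentially. stable_pair (discr n X) (discr n Y) (cell n a) (cell n b))) \<and>
     (unstable_pair X Y c d \<longrightarrow>
       (\<forall>\<^sub>F n in sequentially. unstable_pair (discr n X) (discr n Y) (cell n c) (cell n d)))"
proof (induction rule: stable_pair_unstable_pair.induct)
  case (stable_pairI a b)
  have fin: "finite {a' \<in> X. dist a' b < dist a b}" "finite {b' \<in> Y. dist a b' < dist a b}"
    by (rule locally_finite_bounded[OF X bounded_subset[OF bounded_dist_le[of b "dist a b"]]])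
       (auto intro!: locally_finite_bounded[OF Y bounded_subset[OF bounded_dist_le[of a "dist a b"]]]
         simp: dist_commute)
  have "\<forall>\<^sub>F n in sequentially. \<forall>a'\<in>{a' \<in> X. dist a' b < dist a b}.
      unstable_pair (discr n X) (discr n Y) (cell n a') (cell n b)"
    unfolding eventually_ball_finite_distrib[OF fin(1)] using stable_pairI(4) by blast
  moreover have "\<forall>\<^sub>F n in sequentially. \<forall>b'\<in>{b' \<in> Y. dist a b' < dist a b}.
      unstable_pair (discr n X) (discr n Y) (cell n a) (cell n b')"
    unfolding eventually_ball_finite_distrib[OF fin(2)] using stable_pairI(6) by blast
  ultimately show ?case
    using eventually_cell_closer[OF X, of b a] eventually_cell_closer[OF Y, of a b]
      eventually_cell_in_discr[OF \<open>a \<in> X\<close>] eventually_cell_in_discr[OF \<open>b \<in> Y\<close>]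
  proof eventually_elim
    case (elim n)
    show ?case
    proof (rule stable_pair_unstable_pair.stable_pairI)
      fix p assume "p \<in> discr n X" and less: "dist p (cell n b) < dist (cell n a) (cell n b)"
      then obtain a' where a': "a' \<in> X" "p = cell n a'" by (auto simp: discr_def)
      then have "dist a' b \<le> dist a b" using elim(3) less by simp
      \<comment> \<open>Without ties, equality would give \<open>a' = a\<close>, and then the two
        rounded distances in \<open>less\<close> would coincide.\<close>
      moreover have "dist a' b \<noteq> dist a b"
        using ties a' less stable_pairI(1,2) by (auto simp: no_ties_def inj_on_def)
      ultimately show "unstable_pair (discr n X) (discr n Y) p (cell n b)"
        using elim(1) a' by simp
    next
      fix p assume "p \<in> discr n Y" and less: "dist (cell n a) p < dist (cell n a) (cell n b)"
      then obtain b' where b': "b' \<in> Y" "p = cell n b'" by (auto simp: discr_def)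
      then have "dist a b' \<le> dist a b" using elim(4) less by (metis dist_commute)
      moreover have "dist a b' \<noteq> dist a b"
        using inj_onD[of "\<lambda>b. dist a b" Y b' b] ties b' less stable_pairI(1,2)
        by (auto simp: no_ties_def)
      ultimately show "unstable_pair (discr n X) (discr n Y) (cell n a) p"
        using elim(2) b' by simp
    qed (use elim in auto)
  qed
next
  case (unstable_pair_left a' b a)
  show ?case
    using unstable_pair_left(2) eventually_cell_dist_less[OF unstable_pair_left(5)]
      eventually_cell_in_discr[OF unstable_pair_left(3)]
      eventually_cell_in_discr[OF unstable_pair_left(4)]
    by eventually_elim (rule stable_pair_unstable_pair.unstable_pair_left)
next
  case (unstable_pair_right a b' b)
  show ?case
    using unstable_pair_right(2) eventually_cell_dist_less[OF unstable_pair_right(5)]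
      eventually_cell_in_discr[OF unstable_pair_right(3)]
      eventually_cell_in_discr[OF unstable_pair_right(4)]
    by eventually_elim (rule stable_pair_unstable_pair.unstable_pair_right)
qed

text \<open>Its cardinality is the mass sent from the unit cell \<open>z\<close> to the unit cell
  \<open>w\<close> when every matched point of \<open>X\<close> gives one unit to its
  partner.\<close>

definition cell_pairs ::
    "real ^ 'd \<Rightarrow> real ^ 'd \<Rightarrow> (real ^ 'd) set \<Rightarrow> (real ^ 'd) set \<Rightarrow> ((real ^ 'd) \<times> (real ^ 'd)) set" where
  "cell_pairs z w X Y = {(a, b). stable_pair X Y a b \<and> cell 0 a = z \<and> cell 0 b = w}"

lemma bounded_cell: "bounded {x. cell n x = q}" for q :: "real ^ 'd"
  by (rule bounded_subset[OF bounded_cball[of q "CARD('d) / 2 ^ n"]]) (auto simp: dist_cell)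

lemma finite_points_in_cell: "locally_finite_set X \<Longrightarrow> finite {x \<in> X. cell n x = q}"
  by (rule locally_finite_bounded[OF _ bounded_cell])

lemma eventually_inj_on_cell:
  assumes "finite A" shows "\<forall>\<^sub>F n in sequentially. inj_on (cell n) A"
proof -
  have "\<forall>\<^sub>F n in sequentially. \<forall>p\<in>A \<times> A. cell n (fst p) = cell n (snd p) \<longrightarrow> fst p = snd p"
    unfolding eventually_ball_finite_distrib[OF finite_cartesian_product[OF assms assms]]
  proof
    fix p assume "p \<in> A \<times> A"
    show "\<forall>\<^sub>F n in sequentially. cell n (fst p) = cell n (snd p) \<longrightarrow> fst p = snd p"
    proof (cases "fst p = snd p")
      case False
      then have "0 < dist (fst p) (snd p)" by simp
      then have "\<forall>\<^sub>F n in sequentially. 0 < dist (cell n (fst p)) (cell n (snd p))"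
        using tendsto_dist[OF tendsto_cell tendsto_cell] order_tendstoD(1) by blast
      then show ?thesis by eventually_elim auto
    qed simp
  qed
  then show ?thesis by eventually_elim (auto simp: inj_on_def)
qed

text \<open>Failure of stability is passed to the rounded sets in the positive form of instability,
  which \<open>wf\<close> supplies. Injectivity of rounding on the finitely many points of the two
  unit cells then keeps the counts equal.\<close>

lemma eventually_card_cell_pairs:
  fixes X Y :: "(real ^ 'd) set"
  assumes X: "locally_finite_set X" and Y: "locally_finite_set Y"
    and ties: "no_ties X Y" and wf: "wf (descent X Y)"
  shows "\<forall>\<^sub>F n in sequentially.
    card (cell_pairs z w (discr n X) (discr n Y)) = card (cell_pairs z w X Y)"
proof -
  define A where "A = {a \<in> X. cell 0 a = z}"
  define B where "B = {b \<in> Y. cell 0 b = w}"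
  have fin: "finite A" "finite B"
    unfolding A_def B_def using X Y by (auto intro: finite_points_in_cell)
  have "\<forall>\<^sub>F n in sequentially. \<forall>p\<in>A \<times> B.
     stable_pair (discr n X) (discr n Y) (cell n (fst p)) (cell n (snd p)) \<longleftrightarrow>
       stable_pair X Y (fst p) (snd p)"
    unfolding eventually_ball_finite_distrib[OF finite_cartesian_product[OF fin]]
  proof
    fix p assume "p \<in> A \<times> B"
    then have p: "fst p \<in> X" "snd p \<in> Y" by (auto simp: A_def B_def)
    show "\<forall>\<^sub>F n in sequentially.
       stable_pair (discr n X) (discr n Y) (cell n (fst p)) (cell n (snd p)) \<longleftrightarrow>
         stable_pair X Y (fst p) (snd p)"
    proof (cases "stable_pair X Y (fst p) (snd p)")
      case True
      then have "\<forall>\<^sub>F n in sequentially. stable_pair (discr n X) (discr n Y) (cell n (fst p)) (cell n (snd p))"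
        using stable_pair_discr[OF X Y ties] by blast
      then show ?thesis by eventually_elim (use True in simp)
    next
      case False
      then have "\<forall>\<^sub>F n in sequentially. unstable_pair (discr n X) (discr n Y) (cell n (fst p)) (cell n (snd p))"
        using stable_or_unstable[OF wf p] stable_pair_discr[OF X Y ties] by blast
      then show ?thesis
        by eventually_elim (use False stable_unstable_exclusive in blast)
    qed
  qed
  then show ?thesis
    using eventually_inj_on_cell[OF fin(1)] eventually_inj_on_cell[OF fin(2)]
  proof eventually_elim
    case (elim n)
    have "cell_pairs z w (discr n X) (discr n Y) = map_prod (cell n) (cell n) ` cell_pairs z w X Y"
    proof (intro set_eqI iffI)
      fix r assume "r \<in> cell_pairs z w (discr n X) (discr n Y)"
      then obtain p q where r: "r = (p, q)" and pq: "stable_pair (discr n X) (discr n Y) p q"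
          "cell 0 p = z" "cell 0 q = w"
        by (auto simp: cell_pairs_def)
      then obtain a b where "a \<in> X" "p = cell n a" "b \<in> Y" "q = cell n b"
        using stable_pair_mem[OF pq(1)] by (auto simp: discr_def)
      then show "r \<in> map_prod (cell n) (cell n) ` cell_pairs z w X Y"
        using r pq elim(1)
        by (intro image_eqI[where x = "(a, b)"]) (auto simp: cell_pairs_def A_def B_def cell_zero_cell)
    next
      fix r assume "r \<in> map_prod (cell n) (cell n) ` cell_pairs z w X Y"
      then show "r \<in> cell_pairs z w (discr n X) (discr n Y)"
        using elim(1) stable_pair_mem[of X Y]
        by (fastforce simp: cell_pairs_def A_def B_def cell_zero_cell)
    qed
    moreover have "inj_on (map_prod (cell n) (cell n)) (cell_pairs z w X Y)"
      using map_prod_inj_on[OF elim(2,3)]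
      by (rule inj_on_subset) (auto simp: cell_pairs_def A_def B_def dest: stable_pair_mem)
    ultimately show ?case by (simp add: card_image)
  qed
qed

section \<open>Configurations and Poisson processes\<close>

lemma configurations_generator:
  "{{X. locally_finite_set X \<and> card (X \<inter> A) = k} | A k. A \<in> sets borel \<and> bounded A}
    \<subseteq> Pow {X. locally_finite_set X}"
  by auto

lemma space_configurations: "space configurations = {X. locally_finite_set X}"
  unfolding configurations_def by (rule space_measure_of[OF configurations_generator])

lemma sets_configurations:
  "sets configurations = sigma_sets {X. locally_finite_set X}
     {{X. locally_finite_set X \<and> card (X \<inter> A) = k} | A k. A \<in> sets borel \<and> bounded A}"
  unfolding configurations_def by (rule sets_measure_of[OF configurations_generator])

lemma measurable_card_Int:
  assumes "A \<in> sets borel" "bounded A"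
  shows "(\<lambda>X. card (X \<inter> A)) \<in> measurable configurations (count_space UNIV)"
proof (subst measurable_count_space_eq2_countable, safe)
  fix k
  have "(\<lambda>X. card (X \<inter> A)) -` {k} \<inter> space configurations = {X. locally_finite_set X \<and> card (X \<inter> A) = k}"
    by (auto simp: space_configurations)
  also have "\<dots> \<in> sets configurations"
    unfolding sets_configurations using assms by (intro sigma_sets.Basic) blast
  finally show "(\<lambda>X. card (X \<inter> A)) -` {k} \<inter> space configurations \<in> sets configurations" .
qed auto

lemma measurable_configurationsI:
  fixes f :: "'a \<Rightarrow> 'b::euclidean_space set"
  assumes lf: "\<And>\<omega>. \<omega> \<in> space N \<Longrightarrow> locally_finite_set (f \<omega>)"
    and card: "\<And>A. A \<in> sets borel \<Longrightarrow> bounded A \<Longrightarrow>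
      (\<lambda>\<omega>. card (f \<omega> \<inter> A)) \<in> measurable N (count_space UNIV)"
  shows "f \<in> measurable N configurations"
proof (rule measurable_sigma_sets[OF sets_configurations configurations_generator])
  fix U :: "'b set set"
  assume "U \<in> {{X. locally_finite_set X \<and> card (X \<inter> A) = k} | A k. A \<in> sets borel \<and> bounded A}"
  then obtain A k where A: "A \<in> sets borel" "bounded A"
    and U: "U = {X. locally_finite_set X \<and> card (X \<inter> A) = k}" by blast
  have "f -` U \<inter> space N = (\<lambda>\<omega>. card (f \<omega> \<inter> A)) -` {k} \<inter> space N"
    using lf by (auto simp: U)
  then show "f -` U \<inter> space N \<in> sets N"
    using measurable_sets[OF card[OF A], of "{k}"] by simp
qed (auto simp: lf)

section \<open>Cells: measurability, volume and occupation\<close>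

lemma measurable_cart_nth: "(\<lambda>x :: real ^ 'd. x $ i) \<in> borel_measurable borel"
  by (intro borel_measurable_continuous_onI continuous_intros)

lemma cell_eq_iff:
  assumes "q \<in> grid n"
  shows "cell n x = q \<longleftrightarrow> (\<forall>i. q $ i \<le> x $ i \<and> x $ i < q $ i + 1 / 2 ^ n)"
proof -
  have "of_int \<lfloor>2 ^ n * x $ i\<rfloor> / 2 ^ n = q $ i \<longleftrightarrow> q $ i \<le> x $ i \<and> x $ i < q $ i + 1 / 2 ^ n" for i
  proof -
    have "2 ^ n * q $ i \<in> \<int>" using assms by (simp add: grid_def)
    then obtain k where k: "2 ^ n * q $ i = of_int k" by (elim Ints_cases)
    then have q: "q $ i = of_int k / 2 ^ n" by (simp add: field_simps)
    have "of_int \<lfloor>2 ^ n * x $ i\<rfloor> / 2 ^ n = q $ i \<longleftrightarrow> \<lfloor>2 ^ n * x $ i\<rfloor> = k"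
      by (simp add: q)
    also have "\<dots> \<longleftrightarrow> of_int k \<le> 2 ^ n * x $ i \<and> 2 ^ n * x $ i < of_int k + 1"
      by (rule floor_eq_iff)
    also have "\<dots> \<longleftrightarrow> q $ i \<le> x $ i \<and> x $ i < q $ i + 1 / 2 ^ n"
      by (simp add: q field_simps)
    finally show ?thesis .
  qed
  then show ?thesis by (auto simp: vec_eq_iff)
qed

lemma cell_vimage_borel: "{x. cell n x = q} \<in> sets (borel :: (real ^ 'd) measure)"
proof (cases "q \<in> grid n")
  case True
  have [measurable]: "(\<lambda>x :: real ^ 'd. x $ i) \<in> borel_measurable borel" for i
    by (rule measurable_cart_nth)
  show ?thesis unfolding cell_eq_iff[OF True] by measurable
next
  case False
  then have "{x. cell n x = q} = {}" using cell_in_grid by auto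
  then show ?thesis by simp
qed

lemma measure_cell:
  fixes q :: "real ^ 'd"
  assumes "q \<in> grid n"
  shows "measure lborel {x. cell n x = q} = (1 / 2 ^ n) ^ CARD('d)"
proof -
  define u :: "real ^ 'd" where "u = q + (\<chi> i. 1 / 2 ^ n)"
  have u: "(u - q) \<bullet> b = 1 / 2 ^ n" if "b \<in> Basis" for b
    using that by (auto simp: u_def Basis_vec_def inner_axis)
  have le: "q \<bullet> b \<le> u \<bullet> b" if "b \<in> Basis" for b
  proof -
    have "0 \<le> 1 / (2 ^ n :: real)" by simp
    then show ?thesis using u[OF that] unfolding inner_diff_left by linarith
  qed
  have vol: "(\<Prod>b\<in>Basis. (u - q) \<bullet> b) = (1 / 2 ^ n) ^ CARD('d)"
    using u by simp
  have "box q u \<subseteq> {x. cell n x = q}" "{x. cell n x = q} \<subseteq> cbox q u"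
    unfolding cell_eq_iff[OF assms] by (auto simp: mem_box_cart u_def less_imp_le)
  then have "emeasure lborel (box q u) \<le> emeasure lborel {x. cell n x = q}"
      "emeasure lborel {x. cell n x = q} \<le> emeasure lborel (cbox q u)"
    using cell_vimage_borel[of n q] by (auto intro!: emeasure_mono)
  then have "emeasure lborel {x. cell n x = q} = ennreal ((1 / 2 ^ n) ^ CARD('d))"
    using emeasure_lborel_box[OF le] emeasure_lborel_cbox[OF le] vol by (intro antisym) simp_all
  then show ?thesis by (simp add: measure_def)
qed

lemma occupied_iff_card:
  assumes "locally_finite_set X" "bounded A"
  shows "0 < card (X \<inter> A) \<longleftrightarrow> (\<exists>x\<in>X. x \<in> A)"
  using assms by (auto simp: locally_finite_set_def card_gt_0_iff)

lemma occupied_measurable: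
  assumes "A \<in> sets borel" "bounded A"
  shows "Measurable.pred configurations (\<lambda>X. \<exists>x\<in>X. x \<in> A)"
proof -
  have "Measurable.pred configurations (\<lambda>X. card (X \<inter> A) \<in> {0<..})"
    using measurable_card_Int[OF assms] by simp
  then show ?thesis
    by (rule measurable_cong[THEN iffD1, rotated])
       (simp add: occupied_iff_card assms(2) space_configurations)
qed

definition occupied :: "nat \<Rightarrow> (real ^ 'd) set \<Rightarrow> (real ^ 'd) set set" where
  "occupied n Q = {X. locally_finite_set X \<and> (\<forall>q\<in>Q. \<exists>x\<in>X. cell n x = q)}"

lemma occupied_sets:
  assumes "finite Q" shows "occupied n Q \<in> sets configurations"
proof -
  have "Measurable.pred configurations (\<lambda>X. \<forall>q\<in>Q. \<exists>x\<in>X. x \<in> {x. cell n x = q})"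
    using assms by (intro pred_intros_finite occupied_measurable cell_vimage_borel bounded_cell)
  then show ?thesis
    by (simp add: pred_def occupied_def space_configurations)
qed

context prob_space
begin

lemma poisson_process_measurable: "poisson_process M r L \<Longrightarrow> L \<in> measurable M configurations"
  by (simp add: poisson_process_def)

lemma poisson_process_locally_finite:
  "poisson_process M r L \<Longrightarrow> \<omega> \<in> space M \<Longrightarrow> locally_finite_set (L \<omega>)"
  using measurable_space[OF poisson_process_measurable] by (auto simp: space_configurations)

lemma poisson_process_card_measurable:
  assumes "poisson_process M r L" "A \<in> sets borel" "bounded A"
  shows "(\<lambda>\<omega>. card (L \<omega> \<inter> A)) \<in> measurable M (count_space UNIV)"
  using measurable_compose[OF poisson_process_measurable measurable_card_Int] assms by blast

text \<open>\<open>poisson_process\<close> grants independence for families indexed by an initial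
  segment, so a finite index set is enumerated by \<open>h\<close>. The sets \<open>S i\<close> of
  counts are general because occupied cells ask for positive counts and the determination of the law
  for single values.\<close>

lemma poisson_process_joint:
  assumes L: "poisson_process M r L" and I: "finite I"
    and A: "\<And>i. i \<in> I \<Longrightarrow> A i \<in> sets borel" "\<And>i. i \<in> I \<Longrightarrow> bounded (A i)"
    and disj: "disjoint_family_on A I"
  shows "prob {\<omega> \<in> space M. \<forall>i\<in>I. card (L \<omega> \<inter> A i) \<in> S i} =
    (\<Prod>i\<in>I. prob {\<omega> \<in> space M. card (L \<omega> \<inter> A i) \<in> S i})"
proof (cases "I = {}")
  case False
  obtain h where h: "bij_betw h {0..<card I} I" using ex_bij_betw_nat_finite[OF I] by blast
  then have h: "bij_betw h {..<card I} I" by (simp add: lessThan_atLeast0)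
  have hI: "h j \<in> I" if "j < card I" for j using h that by (auto simp: bij_betw_def)
  have "disjoint_family_on (A \<circ> h) {..<card I}"
  proof (unfold disjoint_family_on_def, intro ballI impI)
    fix j k assume jk: "j \<in> {..<card I}" "k \<in> {..<card I}" "j \<noteq> k"
    then have "h j \<noteq> h k" using h by (auto simp: bij_betw_def inj_on_def)
    then show "(A \<circ> h) j \<inter> (A \<circ> h) k = {}"
      using disj jk hI by (auto simp: disjoint_family_on_def)
  qed
  moreover have "\<forall>j<card I. (A \<circ> h) j \<in> sets borel \<and> bounded ((A \<circ> h) j)"
    using A hI by simp
  ultimately have ind: "indep_vars (\<lambda>_. count_space UNIV) (\<lambda>j \<omega>. card (L \<omega> \<inter> (A \<circ> h) j)) {..<card I}"
    using L unfolding poisson_process_def by blast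
  have "{\<omega> \<in> space M. \<forall>i\<in>I. card (L \<omega> \<inter> A i) \<in> S i} =
      (\<Inter>j\<in>{..<card I}. (\<lambda>\<omega>. card (L \<omega> \<inter> (A \<circ> h) j)) -` S (h j) \<inter> space M)"
  proof -
    have ball: "(\<forall>i\<in>I. P i) \<longleftrightarrow> (\<forall>j<card I. P (h j))" for P
      using hI bij_betw_imp_surj_on[OF h] by (metis imageE lessThan_iff)
    have "0 < card I" using False I by (simp add: card_gt_0_iff)
    then show ?thesis unfolding ball by (auto simp: lessThan_empty_iff)
  qed
  also have "prob \<dots> = (\<Prod>j\<in>{..<card I}. prob ((\<lambda>\<omega>. card (L \<omega> \<inter> (A \<circ> h) j)) -` S (h j) \<inter> space M))"
    using False I by (intro indep_varsD_finite[OF ind]) (auto simp: lessThan_empty_iff)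
  also have "\<dots> = (\<Prod>j\<in>{..<card I}. prob {\<omega> \<in> space M. card (L \<omega> \<inter> A (h j)) \<in> S (h j)})"
    by (intro prod.cong refl arg_cong[where f = prob]) auto
  also have "\<dots> = (\<Prod>i\<in>I. prob {\<omega> \<in> space M. card (L \<omega> \<inter> A i) \<in> S i})"
    by (rule prod.reindex_bij_betw[OF h])
  finally show ?thesis .
qed (simp add: prob_space)

lemma poisson_process_occupied_le:
  assumes L: "poisson_process M r L" and A: "A \<in> sets borel" "bounded A"
  shows "prob {\<omega> \<in> space M. card (L \<omega> \<inter> A) \<in> {0<..}} \<le> r * measure lborel A"
proof -
  note [measurable] = poisson_process_card_measurable[OF L A]
  have "prob {\<omega> \<in> space M. card (L \<omega> \<inter> A) = 0} = exp (- (r * measure lborel A))"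
    using L A unfolding poisson_process_def by fastforce
  moreover have "prob {\<omega> \<in> space M. card (L \<omega> \<inter> A) \<in> {0<..}} = 1 - prob {\<omega> \<in> space M. card (L \<omega> \<inter> A) = 0}"
    using prob_neg[of "\<lambda>\<omega>. card (L \<omega> \<inter> A) = 0"] by simp
  ultimately show ?thesis using exp_ge_add_one_self[of "- (r * measure lborel A)"] by simp
qed

lemma poisson_process_occupied:
  fixes L :: "'a \<Rightarrow> (real ^ 'd) set"
  assumes L: "poisson_process M r L" and Q: "finite Q" "Q \<subseteq> grid n"
  shows "prob (L -` occupied n Q \<inter> space M) \<le> (r * (1 / 2 ^ n) ^ CARD('d)) ^ card Q"
proof -
  let ?A = "\<lambda>q. {x. cell n x = q}"
  have "L -` occupied n Q \<inter> space M = {\<omega> \<in> space M. \<forall>q\<in>Q. card (L \<omega> \<inter> ?A q) \<in> {0<..}}"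
    using poisson_process_locally_finite[OF L]
    by (auto simp: occupied_def occupied_iff_card[OF _ bounded_cell])
  also have "prob \<dots> = (\<Prod>q\<in>Q. prob {\<omega> \<in> space M. card (L \<omega> \<inter> ?A q) \<in> {0<..}})"
    using Q by (intro poisson_process_joint[OF L] cell_vimage_borel bounded_cell)
      (auto simp: disjoint_family_on_def)
  also have "\<dots> \<le> (\<Prod>q\<in>Q. r * (1 / 2 ^ n) ^ CARD('d))"
  proof (intro prod_mono conjI measure_nonneg)
    fix q assume "q \<in> Q"
    then have "q \<in> grid n" using Q by blast
    then show "prob {\<omega> \<in> space M. card (L \<omega> \<inter> ?A q) \<in> {0<..}} \<le> r * (1 / 2 ^ n) ^ CARD('d)"
      using poisson_process_occupied_le[OF L cell_vimage_borel bounded_cell, of n q]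
      by (simp add: measure_cell)
  qed
  finally show ?thesis by simp
qed

end

section \<open>Occupied cells of two independent processes\<close>

locale poisson_pair = prob_space M for M :: "'w measure" +
  fixes \<alpha> \<beta> :: real and LA LB :: "'w \<Rightarrow> (real ^ 'd::finite) set"
  assumes rates_pos: "0 < \<alpha>" "0 < \<beta>"
    and poisson_LA: "poisson_process M \<alpha> LA"
    and poisson_LB: "poisson_process M \<beta> LB"
    and indep: "indep_var configurations LA configurations LB"

context poisson_pair
begin

lemmas locally_finite = poisson_process_locally_finite[OF poisson_LA]
  poisson_process_locally_finite[OF poisson_LB]

lemmas measurable_LA [measurable] = poisson_process_measurable[OF poisson_LA]
lemmas measurable_LB [measurable] = poisson_process_measurable[OF poisson_LB]

text \<open>The larger rate serves both colours, so that the bound depends only on the total number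
  of cells.\<close>

lemma occupied_pair:
  assumes "finite P" "P \<subseteq> grid n" "finite Q" "Q \<subseteq> grid n"
  shows "prob {\<omega> \<in> space M. LA \<omega> \<in> occupied n P \<and> LB \<omega> \<in> occupied n Q}
    \<le> (max \<alpha> \<beta> * (1 / 2 ^ n) ^ CARD('d)) ^ (card P + card Q)"
proof -
  let ?v = "(1 / 2 ^ n) ^ CARD('d) :: real"
  have "prob {\<omega> \<in> space M. LA \<omega> \<in> occupied n P \<and> LB \<omega> \<in> occupied n Q} =
      prob ((\<lambda>\<omega>. (LA \<omega>, LB \<omega>)) -` (occupied n P \<times> occupied n Q) \<inter> space M)"
    by (intro arg_cong[where f = prob]) auto
  also have "\<dots> = prob (LA -` occupied n P \<inter> space M) * prob (LB -` occupied n Q \<inter> space M)"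
    using assms by (intro indep_varD[OF indep] occupied_sets)
  also have "\<dots> \<le> (\<alpha> * ?v) ^ card P * (\<beta> * ?v) ^ card Q"
    using assms rates_pos
    by (intro mult_mono poisson_process_occupied[OF poisson_LA] poisson_process_occupied[OF poisson_LB]) auto
  also have "\<dots> \<le> (max \<alpha> \<beta> * ?v) ^ card P * (max \<alpha> \<beta> * ?v) ^ card Q"
    using rates_pos by (intro mult_mono power_mono mult_right_mono) auto
  finally show ?thesis by (simp add: power_add)
qed

lemma occupied_pair_event:
  assumes "finite P" "finite Q"
  shows "{\<omega> \<in> space M. LA \<omega> \<in> occupied n P \<and> LB \<omega> \<in> occupied n Q} \<in> events"
proof -
  have "{\<omega> \<in> space M. LA \<omega> \<in> occupied n P \<and> LB \<omega> \<in> occupied n Q} =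
      (LA -` occupied n P \<inter> space M) \<inter> (LB -` occupied n Q \<inter> space M)"
    by auto
  also have "\<dots> \<in> events"
    using assms
    by (intro sets.Int measurable_sets[OF measurable_LA] measurable_sets[OF measurable_LB] occupied_sets)
  finally show ?thesis .
qed

end

lemma (in prob_space) indep_set_commute:
  assumes "indep_set A B" shows "indep_set B A"
  unfolding indep_sets2_eq
proof (intro conjI ballI)
  show "B \<subseteq> events" "A \<subseteq> events" using assms unfolding indep_sets2_eq by blast+
  fix b a assume "b \<in> B" "a \<in> A"
  then have "prob (a \<inter> b) = prob a * prob b" using assms unfolding indep_sets2_eq by blast
  then show "prob (b \<inter> a) = prob b * prob a" by (simp only: Int_commute mult.commute)
qed

lemma (in poisson_pair) swap: "poisson_pair M \<beta> \<alpha> LB LA"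
proof -
  have "indep_var configurations LB configurations LA"
    using indep unfolding indep_var_eq
    by (intro conjI) (elim conjE, (assumption | erule indep_set_commute))+
  then show ?thesis
    using prob_space_axioms rates_pos poisson_LA poisson_LB
    by (intro poisson_pair.intro poisson_pair_axioms.intro)
qed

section \<open>Paths in annuli\<close>

lemma power_diff_le:
  fixes x y :: real
  assumes "0 \<le> y" "y \<le> x" "x \<le> R"
  shows "x ^ k - y ^ k \<le> real k * R ^ (k - 1) * (x - y)"
proof -
  have "y ^ (k - Suc i) * x ^ i \<le> R ^ (k - 1)" if "i < k" for i
  proof -
    have "y ^ (k - Suc i) * x ^ i \<le> R ^ (k - Suc i) * R ^ i"
      using assms by (intro mult_mono power_mono) auto
    also have "\<dots> = R ^ (k - 1)" using that by (simp add: power_add[symmetric])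
    finally show ?thesis .
  qed
  then have "(\<Sum>i<k. y ^ (k - Suc i) * x ^ i) \<le> (\<Sum>i<k. R ^ (k - 1))"
    by (intro sum_mono) auto
  then have "(x - y) * (\<Sum>i<k. y ^ (k - Suc i) * x ^ i) \<le> (x - y) * (real k * R ^ (k - 1))"
    using assms by (intro mult_left_mono) auto
  then show ?thesis by (simp add: power_diff_sumr2 mult.commute mult.left_commute)
qed

lemma bounded_borel_fmeasurable:
  "A \<in> sets borel \<Longrightarrow> bounded A \<Longrightarrow> A \<in> fmeasurable lborel"
  using emeasure_bounded_finite by (intro fmeasurableI) auto

lemma norm_annulus_borel: "{x :: 'a::euclidean_space. lo \<le> norm x \<and> norm x \<le> hi} \<in> sets borel"
  by measurable

text \<open>The point is that one \<open>C\<close> serves all annuli inside radius \<open>R\<close>,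
  however thin: a difference of powers of bounded radii is at most linear in the width.\<close>

lemma annulus_volume:
  assumes "0 \<le> R"
  obtains C where "0 \<le> C" "\<And>lo hi. lo \<le> hi \<Longrightarrow> hi \<le> R \<Longrightarrow>
    measure lborel {x :: 'a::euclidean_space. lo \<le> norm x \<and> norm x \<le> hi} \<le> C * (hi - lo)"
proof
  let ?d = "DIM('a)"
  let ?C = "unit_ball_vol ?d * (real ?d * R ^ (?d - 1))"
  show "0 \<le> ?C" using assms by simp
  fix lo hi :: real assume le: "lo \<le> hi" "hi \<le> R"
  show "measure lborel {x :: 'a. lo \<le> norm x \<and> norm x \<le> hi} \<le> ?C * (hi - lo)"
  proof (cases "0 \<le> hi")
    case True
    \<comment> \<open>The inner radius may be negative, as happens when an annulus with small
      \<open>s\<close> is widened to absorb rounding.\<close>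
    define lo' where "lo' = max lo 0"
    have lo': "0 \<le> lo'" "lo' \<le> hi" "lo \<le> lo'" using True le by (auto simp: lo'_def)
    have "{x :: 'a. lo \<le> norm x \<and> norm x \<le> hi} \<subseteq> cball 0 hi - ball 0 lo'"
      by (auto simp: lo'_def less_max_iff_disj)
    then have "measure lborel {x :: 'a. lo \<le> norm x \<and> norm x \<le> hi} \<le> measure lborel (cball 0 hi - ball 0 lo' :: 'a set)"
      using norm_annulus_borel
      by (intro measure_mono_fmeasurable bounded_borel_fmeasurable) (auto intro: bounded_diff)
    also have "\<dots> = measure lborel (cball 0 hi :: 'a set) - measure lborel (ball 0 lo' :: 'a set)"
      using lo' by (intro measurable_measure_Diff bounded_borel_fmeasurable) auto
    also have "\<dots> = unit_ball_vol ?d * (hi ^ ?d - lo' ^ ?d)"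
      using lo' True by (simp add: content_cball content_ball right_diff_distrib)
    also have "\<dots> \<le> unit_ball_vol ?d * (real ?d * R ^ (?d - 1) * (hi - lo'))"
      using lo' le by (intro mult_left_mono power_diff_le) auto
    also have "\<dots> = ?C * (hi - lo')" by simp
    also have "\<dots> \<le> ?C * (hi - lo)"
      using lo' assms by (intro mult_left_mono) auto
    finally show ?thesis .
  next
    case False
    then have "{x :: 'a. lo \<le> norm x \<and> norm x \<le> hi} = {}"
      by (auto dest: order_trans[OF norm_ge_zero])
    moreover have "0 \<le> ?C * (hi - lo)"
      by (rule mult_nonneg_nonneg[OF \<open>0 \<le> ?C\<close>]) (use le in simp)
    ultimately show ?thesis by (simp only: measure_empty)
  qed
qed

lemma card_grid_volume:
  assumes T: "finite T" "T \<subseteq> grid m" and S: "S \<in> sets borel" "bounded S"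
    and sub: "\<And>x. cell m x \<in> T \<Longrightarrow> x \<in> S"
  shows "card T * (1 / 2 ^ m) ^ CARD('d) \<le> measure lborel (S :: (real ^ 'd) set)"
proof -
  have fm: "{x :: real ^ 'd. cell m x = q} \<in> fmeasurable lborel" for q
    by (intro bounded_borel_fmeasurable cell_vimage_borel bounded_cell)
  have "card T * (1 / 2 ^ m) ^ CARD('d) = (\<Sum>q\<in>T. measure lborel {x :: real ^ 'd. cell m x = q})"
    using T by (simp add: measure_cell subset_iff)
  also have "\<dots> = measure lborel (\<Union>q\<in>T. {x :: real ^ 'd. cell m x = q})"
    using T fm by (intro measure_UNION'[symmetric]) (auto simp: pairwise_def disjnt_def)
  also have "\<dots> \<le> measure lborel S"
  proof (rule measure_mono_fmeasurable[OF _ _ bounded_borel_fmeasurable[OF S]])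
    show "(\<Union>q\<in>T. {x. cell m x = q}) \<subseteq> S" using sub by auto
    show "(\<Union>q\<in>T. {x. cell m x = q}) \<in> sets lborel"
      using T by (intro sets.finite_UN) (simp_all add: cell_vimage_borel)
  qed
  finally show ?thesis .
qed

text \<open>Alternating paths of \<open>n\<close> steps with an amber start. Repetition is forbidden
  within each colour: distinct points of one process fall into distinct fine cells, whose
  probabilities multiply, and the other process contributes an independent factor.\<close>

definition annulus_path ::
    "'a::real_normed_vector set \<Rightarrow> 'a set \<Rightarrow> real \<Rightarrow> real \<Rightarrow> real \<Rightarrow> nat \<Rightarrow> bool" where
  "annulus_path X Y R s e n \<longleftrightarrow> (\<exists>f. norm (f 0) \<le> R \<and>
     (\<forall>i\<le>n. f i \<in> (if even i then X else Y)) \<and>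
     inj_on f {i. i \<le> n \<and> even i} \<and> inj_on f {i. i \<le> n \<and> odd i} \<and>
     (\<forall>i<n. s \<le> dist (f i) (f (Suc i)) \<and> dist (f i) (f (Suc i)) \<le> s + e))"

context prob_space
begin

text \<open>Fatou's lemma for events: the lower limit is the increasing union of the
  \<open>D k\<close>, and \<open>D k\<close> lies in \<open>A k\<close>.\<close>

lemma prob_eventually_le:
  assumes A: "\<And>m. A m \<in> events" and le: "\<forall>\<^sub>F m in sequentially. prob (A m) \<le> c"
  shows "{\<omega> \<in> space M. \<forall>\<^sub>F m in sequentially. \<omega> \<in> A m} \<in> events"
    and "prob {\<omega> \<in> space M. \<forall>\<^sub>F m in sequentially. \<omega> \<in> A m} \<le> c"
proof -
  define D where "D k = (\<Inter>m\<in>{k..}. A m)" for k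
  have D: "D k \<in> events" for k unfolding D_def by (intro sets.countable_INT') (use A in auto)
  have eq: "{\<omega> \<in> space M. \<forall>\<^sub>F m in sequentially. \<omega> \<in> A m} = (\<Union>k. D k)"
    using sets.sets_into_space[OF A] by (auto simp: D_def eventually_sequentially)
  show "{\<omega> \<in> space M. \<forall>\<^sub>F m in sequentially. \<omega> \<in> A m} \<in> events"
    unfolding eq using D by auto
  have "incseq D" by (auto simp: D_def incseq_def)
  then have lim: "(\<lambda>k. prob (D k)) \<longlonglongrightarrow> prob (\<Union>k. D k)"
    using D by (intro finite_Lim_measure_incseq) auto
  have "\<forall>\<^sub>F k in sequentially. prob (D k) \<le> c"
    using le
  proof eventually_elim
    case (elim k)
    have "prob (D k) \<le> prob (A k)" by (rule finite_measure_mono) (auto simp: D_def A)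
    then show ?case using elim by simp
  qed
  then show "prob {\<omega> \<in> space M. \<forall>\<^sub>F m in sequentially. \<omega> \<in> A m} \<le> c"
    unfolding eq using lim by (intro tendsto_upperbound[OF lim]) auto
qed

text \<open>Made for statements that quantify over the points of a random set and whose
  measurability is unclear: they are covered by events of arbitrarily small probability, and the
  intersection of countably many of these is null.\<close>

lemma AE_notI:
  assumes "\<And>e. e > 0 \<Longrightarrow> \<exists>B\<in>events. prob B \<le> e \<and> (\<forall>\<omega>\<in>space M. bad \<omega> \<longrightarrow> \<omega> \<in> B)"
  shows "AE \<omega> in M. \<not> bad \<omega>"
proof -
  have "\<exists>B. \<forall>k. B k \<in> events \<and> prob (B k) \<le> 1 / Suc k \<and> (\<forall>\<omega>\<in>space M. bad \<omega> \<longrightarrow> \<omega> \<in> B k)"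
    by (rule choice) (use assms[of "1 / real (Suc k)" for k] in auto)
  then obtain B where B: "\<And>k. B k \<in> events" "\<And>k. prob (B k) \<le> 1 / Suc k"
      "\<And>k \<omega>. \<omega> \<in> space M \<Longrightarrow> bad \<omega> \<Longrightarrow> \<omega> \<in> B k"
    by blast
  define N where "N = (\<Inter>k. B k)"
  have N: "N \<in> events" unfolding N_def using B by auto
  have "prob N \<le> 1 / Suc k" for k
  proof -
    have "N \<subseteq> B k" by (auto simp: N_def)
    from finite_measure_mono[OF this B(1)] B(2)[of k] show ?thesis by linarith
  qed
  then have "prob N \<le> 0"
    by (intro LIMSEQ_le_const[OF LIMSEQ_inverse_real_of_nat]) (auto simp: inverse_eq_divide)
  then have "prob N = 0" using measure_nonneg[of M N] by linarith
  then have "N \<in> null_sets M" using N by (simp add: emeasure_eq_measure null_setsI)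
  moreover have "{\<omega> \<in> space M. \<not> \<not> bad \<omega>} \<subseteq> N" using B(3) by (auto simp: N_def)
  ultimately show ?thesis by (rule AE_I')
qed

end

context poisson_pair
begin

text \<open>
  A path is covered by grid cells \<open>q, q + u 0, q + u 0 + u 1, \<dots>\<close>; its same-coloured points lie in
  different cells once the grid is fine, so the occupation events multiply.
\<close>

lemma annulus_path_event:
  assumes "0 \<le> R'"
  obtains C where "0 \<le> C" "\<And>R. 0 \<le> R \<Longrightarrow> \<exists>K\<ge>0. \<forall>s e n. 0 \<le> s \<longrightarrow> 0 < e \<longrightarrow> s + 3 * e \<le> R' \<longrightarrow>
    (\<exists>B\<in>events. prob B \<le> K * (C * e) ^ n \<and>
      (\<forall>\<omega>\<in>space M. annulus_path (LA \<omega>) (LB \<omega>) R s e n \<longrightarrow> \<omega> \<in> B))"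
proof -
  let ?r = "max \<alpha> \<beta>"
  have r_pos: "0 < ?r" using rates_pos by simp
  obtain C0 where C0: "0 \<le> C0" "\<And>lo hi. lo \<le> hi \<Longrightarrow> hi \<le> R' \<Longrightarrow>
    measure lborel {x :: real ^ 'd. lo \<le> norm x \<and> norm x \<le> hi} \<le> C0 * (hi - lo)"
    using annulus_volume[OF assms] by blast
  \<comment> \<open>The factor 5 is the width, in units of \<open>e\<close>, of the annulus from
    \<open>s - 2 * e\<close> to \<open>s + 3 * e\<close>, whose volume bounds the number of rounded
    steps.\<close>
  define C where "C = ?r * (C0 * 5)"
  show ?thesis
  proof
    show "0 \<le> C" using C0 r_pos by (simp add: C_def)
    \<comment> \<open>\<open>C\<close> is fixed before \<open>R\<close>, so that a width
      \<open>e\<close> with \<open>C * e\<close> small serves starting points at every distance;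
      only \<open>K\<close> depends on \<open>R\<close>. Its radius \<open>R + 2\<close> allows 1
      for rounding the first point and 1 for the extent of its cell.\<close>
    fix R :: real assume R: "0 \<le> R"
    define K where "K = ?r * measure lborel (cball 0 (R + 2) :: (real ^ 'd) set)"
    have "\<exists>B\<in>events. prob B \<le> K * (C * e) ^ n \<and>
      (\<forall>\<omega>\<in>space M. annulus_path (LA \<omega>) (LB \<omega>) R s e n \<longrightarrow> \<omega> \<in> B)"
      if s: "0 \<le> s" and e: "0 < e" "s + 3 * e \<le> R'" for s e n
    proof -
      let ?v = "\<lambda>m. (1 / 2 ^ m) ^ CARD('d) :: real"
      define G :: "nat \<Rightarrow> (real ^ 'd) set" where "G m = grid m \<inter> cball 0 (R + 1)" for m
      \<comment> \<open>Two roundings below \<open>e / 2\<close> change a step length by less than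
        \<open>e\<close>, which widens the range from \<open>s\<close> to \<open>s + e\<close> at
        both ends.\<close>
      define U :: "nat \<Rightarrow> (real ^ 'd) set" where "U m = grid m \<inter> {u. s - e \<le> norm u \<and> norm u \<le> s + 2 * e}" for m
      have ann: "bounded {u :: real ^ 'd. lo \<le> norm u \<and> norm u \<le> hi}" for lo hi
        by (auto simp: bounded_iff)
      have finG: "finite (G m)" for m unfolding G_def by (intro finite_grid_bounded) auto
      have finU: "finite (U m)" for m unfolding U_def by (intro finite_grid_bounded ann)
      define g :: "(real ^ 'd) \<times> (nat \<Rightarrow> real ^ 'd) \<Rightarrow> nat \<Rightarrow> real ^ 'd"
        where "g t i = fst t + (\<Sum>j<i. snd t j)" for t i
      define Ev where "Ev = {i. i \<le> n \<and> even i}"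
      define Od where "Od = {i. i \<le> n \<and> odd i}"
      have fin_EvOd: "finite Ev" "finite Od" by (auto simp: Ev_def Od_def)
      have "card Ev + card Od = card (Ev \<union> Od)"
        using fin_EvOd by (intro card_Un_disjoint[symmetric]) (auto simp: Ev_def Od_def)
      also have "Ev \<union> Od = {..n}" by (auto simp: Ev_def Od_def)
      finally have card_EvOd: "card Ev + card Od = Suc n" by simp
      define T where "T m = {t \<in> G m \<times> (PiE {..<n} (\<lambda>_. U m)). inj_on (g t) Ev \<and> inj_on (g t) Od}" for m
      define A where "A m = (\<Union>t\<in>T m. {\<omega> \<in> space M.
        LA \<omega> \<in> occupied m (g t ` Ev) \<and> LB \<omega> \<in> occupied m (g t ` Od)})" for m
      have finT': "finite (G m \<times> (PiE {..<n} (\<lambda>_. U m)))" for m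
        by (intro finite_cartesian_product finG finite_PiE finU finite_lessThan)
      have finT: "finite (T m)" for m
        unfolding T_def by (rule finite_subset[OF _ finT'[of m]]) blast
      have A_event: "A m \<in> events" for m
        unfolding A_def using fin_EvOd by (intro sets.finite_UN finT occupied_pair_event) auto
      have cardT: "card (T m) \<le> card (G m) * card (U m) ^ n" for m
      proof -
        have "card (T m) \<le> card (G m \<times> (PiE {..<n} (\<lambda>_. U m)))"
          unfolding T_def by (intro card_mono finT') blast
        then show ?thesis by (simp add: card_cartesian_product card_PiE)
      qed
      have T_iff: "t \<in> T m \<longleftrightarrow> fst t \<in> G m \<and> snd t \<in> (PiE {..<n} (\<lambda>_. U m)) \<and>
          inj_on (g t) Ev \<and> inj_on (g t) Od" for t m
        by (simp add: T_def mem_Times_iff)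
      have g_grid: "g t i \<in> grid m" if "t \<in> T m" "i \<le> n" for t i m
      proof -
        have "(\<Sum>j<i. snd t j) \<in> grid m"
          using that(2)
        proof (induction i)
          case (Suc i)
          then have "snd t i \<in> U m" using that(1) PiE_mem[of "snd t" "{..<n}" "\<lambda>_. U m" i] by (simp add: T_iff)
          then have "snd t i \<in> grid m" by (simp add: U_def)
          then show ?case using Suc by (simp add: grid_add)
        qed (simp add: grid_def)
        moreover have "fst t \<in> grid m" using that(1) by (simp add: T_iff G_def)
        ultimately show ?thesis unfolding g_def by (intro grid_add)
      qed
      have probA: "prob (A m) \<le> card (G m) * card (U m) ^ n * (?r * ?v m) ^ Suc n" for m
      proof -
        have "prob (A m) \<le> (\<Sum>t\<in>T m. prob {\<omega> \<in> space M.
            LA \<omega> \<in> occupied m (g t ` Ev) \<and> LB \<omega> \<in> occupied m (g t ` Od)})"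
          unfolding A_def using fin_EvOd
          by (intro finite_measure_subadditive_finite finT) (auto intro!: occupied_pair_event)
        also have "\<dots> \<le> (\<Sum>t\<in>T m. (?r * ?v m) ^ Suc n)"
        proof (intro sum_mono)
          fix t assume t: "t \<in> T m"
          then have "card (g t ` Ev) + card (g t ` Od) = Suc n"
            using card_EvOd by (simp add: T_iff card_image)
          then show "prob {\<omega> \<in> space M. LA \<omega> \<in> occupied m (g t ` Ev) \<and> LB \<omega> \<in> occupied m (g t ` Od)}
              \<le> (?r * ?v m) ^ Suc n"
            using occupied_pair[of "g t ` Ev" m "g t ` Od"] g_grid[OF t] fin_EvOd
            by (auto simp: Ev_def Od_def)
        qed
        also have "\<dots> = card (T m) * (?r * ?v m) ^ Suc n" by simp
        also have "\<dots> \<le> real (card (G m) * card (U m) ^ n) * (?r * ?v m) ^ Suc n"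
          using cardT r_pos by (intro mult_right_mono) (auto simp del: of_nat_mult of_nat_power)
        finally show ?thesis by simp
      qed
      define \<delta> where "\<delta> m = CARD('d) / 2 ^ m" for m :: nat
      have \<delta>_lim: "\<delta> \<longlonglongrightarrow> 0" unfolding \<delta>_def[abs_def] by (rule tendsto_mesh)
      have \<delta>_cell: "dist (cell m x) x \<le> \<delta> m" for m and x :: "real ^ 'd"
        unfolding \<delta>_def by (rule dist_cell)
      have \<delta>_small: "\<forall>\<^sub>F m in sequentially. \<delta> m < min 1 (e / 2)"
        using \<delta>_lim by (rule order_tendstoD) (use e in simp)
      have bound: "\<forall>\<^sub>F m in sequentially. prob (A m) \<le> K * (C * e) ^ n"
        using \<delta>_small
      proof eventually_elim
        case (elim m)
        have "card (G m) * ?v m \<le> measure lborel (cball 0 (R + 2) :: (real ^ 'd) set)"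
        proof (rule card_grid_volume[OF finG])
          fix x assume "cell m x \<in> G m"
          then have "norm (cell m x) \<le> R + 1" by (simp add: G_def)
          then show "x \<in> cball 0 (R + 2)"
            using \<delta>_cell[of m x] elim norm_triangle_sub[of x "cell m x"]
            by (simp add: dist_norm norm_minus_commute)
        qed (auto simp: G_def)
        then have 1: "card (G m) * (?r * ?v m) \<le> K"
          using r_pos by (simp add: K_def mult.left_commute)
        have "card (U m) * ?v m \<le> measure lborel {u :: real ^ 'd. s - 2 * e \<le> norm u \<and> norm u \<le> s + 3 * e}"
        proof (rule card_grid_volume[OF finU _ norm_annulus_borel ann])
          fix x assume "cell m x \<in> U m"
          then have "s - e \<le> norm (cell m x)" "norm (cell m x) \<le> s + 2 * e" by (auto simp: U_def)
          then show "x \<in> {u. s - 2 * e \<le> norm u \<and> norm u \<le> s + 3 * e}"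
            using \<delta>_cell[of m x] elim e norm_triangle_sub[of x "cell m x"]
              norm_triangle_sub[of "cell m x" x]
            by (simp add: dist_norm norm_minus_commute)
        qed (auto simp: U_def)
        also have "\<dots> \<le> C0 * (s + 3 * e - (s - 2 * e))" using e by (intro C0) auto
        finally have "?r * (card (U m) * ?v m) \<le> ?r * (C0 * (5 * e))"
          using r_pos by (intro mult_left_mono) auto
        then have 2: "card (U m) * (?r * ?v m) \<le> C * e"
          by (simp add: C_def mult.left_commute mult.assoc)
        \<comment> \<open>Each of the \<open>n + 1\<close> vertices brings one factor
          \<open>?v m\<close>; one of them turns the number of starting corners into a volume, the
          others the numbers of steps, so the bound no longer depends on \<open>m\<close>.\<close>
        have "prob (A m) \<le> (card (G m) * (?r * ?v m)) * (card (U m) * (?r * ?v m)) ^ n"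
          using probA[of m] by (simp add: power_mult_distrib mult_ac)
        also have "\<dots> \<le> K * (C * e) ^ n"
          using r_pos by (intro mult_mono[OF 1] power_mono[OF 2]) (auto simp: K_def)
        finally show ?case .
      qed
      have "\<forall>\<^sub>F m in sequentially. \<omega> \<in> A m"
        if \<omega>: "\<omega> \<in> space M" and path: "annulus_path (LA \<omega>) (LB \<omega>) R s e n" for \<omega>
      proof -
        obtain f where f0: "norm (f 0) \<le> R" and
          fmem: "\<And>i. i \<le> n \<Longrightarrow> f i \<in> (if even i then LA \<omega> else LB \<omega>)" and
          finj: "inj_on f Ev" "inj_on f Od" and
          fdist: "\<And>i. i < n \<Longrightarrow> s \<le> dist (f i) (f (Suc i)) \<and> dist (f i) (f (Suc i)) \<le> s + e"
          using path unfolding annulus_path_def Ev_def Od_def by blast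
        show ?thesis
          using \<delta>_small eventually_inj_on_cell[of "f ` {..n}", OF finite_imageI[OF finite_atMost]]
        proof eventually_elim
          case (elim m)
          define t where "t = (cell m (f 0), restrict (\<lambda>i. cell m (f (Suc i)) - cell m (f i)) {..<n})"
          have g: "g t i = cell m (f i)" if "i \<le> n" for i
          proof -
            have "g t i = cell m (f 0) + (\<Sum>j<i. cell m (f (Suc j)) - cell m (f j))"
              using that by (auto simp: g_def t_def intro!: sum.cong)
            then show ?thesis by (simp add: sum_lessThan_telescope[of "\<lambda>i. cell m (f i)"])
          qed
          have "cell m (f (Suc i)) - cell m (f i) \<in> U m" if "i < n" for i
          proof -
            have "\<bar>dist (cell m (f i)) (cell m (f (Suc i))) - dist (f i) (f (Suc i))\<bar> \<le> 2 * \<delta> m"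
              using \<delta>_cell[of m "f i"] \<delta>_cell[of m "f (Suc i)"]
                dist_triangle[of "f i" "f (Suc i)" "cell m (f i)"]
                dist_triangle[of "cell m (f i)" "f (Suc i)" "cell m (f (Suc i))"]
                dist_triangle[of "cell m (f i)" "cell m (f (Suc i))" "f i"]
                dist_triangle[of "f i" "cell m (f (Suc i))" "f (Suc i)"]
                dist_commute[of "cell m (f i)" "f i"]
                dist_commute[of "cell m (f (Suc i))" "f (Suc i)"]
              by linarith
            then show ?thesis
              using fdist[OF that] elim(1)
              by (auto simp: U_def grid_diff dist_norm norm_minus_commute)
          qed
          moreover have "cell m (f 0) \<in> G m"
            using f0 \<delta>_cell[of m "f 0"] elim(1) norm_triangle_sub[of "cell m (f 0)" "f 0"]
            by (simp add: G_def dist_norm)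
          moreover have "inj_on (g t) Ev"
            using finj(1) elim(2) by (auto simp: inj_on_def Ev_def g)
          moreover have "inj_on (g t) Od"
            using finj(2) elim(2) by (auto simp: inj_on_def Od_def g)
          ultimately have "t \<in> T m" by (simp add: T_iff t_def)
          moreover have "LA \<omega> \<in> occupied m (g t ` Ev)"
            using fmem locally_finite(1)[OF \<omega>] by (force simp: occupied_def Ev_def g)
          moreover have "LB \<omega> \<in> occupied m (g t ` Od)"
            using fmem locally_finite(2)[OF \<omega>] by (force simp: occupied_def Od_def g)
          ultimately show ?case using \<omega> by (auto simp: A_def)
        qed
      qed
      then show ?thesis
        using prob_eventually_le[OF A_event bound] by (intro bexI[rotated]) auto
    qed
    moreover have "0 \<le> K" using r_pos by (simp add: K_def)
    ultimately show "\<exists>K\<ge>0. \<forall>s e n. 0 \<le> s \<longrightarrow> 0 < e \<longrightarrow> s + 3 * e \<le> R' \<longrightarrow>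
      (\<exists>B\<in>events. prob B \<le> K * (C * e) ^ n \<and>
        (\<forall>\<omega>\<in>space M. annulus_path (LA \<omega>) (LB \<omega>) R s e n \<longrightarrow> \<omega> \<in> B))"
      by blast
  qed
qed

end

section \<open>Infinite descents contain long self-avoiding paths\<close>

lemma floor_multiple:
  fixes x e :: real
  assumes "0 < e" "0 \<le> x"
  shows "real (nat \<lfloor>x / e\<rfloor>) * e \<le> x" "x < real (nat \<lfloor>x / e\<rfloor>) * e + e"
proof -
  have nonneg: "0 \<le> x / e" using assms by simp
  then have eq: "real (nat \<lfloor>x / e\<rfloor>) = of_int \<lfloor>x / e\<rfloor>" by simp
  show "real (nat \<lfloor>x / e\<rfloor>) * e \<le> x"
    unfolding eq using pos_le_divide_eq[OF assms(1)] of_int_floor_le[of "x / e"] by blast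
  have "x / e < of_int \<lfloor>x / e\<rfloor> + 1" by linarith
  then have "x < (of_int \<lfloor>x / e\<rfloor> + 1) * e" using pos_divide_less_eq[OF assms(1)] by blast
  then show "x < real (nat \<lfloor>x / e\<rfloor>) * e + e" unfolding eq by (simp add: distrib_right)
qed

text \<open>Vertices carry their colour, \<open>True\<close> for amber, so that the colour along a
  walk is read off from the parity of the index even if a point belongs to both sets.\<close>

definition link :: "'a::metric_space set \<Rightarrow> 'a set \<Rightarrow> real \<Rightarrow> real \<Rightarrow> ((bool \<times> 'a) \<times> (bool \<times> 'a)) set" where
  "link X Y s e = {((c, x), (c', y)). c' = (\<not> c) \<and> x \<in> (if c then X else Y) \<and> y \<in> (if c' then X else Y) \<and>
     s \<le> dist x y \<and> dist x y \<le> s + e}"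

lemma link_relpow_dist:
  assumes "(u, v) \<in> link X Y s e ^^ n"
  shows "dist (snd u) (snd v) \<le> n * (s + e)"
  using assms
proof (induction n arbitrary: v)
  case (Suc n)
  then obtain w where w: "(u, w) \<in> link X Y s e ^^ n" "(w, v) \<in> link X Y s e" by auto
  then have "dist (snd w) (snd v) \<le> s + e" by (auto simp: link_def)
  then show ?case
    using Suc.IH[OF w(1)] dist_triangle[of "snd u" "snd v" "snd w"] by (simp add: algebra_simps)
qed simp

text \<open>A shortest walk to a distant vertex is self-avoiding.\<close>

lemma annulus_path_from_reachable:
  fixes X Y :: "'a::real_normed_vector set"
  assumes "0 \<le> s + e" and a: "a \<in> X" "norm a \<le> R"
    and v: "((True, a), v) \<in> (link X Y s e)\<^sup>*" "real n * (s + e) < dist a (snd v)"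
  shows "annulus_path X Y R s e n"
proof -
  let ?E = "link X Y s e"
  define m where "m = (LEAST m. ((True, a), v) \<in> ?E ^^ m)"
  have m: "((True, a), v) \<in> ?E ^^ m"
    using rtrancl_imp_relpow[OF v(1)] unfolding m_def by (rule LeastI_ex)
  have least: "m \<le> k" if "((True, a), v) \<in> ?E ^^ k" for k
    unfolding m_def using that by (rule Least_le)
  \<comment> \<open>An edge advances by at most \<open>s + e\<close>, so \<open>v\<close> is more
    than \<open>n\<close> edges away and the first \<open>n + 1\<close> vertices of the shortest
    walk form the path.\<close>
  have "real n * (s + e) < real m * (s + e)"
    using link_relpow_dist[OF m] v(2) by simp
  then have "n < m" using assms(1) by (simp add: mult_less_cancel_right)
  obtain f where f: "f 0 = (True, a)" "f m = v" "\<And>i. i < m \<Longrightarrow> (f i, f (Suc i)) \<in> ?E"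
    using m unfolding relpow_fun_conv by blast
  have seg: "(f i, f (i + k)) \<in> ?E ^^ k" if "i + k \<le> m" for i k
    using that
  proof (induction k)
    case (Suc k)
    then have "(f i, f (i + k)) \<in> ?E ^^ k" "(f (i + k), f (i + Suc k)) \<in> ?E"
      using f(3)[of "i + k"] by auto
    then show ?case by auto
  qed simp
  have inj: "i = j" if "i \<le> j" "j \<le> m" "f i = f j" for i j
  proof -
    have "(f 0, f i) \<in> ?E ^^ i" using seg[of 0 i] that by simp
    moreover have "(f i, f m) \<in> ?E ^^ (m - j)" using seg[of j "m - j"] that by simp
    ultimately have "(f 0, f m) \<in> ?E ^^ (i + (m - j))" by (auto simp: relpow_add)
    then have "m \<le> i + (m - j)" using least f(1,2) by simp
    then show ?thesis using that by simp
  qed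
  have parity: "fst (f i) = even i" if "i \<le> m" for i
    using that
  proof (induction i)
    case (Suc i)
    then show ?case using f(3)[of i] by (auto simp: link_def)
  qed (simp add: f)
  have edge: "snd (f i) \<in> (if fst (f i) then X else Y) \<and> s \<le> dist (snd (f i)) (snd (f (Suc i))) \<and>
      dist (snd (f i)) (snd (f (Suc i))) \<le> s + e" if "i < m" for i
    using f(3)[OF that] by (auto simp: link_def split: prod.splits)
  have same: "i = j" if "i \<le> n" "j \<le> n" "even i = even j" "snd (f i) = snd (f j)" for i j
  proof -
    have "f i = f j" using that parity[of i] parity[of j] \<open>n < m\<close> by (simp add: prod_eq_iff)
    then show ?thesis using inj[of i j] inj[of j i] that \<open>n < m\<close> by (cases "i \<le> j") auto
  qed
  show ?thesis unfolding annulus_path_def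
  proof (intro exI[of _ "\<lambda>i. snd (f i)"] conjI allI impI)
    show "norm (snd (f 0)) \<le> R" using a f by simp
    show "snd (f i) \<in> (if even i then X else Y)" if "i \<le> n" for i
      using edge[of i] parity[of i] that \<open>n < m\<close> by simp
    show "inj_on (\<lambda>i. snd (f i)) {i. i \<le> n \<and> even i}" "inj_on (\<lambda>i. snd (f i)) {i. i \<le> n \<and> odd i}"
      by (intro inj_onI same; simp)+
    show "s \<le> dist (snd (f i)) (snd (f (Suc i)))" "dist (snd (f i)) (snd (f (Suc i))) \<le> s + e"
      if "i < n" for i
      using edge[of i] that \<open>n < m\<close> by auto
  qed
qed

lemma locally_finite_ex_far:
  assumes "locally_finite_set X" "locally_finite_set Y"
    and c: "inj c" "\<And>j :: nat. c j \<in> X \<times> Y"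
  shows "\<exists>j. r < dist a (fst (c j)) \<or> r < dist a (snd (c j))"
proof (rule ccontr)
  assume "\<not> ?thesis"
  then have near: "dist a (fst (c j)) \<le> r" "dist a (snd (c j)) \<le> r" for j
    by (simp_all add: not_less)
  have "range c \<subseteq> (X \<inter> cball a r) \<times> (Y \<inter> cball a r)"
  proof (intro image_subsetI)
    fix j
    show "c j \<in> (X \<inter> cball a r) \<times> (Y \<inter> cball a r)"
      using c(2)[of j] near[of j] by (simp add: mem_Times_iff)
  qed
  moreover have "finite ((X \<inter> cball a r) \<times> (Y \<inter> cball a r))"
    using assms(1,2) by (auto simp: locally_finite_set_def)
  ultimately have "finite (range c)" by (rule finite_subset)
  then show False using c(1) by (simp add: finite_image_iff)
qed

text \<open>
  The decreasing distances converge, so from some step on they lie in a single annulus.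
\<close>

lemma wf_descentI:
  fixes X Y :: "'a::real_normed_vector set" and e :: "nat \<Rightarrow> real"
  assumes X: "locally_finite_set X" and Y: "locally_finite_set Y"
    and e: "\<And>D :: nat. 0 < e D"
    and no_path: "\<And>(D :: nat) (R :: nat) (k :: nat). k * e D \<le> D \<Longrightarrow> \<exists>n. \<not> annulus_path X Y R (k * e D) (e D) n"
  shows "wf (descent X Y)"
  unfolding wf_iff_no_infinite_down_chain
proof
  assume "\<exists>c. \<forall>j. (c (Suc j), c j) \<in> descent X Y"
  then obtain c where c: "\<And>j. (c (Suc j), c j) \<in> descent X Y" by blast
  define a where "a j = fst (c j)" for j
  define b where "b j = snd (c j)" for j
  define d where "d j = dist (a j) (b j)" for j
  have cj: "c j = (a j, b j)" for j by (simp add: a_def b_def)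
  have step: "a j \<in> X" "b j \<in> Y" "a (Suc j) = a j \<or> b (Suc j) = b j" "d (Suc j) < d j" for j
    using c[of j] by (auto simp: descent_def cj d_def)
  \<comment> \<open>Strictly decreasing distances make the pairs of the chain distinct, so by local
    finiteness it leaves every bounded set.\<close>
  have "strict_mono (\<lambda>j. - d j)" using step(4) by (simp add: strict_mono_Suc_iff)
  then have "inj (\<lambda>j. - d j)" by (rule strict_mono_imp_inj_on)
  then have "inj d" by (auto simp: inj_on_def)
  then have inj_c: "inj c" unfolding d_def a_def b_def inj_on_def by metis
  have dec: "decseq d" using step(4) by (simp add: decseq_Suc_iff less_imp_le)
  then obtain l where l: "d \<longlonglongrightarrow> l" "\<And>j. l \<le> d j"
    using decseq_convergent[of d 0] by (auto simp: d_def)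
  have l0: "0 \<le> l" using l(1) by (rule LIMSEQ_le_const) (auto simp: d_def)
  \<comment> \<open>The width \<open>e D\<close> may depend on a bound for the limit, and
    \<open>k\<close> then selects the annulus. With natural numbers \<open>D\<close>,
    \<open>R\<close> and \<open>k\<close>, only countably many exceptional events have to be
    excluded.\<close>
  obtain D :: nat where D: "l \<le> D" using real_arch_simple by blast
  define k where "k = nat \<lfloor>l / e D\<rfloor>"
  have k: "k * e D \<le> l" "l < k * e D + e D"
    unfolding k_def by (rule floor_multiple[OF e l0])+
  have "\<forall>\<^sub>F j in sequentially. d j < k * e D + e D"
    using l(1) k(2) by (rule order_tendstoD)
  then obtain N where N: "\<And>j. N \<le> j \<Longrightarrow> d j < k * e D + e D"
    by (auto simp: eventually_sequentially)
  obtain R :: nat where R: "norm (a N) \<le> R" using real_arch_simple by blast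
  let ?E = "link X Y (k * e D) (e D)"
  have edge: "((True, a j), (False, b j)) \<in> ?E" "((False, b j), (True, a j)) \<in> ?E" if "N \<le> j" for j
    using step(1,2)[of j] N[OF that] k(1) l(2)[of j] by (auto simp: link_def d_def dist_commute)
  \<comment> \<open>Consecutive pairs of the chain share a point, so all later points are connected
    to \<open>a N\<close> by edges of the annulus.\<close>
  have reach: "((True, a N), (True, a (N + j))) \<in> ?E\<^sup>* \<and> ((True, a N), (False, b (N + j))) \<in> ?E\<^sup>*" for j
  proof (induction j)
    case 0
    then show ?case using edge(1)[of N] by auto
  next
    case (Suc j)
    have "a (N + Suc j) = a (N + j) \<or> b (N + Suc j) = b (N + j)" using step(3)[of "N + j"] by simp
    then show ?case
      using Suc edge[of "N + Suc j"] by (auto intro: rtrancl_into_rtrancl)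
  qed
  have "annulus_path X Y R (k * e D) (e D) n" for n
  proof -
    have "inj (\<lambda>j. c (N + j))"
      using injD[OF inj_c] by (intro injI) fastforce
    then obtain j where "n * (k * e D + e D) < dist (a N) (a (N + j)) \<or>
        n * (k * e D + e D) < dist (a N) (b (N + j))"
      using locally_finite_ex_far[OF X Y, of "\<lambda>j. c (N + j)" "n * (k * e D + e D)" "a N"] step(1,2)
      by (auto simp: cj)
    then obtain v where "((True, a N), v) \<in> ?E\<^sup>*" "n * (k * e D + e D) < dist (a N) (snd v)"
      using reach[of j] by (metis snd_conv)
    then show ?thesis
      using e[of D] step(1) R by (intro annulus_path_from_reachable) auto
  qed
  then show False using no_path[of k D R] k(1) D by fastforce
qed

text \<open>A tie is a path of two equally long steps, from \<open>a\<close> over \<open>b\<close>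
  to \<open>a'\<close>.\<close>

lemma tie_annulus_path:
  fixes X Y :: "'a::real_normed_vector set"
  assumes "a \<in> X" "a' \<in> X" "b \<in> Y" "a \<noteq> a'" "dist a b = dist a' b" "norm a \<le> R"
    and "s \<le> dist a b" "dist a b \<le> s + e"
  shows "annulus_path X Y R s e 2"
proof -
  have le2: "i \<le> 2 \<longleftrightarrow> i = 0 \<or> i = 1 \<or> i = 2" "i < 2 \<longleftrightarrow> i = 0 \<or> i = 1" for i :: nat by auto
  show ?thesis unfolding annulus_path_def
    by (rule exI[of _ "\<lambda>i. if i = 0 then a else if i = 1 then b else a'"])
       (use assms in \<open>auto simp: le2 inj_on_def dist_commute\<close>)
qed

section \<open>Almost sure absence of infinite descents and of ties\<close>

context poisson_pair
begin

lemma AE_no_infinite_annulus_path: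
  assumes "0 \<le> R'"
  shows "\<exists>e>0. AE \<omega> in M. \<forall>(R :: nat) (k :: nat). k * e \<le> R' \<longrightarrow>
    (\<exists>n. \<not> annulus_path (LA \<omega>) (LB \<omega>) R (k * e) e n)"
proof -
  have "0 \<le> R' + 3" using assms by simp
  then obtain C where C: "0 \<le> C" "\<And>R. 0 \<le> R \<Longrightarrow> \<exists>K\<ge>0. \<forall>s e n. 0 \<le> s \<longrightarrow> 0 < e \<longrightarrow> s + 3 * e \<le> R' + 3 \<longrightarrow>
    (\<exists>B\<in>events. prob B \<le> K * (C * e) ^ n \<and>
      (\<forall>\<omega>\<in>space M. annulus_path (LA \<omega>) (LB \<omega>) R s e n \<longrightarrow> \<omega> \<in> B))"
    by (rule annulus_path_event) blast
  \<comment> \<open>The bound 1 keeps \<open>k * e + 3 * e\<close> below \<open>R' + 3\<close>; the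
    other bound gives \<open>C * e \<le> 1 / 2\<close>, so that path probabilities decay
    geometrically in \<open>n\<close>.\<close>
  define e where "e = min 1 (1 / (2 * C + 1))"
  have e: "0 < e" "e \<le> 1" using C(1) by (auto simp: e_def)
  have "C * e \<le> C * (1 / (2 * C + 1))" using C(1) by (intro mult_left_mono) (auto simp: e_def)
  also have "\<dots> \<le> 1 / 2" using C(1) by (simp add: field_simps)
  finally have Ce: "C * e \<le> 1 / 2" .
  have "AE \<omega> in M. \<not> (\<forall>n. annulus_path (LA \<omega>) (LB \<omega>) R (k * e) e n)"
    if k: "k * e \<le> R'" for R k :: nat
  proof (rule AE_notI)
    fix \<epsilon> :: real assume \<epsilon>: "\<epsilon> > 0"
    obtain K where K: "K \<ge> 0" "\<And>n. \<exists>B\<in>events. prob B \<le> K * (C * e) ^ n \<and>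
      (\<forall>\<omega>\<in>space M. annulus_path (LA \<omega>) (LB \<omega>) R (k * e) e n \<longrightarrow> \<omega> \<in> B)"
    proof -
      from C(2)[of R] obtain K where "K \<ge> 0" and *: "\<And>s e n. 0 \<le> s \<Longrightarrow> 0 < e \<Longrightarrow> s + 3 * e \<le> R' + 3 \<Longrightarrow>
        (\<exists>B\<in>events. prob B \<le> K * (C * e) ^ n \<and>
          (\<forall>\<omega>\<in>space M. annulus_path (LA \<omega>) (LB \<omega>) R s e n \<longrightarrow> \<omega> \<in> B))"
        by auto
      moreover have "0 \<le> k * e" "k * e + 3 * e \<le> R' + 3" using e k by auto
      ultimately show ?thesis using e(1) that by blast
    qed
    have "(\<lambda>n. K * (1 / 2) ^ n) \<longlonglongrightarrow> K * 0"
      by (intro tendsto_mult tendsto_const LIMSEQ_power_zero) simp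
    then have "\<forall>\<^sub>F n in sequentially. K * (1 / 2) ^ n < \<epsilon>"
      by (rule order_tendstoD) (use \<epsilon> in simp)
    then obtain n where n: "K * (1 / 2) ^ n < \<epsilon>" by (auto simp: eventually_sequentially)
    obtain B where B: "B \<in> events" "prob B \<le> K * (C * e) ^ n"
      "\<And>\<omega>. \<omega> \<in> space M \<Longrightarrow> annulus_path (LA \<omega>) (LB \<omega>) R (k * e) e n \<Longrightarrow> \<omega> \<in> B"
      using K(2) by blast
    have "K * (C * e) ^ n \<le> K * (1 / 2) ^ n"
      using K(1) C(1) e Ce by (intro mult_left_mono power_mono) auto
    then have "prob B \<le> \<epsilon>" using B(2) n by linarith
    then show "\<exists>B\<in>events. prob B \<le> \<epsilon> \<and>
        (\<forall>\<omega>\<in>space M. (\<forall>n. annulus_path (LA \<omega>) (LB \<omega>) R (k * e) e n) \<longrightarrow> \<omega> \<in> B)"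
      using B by blast
  qed
  then have "AE \<omega> in M. \<forall>(R :: nat) (k :: nat). k * e \<le> R' \<longrightarrow>
      (\<exists>n. \<not> annulus_path (LA \<omega>) (LB \<omega>) R (k * e) e n)"
    unfolding AE_all_countable by (intro allI AE_impI) simp
  then show ?thesis using e(1) by blast
qed

lemma AE_wf_descent: "AE \<omega> in M. wf (descent (LA \<omega>) (LB \<omega>))"
proof -
  have "\<exists>e. \<forall>D. 0 < e D \<and> (AE \<omega> in M. \<forall>(R :: nat) (k :: nat). k * e D \<le> real D \<longrightarrow>
    (\<exists>n. \<not> annulus_path (LA \<omega>) (LB \<omega>) R (k * e D) (e D) n))"
    by (rule choice) (use AE_no_infinite_annulus_path[OF of_nat_0_le_iff] in blast)
  then obtain e where e: "\<And>D. 0 < e D" and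
    "\<And>D. AE \<omega> in M. \<forall>(R :: nat) (k :: nat). k * e D \<le> real D \<longrightarrow>
      (\<exists>n. \<not> annulus_path (LA \<omega>) (LB \<omega>) R (k * e D) (e D) n)"
    by blast
  then have "AE \<omega> in M. \<forall>D. \<forall>(R :: nat) (k :: nat). k * e D \<le> real D \<longrightarrow>
      (\<exists>n. \<not> annulus_path (LA \<omega>) (LB \<omega>) R (k * e D) (e D) n)"
    by (simp add: AE_all_countable)
  with AE_space show ?thesis
  proof eventually_elim
    case (elim \<omega>)
    then show ?case
      using e by (intro wf_descentI[of _ _ e] locally_finite) auto
  qed
qed

text \<open>Distances up to \<open>R\<close> are covered by about \<open>R / e\<close> annuli of
  width \<open>e\<close>. A tie in a given one has probability of order \<open>e\<^sup>2\<close>,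
  one factor \<open>e\<close> per step, so the total is of order \<open>e\<close>.\<close>

lemma AE_inj_dist_within:
  assumes R: "1 \<le> R"
  shows "AE \<omega> in M. \<not> (\<exists>b\<in>LB \<omega>. \<exists>a\<in>LA \<omega>. \<exists>a'\<in>LA \<omega>. a \<noteq> a' \<and> dist a b = dist a' b \<and>
    norm a \<le> R \<and> dist a b \<le> R)"
proof (rule AE_notI)
  fix \<epsilon> :: real assume \<epsilon>: "\<epsilon> > 0"
  \<comment> \<open>The radius \<open>4 * R\<close> leaves room for \<open>k * e + 3 * e\<close>, as
    both \<open>k * e\<close> and \<open>e\<close> are at most \<open>R\<close>.\<close>
  have "0 \<le> 4 * R" using R by simp
  then obtain C where C: "0 \<le> C" "\<And>R'. 0 \<le> R' \<Longrightarrow> \<exists>K\<ge>0. \<forall>s e n. 0 \<le> s \<longrightarrow> 0 < e \<longrightarrow> s + 3 * e \<le> 4 * R \<longrightarrow>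
    (\<exists>B\<in>events. prob B \<le> K * (C * e) ^ n \<and>
      (\<forall>\<omega>\<in>space M. annulus_path (LA \<omega>) (LB \<omega>) R' s e n \<longrightarrow> \<omega> \<in> B))"
    by (rule annulus_path_event) blast
  from C(2)[of R] R obtain K where K: "K \<ge> 0"
    "\<And>s e n. 0 \<le> s \<Longrightarrow> 0 < e \<Longrightarrow> s + 3 * e \<le> 4 * R \<Longrightarrow>
    (\<exists>B\<in>events. prob B \<le> K * (C * e) ^ n \<and>
      (\<forall>\<omega>\<in>space M. annulus_path (LA \<omega>) (LB \<omega>) R s e n \<longrightarrow> \<omega> \<in> B))"
    by auto
  \<comment> \<open>Chosen so that the sum of the \<open>n + 1 \<le> 2 * n\<close> bounds, which is
    at most \<open>2 * K * C\<^sup>2 * R\<^sup>2 / n\<close>, does not exceed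
    \<open>\<epsilon>\<close>.\<close>
  obtain N :: nat where N: "2 * K * C\<^sup>2 * R\<^sup>2 / \<epsilon> \<le> N" using real_arch_simple by blast
  define n where "n = Suc N"
  define e where "e = R / n"
  have n: "real n > 0" by (simp add: n_def)
  have e: "0 < e" "e \<le> R" "n * e = R"
    using R by (auto simp: e_def n_def field_simps)
  have "\<exists>B\<in>events. prob B \<le> K * (C * e) ^ 2 \<and>
      (\<forall>\<omega>\<in>space M. annulus_path (LA \<omega>) (LB \<omega>) R (k * e) e 2 \<longrightarrow> \<omega> \<in> B)" if "k < Suc n" for k
  proof (rule K(2))
    have "k * e \<le> n * e" using that e by (intro mult_right_mono) auto
    then show "k * e + 3 * e \<le> 4 * R" using e by simp
  qed (use e in auto)
  then have "\<exists>B. \<forall>k. k < Suc n \<longrightarrow> B k \<in> events \<and> prob (B k) \<le> K * (C * e) ^ 2 \<and>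
      (\<forall>\<omega>\<in>space M. annulus_path (LA \<omega>) (LB \<omega>) R (k * e) e 2 \<longrightarrow> \<omega> \<in> B k)"
    by (intro choice) blast
  then obtain B where B: "\<And>k. k < Suc n \<Longrightarrow> B k \<in> events"
    "\<And>k. k < Suc n \<Longrightarrow> prob (B k) \<le> K * (C * e) ^ 2"
    "\<And>k \<omega>. k < Suc n \<Longrightarrow> \<omega> \<in> space M \<Longrightarrow> annulus_path (LA \<omega>) (LB \<omega>) R (k * e) e 2 \<Longrightarrow> \<omega> \<in> B k"
    by blast
  let ?B = "\<Union>k<Suc n. B k"
  have "prob ?B \<le> (\<Sum>k<Suc n. prob (B k))"
    using B(1) by (intro finite_measure_subadditive_finite) auto
  also have "\<dots> \<le> (\<Sum>k<Suc n. K * (C * e) ^ 2)" using B(2) by (intro sum_mono) auto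
  also have "\<dots> = (real n + 1) * (K * (C * e) ^ 2)" by simp
  also have "\<dots> \<le> (2 * real n) * (K * (C * e) ^ 2)"
    using K(1) by (intro mult_right_mono) (auto simp: n_def)
  also have "\<dots> = 2 * K * C\<^sup>2 * R\<^sup>2 / n"
    using n by (simp add: e_def power2_eq_square field_simps)
  also have "\<dots> \<le> \<epsilon>"
  proof -
    have "2 * K * C\<^sup>2 * R\<^sup>2 / \<epsilon> \<le> n" using N by (simp add: n_def)
    then show ?thesis using \<epsilon> n by (simp add: field_simps)
  qed
  finally have "prob ?B \<le> \<epsilon>" .
  moreover have "\<omega> \<in> ?B" if "\<omega> \<in> space M" and tie: "a \<in> LA \<omega>" "a' \<in> LA \<omega>" "b \<in> LB \<omega>" "a \<noteq> a'"
    "dist a b = dist a' b" "norm a \<le> R" "dist a b \<le> R" for \<omega> a a' b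
  proof -
    define k where "k = nat \<lfloor>dist a b / e\<rfloor>"
    have k: "k * e \<le> dist a b" "dist a b \<le> k * e + e"
      unfolding k_def using floor_multiple[OF e(1), of "dist a b"] zero_le_dist[of a b] by linarith+
    then have "k * e \<le> n * e" using tie e by simp
    then have "real k \<le> real n" using mult_le_cancel_right_pos[OF e(1)] by blast
    then have "k < Suc n" by simp
    moreover have "annulus_path (LA \<omega>) (LB \<omega>) R (k * e) e 2"
      using tie k by (intro tie_annulus_path[of a _ a' b])
    ultimately show ?thesis using B(3) \<open>\<omega> \<in> space M\<close> by blast
  qed
  ultimately show "\<exists>B\<in>events. prob B \<le> \<epsilon> \<and> (\<forall>\<omega>\<in>space M. (\<exists>b\<in>LB \<omega>. \<exists>a\<in>LA \<omega>. \<exists>a'\<in>LA \<omega>.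
      a \<noteq> a' \<and> dist a b = dist a' b \<and> norm a \<le> R \<and> dist a b \<le> R) \<longrightarrow> \<omega> \<in> B)"
    using B(1) by (intro bexI[of _ ?B]) blast+
qed

lemma AE_inj_dist: "AE \<omega> in M. \<forall>b\<in>LB \<omega>. inj_on (\<lambda>a. dist a b) (LA \<omega>)"
proof -
  have "AE \<omega> in M. \<forall>N :: nat. \<not> (\<exists>b\<in>LB \<omega>. \<exists>a\<in>LA \<omega>. \<exists>a'\<in>LA \<omega>. a \<noteq> a' \<and> dist a b = dist a' b \<and>
    norm a \<le> real (Suc N) \<and> dist a b \<le> real (Suc N))"
    unfolding AE_all_countable by (intro allI AE_inj_dist_within) simp
  then show ?thesis
  proof eventually_elim
    case (elim \<omega>)
    show ?case
    proof (intro ballI inj_onI)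
      fix b a a' assume *: "b \<in> LB \<omega>" "a \<in> LA \<omega>" "a' \<in> LA \<omega>" "dist a b = dist a' b"
      obtain N :: nat where "max (norm a) (dist a b) \<le> N" using real_arch_simple by blast
      then have "norm a \<le> real (Suc N)" "dist a b \<le> real (Suc N)" by auto
      then show "a = a'" using elim * by blast
    qed
  qed
qed

end

text \<open>\<open>AE_inj_dist\<close> excludes ties seen from blue points; exchanging the colours
  excludes those seen from amber points.\<close>

lemma (in poisson_pair) AE_no_ties: "AE \<omega> in M. no_ties (LA \<omega>) (LB \<omega>)"
proof -
  interpret swapped: poisson_pair M \<beta> \<alpha> LB LA by (rule swap)
  show ?thesis
    using AE_inj_dist swapped.AE_inj_dist
    by eventually_elim (simp add: no_ties_def dist_commute)
qed

section \<open>Uniqueness of the law and translations\<close>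

definition cylinder :: "nat \<Rightarrow> (nat \<Rightarrow> 'a set) \<Rightarrow> (nat \<Rightarrow> nat) \<Rightarrow> 'a::euclidean_space set set" where
  "cylinder n A k = {X. locally_finite_set X \<and> (\<forall>i<n. card (X \<inter> A i) = k i)}"

text \<open>The generators of \<open>configurations\<close> prescribe a single count. Allowing
  finitely many counts yields a generator closed under intersections, as the uniqueness of measures
  requires.\<close>

definition cylinders :: "'a::euclidean_space set set set" where
  "cylinders = {cylinder n A k | n A k. \<forall>i<n. A i \<in> sets borel \<and> bounded (A i)}"

lemma cylinder_sets:
  assumes "\<And>i. i < n \<Longrightarrow> A i \<in> sets borel" "\<And>i. i < n \<Longrightarrow> bounded (A i)"
  shows "cylinder n A k \<in> sets configurations"
proof -
  have "Measurable.pred configurations (\<lambda>X. \<forall>i\<in>{..<n}. card (X \<inter> A i) = k i)"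
  proof (intro pred_intros_finite)
    fix i assume "i \<in> {..<n}"
    then have [measurable]: "(\<lambda>X. card (X \<inter> A i)) \<in> measurable configurations (count_space UNIV)"
      using assms by (intro measurable_card_Int) auto
    show "Measurable.pred configurations (\<lambda>X. card (X \<inter> A i) = k i)" by measurable
  qed simp
  then show ?thesis by (simp add: pred_def cylinder_def space_configurations lessThan_def)
qed

lemma sigma_sets_cylinders:
  "sets configurations = sigma_sets {X. locally_finite_set X} cylinders"
proof (rule antisym)
  have "U \<in> sets configurations" if "U \<in> cylinders" for U :: "'a set set"
    using that cylinder_sets by (auto simp: cylinders_def)
  then show "sigma_sets {X. locally_finite_set X} cylinders \<subseteq> (sets configurations :: 'a set set set)"
    using sets.sigma_sets_subset[of cylinders "configurations :: 'a set measure"]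
    by (auto simp: space_configurations)
next
  show "(sets configurations :: 'a set set set) \<subseteq> sigma_sets {X. locally_finite_set X} cylinders"
    unfolding sets_configurations
  proof (rule sigma_sets_mono')
    show "{{X. locally_finite_set X \<and> card (X \<inter> A) = k} | A k. A \<in> sets borel \<and> bounded A}
        \<subseteq> (cylinders :: 'a set set set)"
    proof
      fix U :: "'a set set"
      assume "U \<in> {{X. locally_finite_set X \<and> card (X \<inter> A) = k} | A k. A \<in> sets borel \<and> bounded A}"
      then obtain A k where "A \<in> sets borel" "bounded A"
        "U = {X. locally_finite_set X \<and> card (X \<inter> A) = k}" by blast
      then show "U \<in> cylinders"
        unfolding cylinders_def
        by (intro CollectI exI[of _ "Suc 0"] exI[of _ "\<lambda>_. A"] exI[of _ "\<lambda>_. k"])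
           (auto simp: cylinder_def)
    qed
  qed
qed

lemma Int_stable_cylinders: "Int_stable cylinders"
proof (rule Int_stableI)
  fix U V :: "'a set set" assume "U \<in> cylinders" "V \<in> cylinders"
  then obtain m A k n B l where U: "U = cylinder m A k" "\<And>i. i < m \<Longrightarrow> A i \<in> sets borel \<and> bounded (A i)"
    and V: "V = cylinder n B l" "\<And>i. i < n \<Longrightarrow> B i \<in> sets borel \<and> bounded (B i)"
    unfolding cylinders_def by blast
  have all: "(\<forall>i<m + n. P i) \<longleftrightarrow> (\<forall>i<m. P i) \<and> (\<forall>i<n. P (m + i))" for P
  proof safe
    fix i assume "\<forall>i<m. P i" "\<forall>i<n. P (m + i)" "i < m + n"
    then show "P i" by (cases "i < m") (auto dest: spec[of _ "i - m"])
  qed auto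
  have "U \<inter> V = cylinder (m + n) (\<lambda>i. if i < m then A i else B (i - m)) (\<lambda>i. if i < m then k i else l (i - m))"
    unfolding U V cylinder_def all by auto
  moreover have "\<forall>i<m + n. (if i < m then A i else B (i - m)) \<in> sets borel \<and> bounded (if i < m then A i else B (i - m))"
    using U V by auto
  ultimately show "U \<inter> V \<in> cylinders" unfolding cylinders_def by blast
qed

text \<open>The sets counted by a cylinder may overlap, whereas independence is available for
  disjoint sets. The atoms of the set algebra they generate are disjoint, and every count is a sum
  of counts over atoms.\<close>

definition atom :: "nat \<Rightarrow> (nat \<Rightarrow> 'a set) \<Rightarrow> nat set \<Rightarrow> 'a set" where
  "atom n A J = {x. {i. i < n \<and> x \<in> A i} = J}"

lemma atom_eq:
  assumes "J \<subseteq> {..<n}" shows "atom n A J = {x. \<forall>i<n. x \<in> A i \<longleftrightarrow> i \<in> J}"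
proof -
  have "{i. i < n \<and> x \<in> A i} = J" if "\<forall>i<n. x \<in> A i \<longleftrightarrow> i \<in> J" for x
  proof (intro set_eqI iffI)
    fix i assume "i \<in> J"
    then have "i < n" using assms by blast
    then show "i \<in> {i. i < n \<and> x \<in> A i}" using that \<open>i \<in> J\<close> by simp
  qed (use that in blast)
  then show ?thesis by (force simp: atom_def)
qed

lemma card_Int_atoms:
  assumes X: "locally_finite_set X" and A: "\<And>i. i < n \<Longrightarrow> bounded (A i)" and i: "i < n"
  shows "card (X \<inter> A i) = (\<Sum>J\<in>{J. J \<subseteq> {..<n} \<and> i \<in> J}. card (X \<inter> atom n A J))"
proof -
  have fin: "finite (X \<inter> A i)" using X A[OF i] by (auto simp: locally_finite_set_def)
  have sub: "X \<inter> atom n A J \<subseteq> X \<inter> A i" if "i \<in> J" for J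
    using that by (auto simp: atom_def)
  have "X \<inter> A i = (\<Union>J\<in>{J. J \<subseteq> {..<n} \<and> i \<in> J}. X \<inter> atom n A J)"
    using i by (auto simp: atom_def)
  also have "card \<dots> = (\<Sum>J\<in>{J. J \<subseteq> {..<n} \<and> i \<in> J}. card (X \<inter> atom n A J))"
  proof (rule card_UN_disjoint)
    show "finite {J. J \<subseteq> {..<n} \<and> i \<in> J}" by (rule finite_subset[of _ "Pow {..<n}"]) auto
    show "\<forall>J\<in>{J. J \<subseteq> {..<n} \<and> i \<in> J}. finite (X \<inter> atom n A J)"
      using finite_subset[OF sub fin] by simp
  qed (auto simp: atom_def)
  finally show ?thesis .
qed

context prob_space
begin

text \<open>The cylinder is split according to the vector \<open>v\<close> of counts on the atoms.
  The empty pattern is left out, as its atom is the complement of all \<open>A i\<close>, which is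
  unbounded and contributes to no count. What matters is that the right-hand side depends on the
  process only through its rate.\<close>

lemma poisson_process_cylinder:
  assumes L: "poisson_process M r L" and A: "\<And>i. i < n \<Longrightarrow> A i \<in> sets borel" "\<And>i. i < n \<Longrightarrow> bounded (A i)"
  defines "I \<equiv> Pow {..<n} - {{}}"
  shows "emeasure M (L -` cylinder n A k \<inter> space M) =
    (\<integral>\<^sup>+v. ennreal (\<Prod>J\<in>I. (r * measure lborel (atom n A J)) ^ v J / fact (v J) *
        exp (- (r * measure lborel (atom n A J))))
      \<partial>count_space {v \<in> PiE I (\<lambda>_. UNIV). \<forall>i<n. (\<Sum>J\<in>{J. J \<subseteq> {..<n} \<and> i \<in> J}. v J) = k i})"
proof -
  define V where "V = {v \<in> PiE I (\<lambda>_. UNIV :: nat set). \<forall>i<n. (\<Sum>J\<in>{J. J \<subseteq> {..<n} \<and> i \<in> J}. v J) = k i}"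
  have I: "finite I" unfolding I_def by simp
  have atoms: "card (X \<inter> A i) = (\<Sum>J\<in>{J. J \<subseteq> {..<n} \<and> i \<in> J}. card (X \<inter> atom n A J))"
    if "locally_finite_set X" "i < n" for X i
    using that A(2) by (intro card_Int_atoms) auto
  have atom_borel: "atom n A J \<in> sets borel" if "J \<in> I" for J
  proof -
    have "atom n A J = {x\<in>space borel. \<forall>i\<in>{..<n}. x \<in> A i \<longleftrightarrow> i \<in> J}"
      using that by (auto simp: atom_eq I_def)
    also have "\<dots> \<in> sets borel"
      using A by (intro sets.sets_Collect_finite_All) (auto intro!: sets.sets_Collect)
    finally show ?thesis .
  qed
  have atom_bounded: "bounded (atom n A J)" if "J \<in> I" for J
  proof -
    obtain i where "i \<in> J" "i < n" using \<open>J \<in> I\<close> by (auto simp: I_def)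
    then show ?thesis by (intro bounded_subset[OF A(2)[of i]]) (auto simp: atom_def)
  qed
  have disj: "disjoint_family_on (atom n A) I" by (auto simp: disjoint_family_on_def atom_def)
  define D where "D v = {\<omega> \<in> space M. \<forall>J\<in>I. card (L \<omega> \<inter> atom n A J) \<in> {v J}}" for v
  have D_event: "D v \<in> events" for v
    unfolding D_def
    using measurable_sets[OF poisson_process_card_measurable[OF L atom_borel atom_bounded], of _ "{v _}"]
    by (intro sets.sets_Collect_finite_All I) (simp add: vimage_def Int_def conj_commute)
  have "L -` cylinder n A k \<inter> space M = (\<Union>v\<in>V. D v)"
  proof (intro set_eqI iffI)
    fix \<omega> assume "\<omega> \<in> L -` cylinder n A k \<inter> space M"
    then have \<omega>: "\<omega> \<in> space M" "locally_finite_set (L \<omega>)" "\<And>i. i < n \<Longrightarrow> card (L \<omega> \<inter> A i) = k i"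
      by (auto simp: cylinder_def)
    have "(\<Sum>J\<in>{J. J \<subseteq> {..<n} \<and> i \<in> J}. restrict (\<lambda>J. card (L \<omega> \<inter> atom n A J)) I J) = k i" if "i < n" for i
    proof -
      have "k i = (\<Sum>J\<in>{J. J \<subseteq> {..<n} \<and> i \<in> J}. card (L \<omega> \<inter> atom n A J))"
        using atoms[OF \<omega>(2) that] \<omega>(3)[OF that] by simp
      also have "\<dots> = (\<Sum>J\<in>{J. J \<subseteq> {..<n} \<and> i \<in> J}. restrict (\<lambda>J. card (L \<omega> \<inter> atom n A J)) I J)"
        by (intro sum.cong refl) (auto simp: I_def)
      finally show ?thesis by simp
    qed
    then show "\<omega> \<in> (\<Union>v\<in>V. D v)"
      using \<omega>(1) by (intro UN_I[of "restrict (\<lambda>J. card (L \<omega> \<inter> atom n A J)) I"]) (auto simp: V_def D_def)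
  next
    fix \<omega> assume "\<omega> \<in> (\<Union>v\<in>V. D v)"
    then obtain v where v: "v \<in> V" "\<omega> \<in> D v" by blast
    then have \<omega>: "\<omega> \<in> space M" "locally_finite_set (L \<omega>)"
      using poisson_process_locally_finite[OF L] by (auto simp: D_def)
    have "card (L \<omega> \<inter> A i) = k i" if "i < n" for i
    proof -
      have "card (L \<omega> \<inter> A i) = (\<Sum>J\<in>{J. J \<subseteq> {..<n} \<and> i \<in> J}. v J)"
        unfolding atoms[OF \<omega>(2) that]
        using v(2) by (intro sum.cong refl) (auto simp: D_def I_def)
      then show ?thesis using v(1) that by (simp add: V_def)
    qed
    then show "\<omega> \<in> L -` cylinder n A k \<inter> space M" using \<omega> by (simp add: cylinder_def)
  qed
  also have "emeasure M \<dots> = (\<integral>\<^sup>+v. emeasure M (D v) \<partial>count_space V)"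
  proof (rule emeasure_UN_countable)
    have "countable (PiE I (\<lambda>_. UNIV :: nat set))" by (intro countable_PiE I) auto
    then show "countable V" unfolding V_def by (rule countable_subset[rotated]) blast
    show "disjoint_family_on D V"
      unfolding disjoint_family_on_def
    proof (intro ballI impI)
      fix v v' assume v: "v \<in> V" "v' \<in> V" "v \<noteq> v'"
      then have "v \<in> PiE I (\<lambda>_. UNIV)" "v' \<in> PiE I (\<lambda>_. UNIV)" by (simp_all add: V_def)
      then obtain J where "J \<in> I" "v J \<noteq> v' J" using PiE_ext v(3) by metis
      then show "D v \<inter> D v' = {}" by (auto simp: D_def)
    qed
  qed (use D_event in auto)
  also have "\<dots> = (\<integral>\<^sup>+v. ennreal (\<Prod>J\<in>I. (r * measure lborel (atom n A J)) ^ v J / fact (v J) *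
        exp (- (r * measure lborel (atom n A J)))) \<partial>count_space V)"
  proof (intro nn_integral_cong)
    fix v
    have "prob (D v) = (\<Prod>J\<in>I. prob {\<omega> \<in> space M. card (L \<omega> \<inter> atom n A J) \<in> {v J}})"
      unfolding D_def by (intro poisson_process_joint[OF L I] atom_borel atom_bounded disj)
    also have "\<dots> = (\<Prod>J\<in>I. (r * measure lborel (atom n A J)) ^ v J / fact (v J) *
        exp (- (r * measure lborel (atom n A J))))"
      using L atom_borel atom_bounded by (intro prod.cong refl) (simp add: poisson_process_def)
    finally show "emeasure M (D v) = ennreal (\<Prod>J\<in>I. (r * measure lborel (atom n A J)) ^ v J / fact (v J) *
        exp (- (r * measure lborel (atom n A J))))"
      by (simp add: emeasure_eq_measure)
  qed
  finally show ?thesis unfolding V_def .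
qed

lemma poisson_process_distr_unique:
  fixes L L' :: "'a \<Rightarrow> 'b::euclidean_space set"
  assumes L: "poisson_process M r L" and L': "poisson_process M r L'"
  shows "distr M configurations L = distr M configurations L'"
proof (rule measure_eqI_generator_eq[OF Int_stable_cylinders,
      where \<Omega> = "{X. locally_finite_set X}" and A = "\<lambda>_. {X. locally_finite_set X}"])
  show "cylinders \<subseteq> Pow {X. locally_finite_set X}" by (auto simp: cylinders_def cylinder_def)
  fix U :: "'b set set" assume "U \<in> cylinders"
  then obtain n A k where U: "U = cylinder n A k" and A: "\<And>i. i < n \<Longrightarrow> A i \<in> sets borel" "\<And>i. i < n \<Longrightarrow> bounded (A i)"
    unfolding cylinders_def by blast
  show "emeasure (distr M configurations L) U = emeasure (distr M configurations L') U"
  proof -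
    have "U \<in> sets configurations" unfolding U using A by (intro cylinder_sets) auto
    moreover have "emeasure M (L -` U \<inter> space M) = emeasure M (L' -` U \<inter> space M)"
      unfolding U
      by (rule trans[OF poisson_process_cylinder[OF L] poisson_process_cylinder[OF L', symmetric]])
         (use A in auto)
    ultimately show ?thesis
      using poisson_process_measurable[OF L] poisson_process_measurable[OF L'] by (simp only: emeasure_distr)
  qed
next
  have "{X. locally_finite_set X} = cylinder 0 (\<lambda>_. {}) (\<lambda>_. 0)" by (simp add: cylinder_def)
  then show "range (\<lambda>_. {X. locally_finite_set X}) \<subseteq> cylinders" unfolding cylinders_def by blast
  interpret D: prob_space "distr M configurations L"
    using L by (intro prob_space_distr poisson_process_measurable)
  show "emeasure (distr M configurations L) {X. locally_finite_set X} \<noteq> \<infinity>"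
    using D.emeasure_finite by simp
  show "sets (distr M configurations L) = sigma_sets {X. locally_finite_set X} cylinders"
    "sets (distr M configurations L') = sigma_sets {X. locally_finite_set X} cylinders"
    by (simp_all only: sets_distr sigma_sets_cylinders)
qed simp

end

section \<open>Translation invariance of the laws\<close>

lemma translate_Int: "(+) t ` X \<inter> A = (+) t ` (X \<inter> (+) t -` A)" for t :: "'a::group_add"
  by auto

lemma card_translate_Int: "card ((+) t ` X \<inter> A) = card (X \<inter> (+) t -` A)" for t :: "'a::group_add"
  unfolding translate_Int by (intro card_image) (simp add: inj_on_def)

lemma bounded_translate_vimage:
  fixes t :: "'a::real_normed_vector"
  assumes "bounded A" shows "bounded ((+) t -` A)"
proof -
  have "(+) t -` A = (+) (- t) ` A"
  proof (intro set_eqI iffI)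
    fix x assume "x \<in> (+) t -` A"
    then show "x \<in> (+) (- t) ` A" by (intro image_eqI[of _ _ "t + x"]) auto
  qed auto
  then show ?thesis using bounded_translation[OF assms, of "- t"] by simp
qed

lemma borel_translate_vimage:
  "A \<in> sets borel \<Longrightarrow> (+) t -` A \<in> sets borel" for t :: "'a::euclidean_space"
  using measurable_sets[of "(+) t" borel borel A] by simp

lemma measure_translate_vimage:
  fixes t :: "'a::euclidean_space"
  assumes "A \<in> sets borel"
  shows "measure lborel ((+) t -` A) = measure lborel A"
proof -
  have "measure (distr lborel borel ((+) t)) A = measure lborel ((+) t -` A)"
    using assms by (subst measure_distr) auto
  then show ?thesis by (simp add: lborel_distr_plus)
qed

lemma locally_finite_translate:
  fixes t :: "'a::real_normed_vector"
  assumes "locally_finite_set X" shows "locally_finite_set ((+) t ` X)"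
  using assms unfolding locally_finite_set_def translate_Int
  by (auto intro!: finite_imageI bounded_translate_vimage)

lemma measurable_translate:
  "(`) ((+) t) \<in> measurable configurations configurations" for t :: "'a::euclidean_space"
proof (rule measurable_configurationsI)
  fix X :: "'a set" assume "X \<in> space configurations"
  then show "locally_finite_set ((+) t ` X)"
    by (simp add: space_configurations locally_finite_translate)
next
  fix A :: "'a set" assume "A \<in> sets borel" "bounded A"
  then show "(\<lambda>X. card ((+) t ` X \<inter> A)) \<in> measurable configurations (count_space UNIV)"
    unfolding card_translate_Int
    by (intro measurable_card_Int borel_translate_vimage bounded_translate_vimage)
qed

lemma poisson_process_translate:
  fixes L :: "'w \<Rightarrow> 'a::euclidean_space set"
  assumes "poisson_process M r L"
  shows "poisson_process M r (\<lambda>\<omega>. (+) t ` L \<omega>)"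
  unfolding poisson_process_def
proof (intro conjI allI impI)
  show "(\<lambda>\<omega>. (+) t ` L \<omega>) \<in> measurable M configurations"
  proof -
    have "L \<in> measurable M configurations" using assms by (simp add: poisson_process_def)
    from measurable_compose[OF this measurable_translate] show ?thesis .
  qed
  fix A :: "'a set" and k assume "A \<in> sets borel \<and> bounded A"
  then show "measure M {\<omega> \<in> space M. card ((+) t ` L \<omega> \<inter> A) = k} =
      (r * measure lborel A) ^ k / fact k * exp (- (r * measure lborel A))"
    using assms borel_translate_vimage[of A t] bounded_translate_vimage[of A t]
    by (simp add: poisson_process_def card_translate_Int measure_translate_vimage)
next
  fix n :: nat and A :: "nat \<Rightarrow> 'a set"
  assume A: "(\<forall>i<n. A i \<in> sets borel \<and> bounded (A i)) \<and> disjoint_family_on A {..<n}"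
  let ?A = "\<lambda>i. (+) t -` A i"
  have "\<forall>i<n. ?A i \<in> sets borel \<and> bounded (?A i)"
    using A borel_translate_vimage bounded_translate_vimage by blast
  moreover have "disjoint_family_on ?A {..<n}"
    using A by (auto simp: disjoint_family_on_def)
  ultimately have "prob_space.indep_vars M (\<lambda>_. count_space UNIV) (\<lambda>i \<omega>. card (L \<omega> \<inter> ?A i)) {..<n}"
    using assms[unfolded poisson_process_def, THEN conjunct2, THEN conjunct2, rule_format, of n ?A]
    by blast
  then show "prob_space.indep_vars M (\<lambda>_. count_space UNIV) (\<lambda>i \<omega>. card ((+) t ` L \<omega> \<inter> A i)) {..<n}"
    by (simp add: card_translate_Int)
qed

context poisson_pair
begin

lemma translate: "poisson_pair M \<alpha> \<beta> (\<lambda>\<omega>. (+) t ` LA \<omega>) (\<lambda>\<omega>. (+) t ` LB \<omega>)"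
proof -
  have "indep_var configurations ((`) ((+) t) \<circ> LA) configurations ((`) ((+) t) \<circ> LB)"
    by (rule indep_var_compose[OF indep measurable_translate measurable_translate])
  then have "indep_var configurations (\<lambda>\<omega>. (+) t ` LA \<omega>) configurations (\<lambda>\<omega>. (+) t ` LB \<omega>)"
    by (simp add: comp_def)
  then show ?thesis
    using prob_space_axioms rates_pos poisson_process_translate[OF poisson_LA] poisson_process_translate[OF poisson_LB]
    by (intro poisson_pair.intro poisson_pair_axioms.intro)
qed

lemma measurable_pair [measurable]:
  "(\<lambda>\<omega>. (LA \<omega>, LB \<omega>)) \<in> measurable M (configurations \<Otimes>\<^sub>M configurations)"
  by (rule measurable_Pair[OF measurable_LA measurable_LB])

text \<open>By independence the joint law is the product of the two marginals, and each of these is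
  preserved since the translated process is again Poisson with the same rate.\<close>

lemma nn_integral_translate:
  assumes h: "h \<in> borel_measurable (configurations \<Otimes>\<^sub>M configurations)"
  shows "(\<integral>\<^sup>+\<omega>. h ((+) t ` LA \<omega>, (+) t ` LB \<omega>) \<partial>M) = (\<integral>\<^sup>+\<omega>. h (LA \<omega>, LB \<omega>) \<partial>M)"
proof -
  interpret T: poisson_pair M \<alpha> \<beta> "\<lambda>\<omega>. (+) t ` LA \<omega>" "\<lambda>\<omega>. (+) t ` LB \<omega>"
    by (rule translate)
  have "distr M (configurations \<Otimes>\<^sub>M configurations) (\<lambda>\<omega>. ((+) t ` LA \<omega>, (+) t ` LB \<omega>)) =
      distr M configurations (\<lambda>\<omega>. (+) t ` LA \<omega>) \<Otimes>\<^sub>M distr M configurations (\<lambda>\<omega>. (+) t ` LB \<omega>)"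
    using T.indep unfolding indep_var_distribution_eq by simp
  also have "\<dots> = distr M configurations LA \<Otimes>\<^sub>M distr M configurations LB"
    using poisson_process_distr_unique[OF T.poisson_LA poisson_LA]
      poisson_process_distr_unique[OF T.poisson_LB poisson_LB] by simp
  also have "\<dots> = distr M (configurations \<Otimes>\<^sub>M configurations) (\<lambda>\<omega>. (LA \<omega>, LB \<omega>))"
    using indep unfolding indep_var_distribution_eq by simp
  finally show ?thesis
    using nn_integral_distr[OF T.measurable_pair, of h] nn_integral_distr[OF measurable_pair, of h] h by simp
qed

end

section \<open>The mean number of points on an invariant event\<close>

text \<open>The variance of a Poisson variable: the factor \<open>k\<close> cancels against the
  factorial and shifts the index, which reduces the first moment to the exponential series and the
  second moment to the first.\<close>

lemma poisson_second_moment_sums: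
  fixes \<mu> :: real
  shows "(\<lambda>k. (real k - \<mu>)\<^sup>2 * (\<mu> ^ k / fact k * exp (- \<mu>))) sums \<mu>"
proof -
  define e where "e k = \<mu> ^ k / fact k" for k
  have Suc: "real (Suc k) * e (Suc k) = \<mu> * e k" for k
    by (simp add: e_def del: of_nat_Suc)
  have "e = (\<lambda>k. \<mu> ^ k /\<^sub>R fact k)"
    by (simp add: e_def fun_eq_iff divide_inverse mult.commute)
  then have e0: "e sums exp \<mu>" using exp_converges[of \<mu>] by simp
  have "(\<lambda>k. real (Suc k) * e (Suc k)) sums (\<mu> * exp \<mu>)"
    unfolding Suc by (intro sums_mult e0)
  then have e1: "(\<lambda>k. real k * e k) sums (\<mu> * exp \<mu>)"
    using sums_Suc_iff[of "\<lambda>k. real k * e k"] by simp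
  have "real (Suc k) ^ 2 * e (Suc k) = \<mu> * (real k * e k + e k)" for k
  proof -
    have "real (Suc k) ^ 2 * e (Suc k) = real (Suc k) * (real (Suc k) * e (Suc k))"
      by (simp add: power2_eq_square)
    then show ?thesis unfolding Suc by (simp add: algebra_simps)
  qed
  moreover have "(\<lambda>k. \<mu> * (real k * e k + e k)) sums (\<mu> * (\<mu> * exp \<mu> + exp \<mu>))"
    by (intro sums_mult sums_add e0 e1)
  ultimately have "(\<lambda>k. real (Suc k) ^ 2 * e (Suc k)) sums (\<mu> * (\<mu> * exp \<mu> + exp \<mu>))" by simp
  then have e2: "(\<lambda>k. real k ^ 2 * e k) sums (\<mu> * (\<mu> * exp \<mu> + exp \<mu>))"
    using sums_Suc_iff[of "\<lambda>k. real k ^ 2 * e k"] by simp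
  have "(\<lambda>k. (real k ^ 2 * e k - 2 * \<mu> * (real k * e k) + \<mu>\<^sup>2 * e k) * exp (- \<mu>)) sums
      ((\<mu> * (\<mu> * exp \<mu> + exp \<mu>) - 2 * \<mu> * (\<mu> * exp \<mu>) + \<mu>\<^sup>2 * exp \<mu>) * exp (- \<mu>))"
    by (intro sums_mult2 sums_add sums_diff sums_mult e0 e1 e2)
  moreover have "(\<mu> * (\<mu> * exp \<mu> + exp \<mu>) - 2 * \<mu> * (\<mu> * exp \<mu>) + \<mu>\<^sup>2 * exp \<mu>) * exp (- \<mu>) = \<mu>"
    by (simp add: algebra_simps power2_eq_square exp_minus)
  moreover have "(real k ^ 2 * e k - 2 * \<mu> * (real k * e k) + \<mu>\<^sup>2 * e k) * exp (- \<mu>) =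
      (real k - \<mu>)\<^sup>2 * (\<mu> ^ k / fact k * exp (- \<mu>))" for k
    by (simp add: e_def power2_diff algebra_simps)
  ultimately show ?thesis by simp
qed

context prob_space
begin

lemma poisson_variance:
  assumes X: "X \<in> measurable M (count_space UNIV)" and "0 \<le> \<mu>"
    and pois: "\<And>k. prob {\<omega> \<in> space M. X \<omega> = k} = \<mu> ^ k / fact k * exp (- \<mu>)"
  shows "integrable M (\<lambda>\<omega>. (real (X \<omega>) - \<mu>)\<^sup>2)" "expectation (\<lambda>\<omega>. (real (X \<omega>) - \<mu>)\<^sup>2) = \<mu>"
proof -
  note [measurable] = X
  let ?D = "\<lambda>k. {\<omega> \<in> space M. X \<omega> = k}"
  have "(\<integral>\<^sup>+\<omega>. ennreal ((real (X \<omega>) - \<mu>)\<^sup>2) \<partial>M) =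
      (\<integral>\<^sup>+\<omega>. (\<Sum>k. ennreal ((real k - \<mu>)\<^sup>2) * indicator (?D k) \<omega>) \<partial>M)"
  proof (intro nn_integral_cong)
    fix \<omega> assume "\<omega> \<in> space M"
    then show "ennreal ((real (X \<omega>) - \<mu>)\<^sup>2) = (\<Sum>k. ennreal ((real k - \<mu>)\<^sup>2) * indicator (?D k) \<omega>)"
      by (subst suminf_cmult_indicator[of _ _ "X \<omega>"]) (auto simp: disjoint_family_on_def)
  qed
  also have "\<dots> = (\<Sum>k. \<integral>\<^sup>+\<omega>. ennreal ((real k - \<mu>)\<^sup>2) * indicator (?D k) \<omega> \<partial>M)"
    by (intro nn_integral_suminf) measurable
  also have "\<dots> = (\<Sum>k. ennreal ((real k - \<mu>)\<^sup>2 * (\<mu> ^ k / fact k * exp (- \<mu>))))"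
  proof (intro suminf_cong)
    fix k
    have "(\<integral>\<^sup>+\<omega>. ennreal ((real k - \<mu>)\<^sup>2) * indicator (?D k) \<omega> \<partial>M) =
        ennreal ((real k - \<mu>)\<^sup>2) * emeasure M (?D k)"
      by (intro nn_integral_cmult_indicator) measurable
    then show "(\<integral>\<^sup>+\<omega>. ennreal ((real k - \<mu>)\<^sup>2) * indicator (?D k) \<omega> \<partial>M) =
        ennreal ((real k - \<mu>)\<^sup>2 * (\<mu> ^ k / fact k * exp (- \<mu>)))"
      by (simp only: emeasure_eq_measure pois ennreal_mult'[OF zero_le_power2])
  qed
  also have "\<dots> = ennreal \<mu>"
    using poisson_second_moment_sums \<open>0 \<le> \<mu>\<close> by (intro suminf_ennreal_eq) auto
  finally have *: "(\<integral>\<^sup>+\<omega>. ennreal ((real (X \<omega>) - \<mu>)\<^sup>2) \<partial>M) = ennreal \<mu>" .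
  show "integrable M (\<lambda>\<omega>. (real (X \<omega>) - \<mu>)\<^sup>2)"
    by (rule integrableI_nonneg) (simp_all add: *)
  show "expectation (\<lambda>\<omega>. (real (X \<omega>) - \<mu>)\<^sup>2) = \<mu>"
    using \<open>0 \<le> \<mu>\<close> by (subst integral_eq_nn_integral) (simp_all add: *)
qed

text \<open>The variance of \<open>\<bar>f \<omega>\<bar>\<close> is nonnegative.\<close>

lemma expectation_abs_le_sqrt:
  assumes "f \<in> borel_measurable M" "integrable M (\<lambda>\<omega>. (f \<omega>)\<^sup>2)"
  shows "integrable M f" "expectation (\<lambda>\<omega>. \<bar>f \<omega>\<bar>) \<le> sqrt (expectation (\<lambda>\<omega>. (f \<omega>)\<^sup>2))"
proof -
  show int: "integrable M f"
    by (rule square_integrable_imp_integrable[OF assms])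
  have "0 \<le> variance (\<lambda>\<omega>. \<bar>f \<omega>\<bar>)" by (rule variance_positive)
  also have "\<dots> = expectation (\<lambda>\<omega>. (f \<omega>)\<^sup>2) - (expectation (\<lambda>\<omega>. \<bar>f \<omega>\<bar>))\<^sup>2"
    using int assms by (subst variance_eq) auto
  finally show "expectation (\<lambda>\<omega>. \<bar>f \<omega>\<bar>) \<le> sqrt (expectation (\<lambda>\<omega>. (f \<omega>)\<^sup>2))"
    by (intro real_le_rsqrt) simp
qed

text \<open>Valid for every event \<open>S\<close>, however it depends on the points: the error is
  at most the mean absolute deviation of the count, hence at most its standard deviation.\<close>

lemma poisson_process_restricted_mean:
  assumes L: "poisson_process M r L" and A: "A \<in> sets borel" "bounded A" and "0 \<le> r"
    and S: "S \<in> events"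
  defines "\<mu> \<equiv> r * measure lborel A"
  shows "integrable M (\<lambda>\<omega>. indicator S \<omega> * real (card (L \<omega> \<inter> A)))"
    and "\<bar>expectation (\<lambda>\<omega>. indicator S \<omega> * real (card (L \<omega> \<inter> A))) - \<mu> * prob S\<bar> \<le> sqrt \<mu>"
proof -
  let ?X = "\<lambda>\<omega>. card (L \<omega> \<inter> A)"
  note X [measurable] = poisson_process_card_measurable[OF L A]
  note S [measurable]
  have "0 \<le> \<mu>" using \<open>0 \<le> r\<close> by (simp add: \<mu>_def)
  have pois: "prob {\<omega> \<in> space M. ?X \<omega> = k} = \<mu> ^ k / fact k * exp (- \<mu>)" for k
    using L A unfolding poisson_process_def \<mu>_def by blast
  note var = poisson_variance[OF X \<open>0 \<le> \<mu>\<close> pois]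
  have int: "integrable M (\<lambda>\<omega>. real (?X \<omega>) - \<mu>)"
    and abs: "expectation (\<lambda>\<omega>. \<bar>real (?X \<omega>) - \<mu>\<bar>) \<le> sqrt \<mu>"
    using expectation_abs_le_sqrt[of "\<lambda>\<omega>. real (?X \<omega>) - \<mu>"] var by auto
  have int1: "integrable M (\<lambda>\<omega>. indicator S \<omega> * (real (?X \<omega>) - \<mu>))"
    using integrable_mult_indicator[OF S int] by simp
  have int2: "integrable M (\<lambda>\<omega>. indicator S \<omega> * \<mu>)"
    using S by (simp add: emeasure_eq_measure)
  have split: "indicator S \<omega> * real (?X \<omega>) = indicator S \<omega> * (real (?X \<omega>) - \<mu>) + indicator S \<omega> * \<mu>" for \<omega>
    by (simp add: algebra_simps)
  show "integrable M (\<lambda>\<omega>. indicator S \<omega> * real (?X \<omega>))"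
    unfolding split by (intro Bochner_Integration.integrable_add int1 int2)
  have "expectation (\<lambda>\<omega>. indicator S \<omega> * real (?X \<omega>)) =
      expectation (\<lambda>\<omega>. indicator S \<omega> * (real (?X \<omega>) - \<mu>)) + \<mu> * prob S"
    unfolding split using S
    by (subst Bochner_Integration.integral_add[OF int1 int2]) (simp add: mult.commute)
  moreover have "\<bar>expectation (\<lambda>\<omega>. indicator S \<omega> * (real (?X \<omega>) - \<mu>))\<bar> \<le>
      expectation (\<lambda>\<omega>. \<bar>real (?X \<omega>) - \<mu>\<bar>)"
    by (intro order_trans[OF integral_abs_bound] integral_mono integrable_abs int int1)
       (auto simp: abs_mult split: split_indicator)
  ultimately show "\<bar>expectation (\<lambda>\<omega>. indicator S \<omega> * real (?X \<omega>)) - \<mu> * prob S\<bar> \<le> sqrt \<mu>"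
    using abs by simp
qed

text \<open>
  Adding up \<open>n\<close> disjoint unit cells, the error \<open>sqrt (r * n)\<close> is negligible compared with \<open>n\<close>,
  so no ergodic theorem is needed.
\<close>

lemma poisson_process_mean_on_event:
  assumes L: "poisson_process M r L" and "0 \<le> r" and S: "S \<in> events"
    and Q: "\<And>k :: nat. Q k \<in> sets borel" "\<And>k. bounded (Q k)" "\<And>k. measure lborel (Q k) = 1"
    and disj: "disjoint_family Q"
    and I: "\<And>k. (\<integral>\<^sup>+\<omega>. of_nat (card (L \<omega> \<inter> Q k)) * indicator S \<omega> \<partial>M) = I"
  shows "I = ennreal (r * prob S)"
proof -
  let ?c = "expectation (\<lambda>\<omega>. indicator S \<omega> * real (card (L \<omega> \<inter> Q 0)))"
  note int = poisson_process_restricted_mean(1)[OF L Q(1,2) \<open>0 \<le> r\<close> S]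
  have I_eq: "I = ennreal (expectation (\<lambda>\<omega>. indicator S \<omega> * real (card (L \<omega> \<inter> Q k))))" for k
  proof -
    have "I = (\<integral>\<^sup>+\<omega>. ennreal (indicator S \<omega> * real (card (L \<omega> \<inter> Q k))) \<partial>M)"
      unfolding I[of k, symmetric]
      by (intro nn_integral_cong) (auto simp: ennreal_of_nat_eq_real_of_nat split: split_indicator)
    also have "\<dots> = ennreal (expectation (\<lambda>\<omega>. indicator S \<omega> * real (card (L \<omega> \<inter> Q k))))"
      using int[of k] by (intro nn_integral_eq_integral) auto
    finally show ?thesis .
  qed
  have c: "expectation (\<lambda>\<omega>. indicator S \<omega> * real (card (L \<omega> \<inter> Q k))) = ?c" for k
  proof -
    have "0 \<le> expectation (\<lambda>\<omega>. indicator S \<omega> * real (card (L \<omega> \<inter> Q k)))" for k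
      by (intro integral_nonneg_AE) auto
    from ennreal_inj[OF this this] trans[OF I_eq[of k, symmetric] I_eq[of 0]] show ?thesis by blast
  qed
  have bound: "\<bar>?c - r * prob S\<bar> \<le> sqrt (r / n)" if n: "0 < n" for n :: nat
  proof -
    let ?U = "\<Union>k<n. Q k"
    have U: "?U \<in> sets borel" "bounded ?U" using Q by (auto intro!: bounded_UN)
    have vol: "measure lborel ?U = n"
    proof -
      have "measure lborel ?U = (\<Sum>k<n. measure lborel (Q k))"
        using disj Q
        by (intro measure_UNION' bounded_borel_fmeasurable)
           (auto simp: pairwise_def disjnt_def disjoint_family_on_def)
      then show ?thesis using Q by simp
    qed
    have card: "card (L \<omega> \<inter> ?U) = (\<Sum>k<n. card (L \<omega> \<inter> Q k))" if "\<omega> \<in> space M" for \<omega>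
    proof -
      have "finite (L \<omega> \<inter> Q k)" for k
        using poisson_process_locally_finite[OF L that] Q by (auto simp: locally_finite_set_def)
      then have "card (\<Union>k<n. L \<omega> \<inter> Q k) = (\<Sum>k<n. card (L \<omega> \<inter> Q k))"
        using disj by (intro card_UN_disjoint) (auto simp: disjoint_family_on_def)
      then show ?thesis by (simp only: Int_UN_distrib)
    qed
    have "expectation (\<lambda>\<omega>. indicator S \<omega> * real (card (L \<omega> \<inter> ?U))) =
        expectation (\<lambda>\<omega>. \<Sum>k<n. indicator S \<omega> * real (card (L \<omega> \<inter> Q k)))"
      by (intro Bochner_Integration.integral_cong refl) (simp add: card sum_distrib_left)
    also have "\<dots> = (\<Sum>k<n. expectation (\<lambda>\<omega>. indicator S \<omega> * real (card (L \<omega> \<inter> Q k))))"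
      using int by (intro Bochner_Integration.integral_sum) auto
    also have "\<dots> = (\<Sum>k<n. ?c)" by (intro sum.cong refl c)
    also have "\<dots> = n * ?c" by simp
    finally have "\<bar>n * ?c - r * n * prob S\<bar> \<le> sqrt (r * n)"
      using poisson_process_restricted_mean(2)[OF L U \<open>0 \<le> r\<close> S] unfolding vol by simp
    then have "n * \<bar>?c - r * prob S\<bar> \<le> sqrt (r * n)"
    proof -
      have "n * ?c - r * n * prob S = n * (?c - r * prob S)" by (simp add: algebra_simps)
      then have "\<bar>n * ?c - r * n * prob S\<bar> = n * \<bar>?c - r * prob S\<bar>"
        by (simp only: abs_mult abs_of_nat)
      then show ?thesis using \<open>\<bar>n * ?c - r * n * prob S\<bar> \<le> sqrt (r * n)\<close> by simp
    qed
    then have "\<bar>?c - r * prob S\<bar> \<le> sqrt (r * n) / n" using n by (simp add: pos_le_divide_eq mult.commute)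
    also have "\<dots> = sqrt (r * n / (real n)\<^sup>2)"
      using n by (simp only: real_sqrt_divide) simp
    also have "r * n / (real n)\<^sup>2 = r / n" using n by (simp add: power2_eq_square)
    finally show ?thesis .
  qed
  have "(\<lambda>n. sqrt (r * inverse (real (Suc n)))) \<longlonglongrightarrow> sqrt (r * 0)"
    by (intro tendsto_intros LIMSEQ_inverse_real_of_nat)
  then have "\<bar>?c - r * prob S\<bar> \<le> sqrt (r * 0)"
    by (rule LIMSEQ_le_const) (use bound[of "Suc _"] in \<open>auto simp: divide_inverse\<close>)
  then have "?c = r * prob S" by simp
  then show ?thesis using I_eq[of 0] by simp
qed

end

section \<open>Mass transport\<close>

lemma stable_pair_translate:
  fixes X Y :: "'a::real_normed_vector set"
  shows "stable_pair ((+) t ` X) ((+) t ` Y) (t + a) (t + b) \<longleftrightarrow> stable_pair X Y a b"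
proof -
  have *: "(stable_pair X Y a b \<longrightarrow> stable_pair ((+) t ` X) ((+) t ` Y) (t + a) (t + b)) \<and>
      (unstable_pair X Y c d \<longrightarrow> unstable_pair ((+) t ` X) ((+) t ` Y) (t + c) (t + d))"
    for t a b c d and X Y :: "'a set"
  proof (induction rule: stable_pair_unstable_pair.induct)
    case (stable_pairI a b)
    then show ?case by (intro stable_pair_unstable_pair.stable_pairI) auto
  next
    case (unstable_pair_left a' b a)
    then show ?case
      by (intro stable_pair_unstable_pair.unstable_pair_left[of _ _ "t + a'"]) auto
  next
    case (unstable_pair_right a b' b)
    then show ?case
      by (intro stable_pair_unstable_pair.unstable_pair_right[of _ _ _ "t + b'"]) auto
  qed
  have "stable_pair X Y a b" if "stable_pair ((+) t ` X) ((+) t ` Y) (t + a) (t + b)"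
  proof -
    have cancel: "(+) (- t) ` ((+) t ` Z) = Z" for Z :: "'a set" by (simp add: image_comp)
    have "stable_pair ((+) (- t) ` (+) t ` X) ((+) (- t) ` (+) t ` Y) (- t + (t + a)) (- t + (t + b))"
      using * that by blast
    then show ?thesis unfolding cancel by simp
  qed
  then show ?thesis using * by blast
qed

lemma cell_zero_translate: "t \<in> grid 0 \<Longrightarrow> cell 0 (t + x) = t + cell 0 x"
  using cell_zero_add[of t x] by (simp add: add.commute)

lemma card_cell_pairs_translate:
  assumes "t \<in> grid 0"
  shows "card (cell_pairs (t + z) (t + w) ((+) t ` X) ((+) t ` Y)) = card (cell_pairs z w X Y)"
proof -
  have "cell_pairs (t + z) (t + w) ((+) t ` X) ((+) t ` Y) = map_prod ((+) t) ((+) t) ` cell_pairs z w X Y"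
  proof (intro set_eqI iffI)
    fix p assume "p \<in> cell_pairs (t + z) (t + w) ((+) t ` X) ((+) t ` Y)"
    then obtain a b where p: "p = (a, b)" and ab: "stable_pair ((+) t ` X) ((+) t ` Y) a b"
        "cell 0 a = t + z" "cell 0 b = t + w"
      by (auto simp: cell_pairs_def)
    obtain a' b' where "a = t + a'" "b = t + b'" using stable_pair_mem[OF ab(1)] by auto
    then show "p \<in> map_prod ((+) t) ((+) t) ` cell_pairs z w X Y"
      using p ab assms
      by (intro image_eqI[of _ _ "(a', b')"])
         (auto simp: cell_pairs_def stable_pair_translate cell_zero_translate)
  next
    fix p assume "p \<in> map_prod ((+) t) ((+) t) ` cell_pairs z w X Y"
    then show "p \<in> cell_pairs (t + z) (t + w) ((+) t ` X) ((+) t ` Y)"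
      using assms by (auto simp: cell_pairs_def stable_pair_translate cell_zero_translate)
  qed
  moreover have "inj_on (map_prod ((+) t) ((+) t)) (cell_pairs z w X Y)"
    by (auto simp: inj_on_def)
  ultimately show ?thesis by (simp only: card_image)
qed

lemma card_cell_pairs_swap: "card (cell_pairs z w X Y) = card (cell_pairs w z Y X)"
proof -
  have "cell_pairs w z Y X = prod.swap ` cell_pairs z w X Y"
    by (force simp: cell_pairs_def stable_pair_swap[of X Y] image_iff)
  then show ?thesis by (simp add: card_image)
qed

section \<open>Counting matched points by the cells of their partners\<close>

lemma stable_pair_unique:
  assumes "no_ties X Y" "stable_pair X Y a b" "stable_pair X Y a b'"
  shows "b = b'"
proof -
  have "dist a b = dist a b'"
    using stable_pair_closest(2)[OF assms(2,3)] stable_pair_closest(2)[OF assms(3,2)] by simp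
  then show ?thesis
    using assms(1) stable_pair_mem[OF assms(2)] stable_pair_mem[OF assms(3)]
    by (auto simp: no_ties_def dest: inj_onD)
qed

lemma no_ties_swap: "no_ties X Y \<longleftrightarrow> no_ties Y X"
  by (auto simp: no_ties_def dist_commute)

definition matched_in :: "real ^ 'd \<Rightarrow> (real ^ 'd) set \<Rightarrow> (real ^ 'd) set \<Rightarrow> (real ^ 'd) set" where
  "matched_in z X Y = {a \<in> X. cell 0 a = z \<and> (\<exists>b. stable_pair X Y a b)}"

lemma matched_in_subset: "matched_in z X Y \<subseteq> X \<inter> {x. cell 0 x = z}"
  by (auto simp: matched_in_def)

lemma finite_Int_cell: "locally_finite_set X \<Longrightarrow> finite (X \<inter> {x. cell n x = z})"
  using finite_points_in_cell[of X n z] by (simp add: Int_def)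

lemma card_matched_in_le:
  "locally_finite_set X \<Longrightarrow> card (matched_in z X Y) \<le> card (X \<inter> {x. cell 0 x = z})"
  by (rule card_mono[OF finite_Int_cell matched_in_subset])

lemma matched_in_eq:
  "(\<And>a. a \<in> X \<Longrightarrow> \<exists>b. stable_pair X Y a b) \<Longrightarrow> matched_in z X Y = X \<inter> {x. cell 0 x = z}"
  by (auto simp: matched_in_def)

text \<open>Without ties each matched point has exactly one partner, and this partner lies in
  exactly one unit cell.\<close>

lemma sum_card_cell_pairs:
  assumes X: "locally_finite_set X" and ties: "no_ties X Y"
  shows "(\<integral>\<^sup>+w. of_nat (card (cell_pairs z w X Y)) \<partial>count_space (grid 0)) =
    (of_nat (card (matched_in z X Y)) :: ennreal)"
proof -
  let ?A = "matched_in z X Y"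
  have fin: "finite ?A" using matched_in_subset finite_Int_cell[OF X] by (rule finite_subset)
  define m where "m a = (SOME b. stable_pair X Y a b)" for a
  have m: "stable_pair X Y a b \<longleftrightarrow> b = m a" if "a \<in> ?A" for a b
  proof -
    have ex: "\<exists>b. stable_pair X Y a b" using that by (auto simp: matched_in_def)
    have "stable_pair X Y a (m a)" unfolding m_def by (rule someI_ex[OF ex])
    then show ?thesis using stable_pair_unique[OF ties] by blast
  qed
  have "of_nat (card (cell_pairs z w X Y)) = (\<Sum>a\<in>?A. indicator {cell 0 (m a)} w :: ennreal)" for w
  proof -
    have "cell_pairs z w X Y = (\<lambda>a. (a, m a)) ` {a \<in> ?A. cell 0 (m a) = w}"
    proof (intro set_eqI iffI)
      fix p assume "p \<in> cell_pairs z w X Y"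
      then obtain a b where p: "p = (a, b)" "stable_pair X Y a b" "cell 0 a = z" "cell 0 b = w"
        by (auto simp: cell_pairs_def)
      then have "a \<in> ?A" using stable_pair_mem(1) by (auto simp: matched_in_def)
      then show "p \<in> (\<lambda>a. (a, m a)) ` {a \<in> ?A. cell 0 (m a) = w}" using p m by auto
    next
      fix p assume "p \<in> (\<lambda>a. (a, m a)) ` {a \<in> ?A. cell 0 (m a) = w}"
      then obtain a where p: "p = (a, m a)" "a \<in> ?A" "cell 0 (m a) = w" by auto
      then have "stable_pair X Y a (m a)" "cell 0 a = z" using m by (auto simp: matched_in_def)
      then show "p \<in> cell_pairs z w X Y" using p by (simp add: cell_pairs_def)
    qed
    then have "card (cell_pairs z w X Y) = card {a \<in> ?A. cell 0 (m a) = w}"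
      by (simp add: card_image inj_on_def)
    also have "\<dots> = (\<Sum>a\<in>?A. if cell 0 (m a) = w then 1 else 0)"
      using fin by (simp add: sum.If_cases Int_def)
    finally show ?thesis by (auto simp: indicator_def intro!: sum.cong)
  qed
  then have "(\<integral>\<^sup>+w. of_nat (card (cell_pairs z w X Y)) \<partial>count_space (grid 0)) =
      (\<integral>\<^sup>+w. (\<Sum>a\<in>?A. indicator {cell 0 (m a)} w) \<partial>count_space (grid 0))"
    by simp
  also have "\<dots> = (\<Sum>a\<in>?A. \<integral>\<^sup>+w. indicator {cell 0 (m a)} w \<partial>count_space (grid 0))"
    by (intro nn_integral_sum) simp
  also have "\<dots> = (\<Sum>a\<in>?A. 1)" by (intro sum.cong refl) (simp add: nn_integral_indicator)
  finally show ?thesis by simp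
qed

text \<open>The lower limit makes this measurable on all configurations; on generic ones the
  sequence is eventually constant and equals the number of stable pairs.\<close>

definition transport :: "real ^ 'd \<Rightarrow> real ^ 'd \<Rightarrow> (real ^ 'd) set \<times> (real ^ 'd) set \<Rightarrow> ennreal" where
  "transport z w p = liminf (\<lambda>n. of_nat (card (cell_pairs z w (discr n (fst p)) (discr n (snd p)))))"

definition generic :: "'a::metric_space set \<times> 'a set \<Rightarrow> bool" where
  "generic p \<longleftrightarrow> locally_finite_set (fst p) \<and> locally_finite_set (snd p) \<and>
     no_ties (fst p) (snd p) \<and> wf (descent (fst p) (snd p))"

lemma transport_eq:
  assumes "generic (X, Y)"
  shows "transport z w (X, Y) = of_nat (card (cell_pairs z w X Y))"
proof -
  have "\<forall>\<^sub>F n in sequentially. card (cell_pairs z w (discr n X) (discr n Y)) = card (cell_pairs z w X Y)"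
    using assms by (intro eventually_card_cell_pairs) (auto simp: generic_def)
  then have "(\<lambda>n. of_nat (card (cell_pairs z w (discr n X) (discr n Y))) :: ennreal)
      \<longlonglongrightarrow> of_nat (card (cell_pairs z w X Y))"
    by (intro tendsto_eventually) (auto elim!: eventually_mono)
  then show ?thesis unfolding transport_def by (intro lim_imp_Liminf) auto
qed

text \<open>The value of \<open>discr n\<close> is decided by asking for finitely many cells whether
  they are occupied.\<close>

lemma measurable_discr:
  "(discr n :: (real ^ 'd) set \<Rightarrow> _) \<in>
    measurable configurations (count_space (Pow (grid n \<inter> cball 0 n)))"
proof -
  let ?G = "grid n \<inter> cball 0 n :: (real ^ 'd) set"
  have fin: "finite ?G" by (intro finite_grid_bounded) simp
  have "discr n -` {Q} \<inter> space configurations \<in> sets configurations" if Q: "Q \<in> Pow ?G" for Q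
  proof -
    have iff: "discr n X = Q \<longleftrightarrow> (\<forall>q\<in>?G. (\<exists>x\<in>X. x \<in> {x. cell n x = q}) \<longleftrightarrow> q \<in> Q)" for X
    proof
      assume "discr n X = Q"
      then show "\<forall>q\<in>?G. (\<exists>x\<in>X. x \<in> {x. cell n x = q}) \<longleftrightarrow> q \<in> Q" by (auto simp: discr_def)
    next
      assume *: "\<forall>q\<in>?G. (\<exists>x\<in>X. x \<in> {x. cell n x = q}) \<longleftrightarrow> q \<in> Q"
      show "discr n X = Q"
      proof (intro set_eqI iffI)
        fix q assume "q \<in> discr n X"
        then have "q \<in> ?G" "\<exists>x\<in>X. x \<in> {x. cell n x = q}"
          using discr_subset[of n X] by (auto simp: discr_def)
        then show "q \<in> Q" using * by blast
      next
        fix q assume "q \<in> Q"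
        then have q: "q \<in> ?G" using Q by blast
        have "\<exists>x\<in>X. x \<in> {x. cell n x = q}" using bspec[OF * q] \<open>q \<in> Q\<close> by (rule iffD2)
        then obtain x where "x \<in> X" "cell n x = q" by auto
        then show "q \<in> discr n X" using q by (auto simp: discr_def)
      qed
    qed
    have "Measurable.pred configurations (\<lambda>X. \<forall>q\<in>?G. (\<exists>x\<in>X. x \<in> {x. cell n x = q}) \<longleftrightarrow> q \<in> Q)"
    proof (intro pred_intros_finite fin)
      fix q :: "real ^ 'd"
      have [measurable]: "Measurable.pred configurations (\<lambda>X. \<exists>x\<in>X. x \<in> {x. cell n x = q})"
        by (intro occupied_measurable cell_vimage_borel bounded_cell)
      show "Measurable.pred configurations (\<lambda>X. (\<exists>x\<in>X. x \<in> {x. cell n x = q}) \<longleftrightarrow> q \<in> Q)"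
        by measurable
    qed
    then show ?thesis
      unfolding iff[symmetric] by (simp add: pred_def vimage_def Int_def conj_commute)
  qed
  moreover have "discr n \<in> space configurations \<rightarrow> Pow ?G" using discr_subset by blast
  moreover have "finite (Pow ?G)" using fin by (rule finite_Pow_iff[THEN iffD2])
  ultimately show ?thesis
    by (simp only: measurable_count_space_eq2) blast
qed

abbreviation pair_configurations :: "((real ^ 'd) set \<times> (real ^ 'd) set) measure" where
  "pair_configurations \<equiv> configurations \<Otimes>\<^sub>M configurations"

lemma transport_measurable [measurable]:
  fixes z w :: "real ^ 'd"
  shows "transport z w \<in> borel_measurable pair_configurations"
proof -
  have "(\<lambda>p. of_nat (card (cell_pairs z w (discr n (fst p)) (discr n (snd p)))) :: ennreal)
      \<in> borel_measurable pair_configurations" for n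
  proof (rule measurable_compose_countable'[where f = "\<lambda>Q p. of_nat (card (cell_pairs z w Q (discr n (snd p))))"])
    have fin: "finite (Pow (grid n \<inter> cball 0 n) :: (real ^ 'd) set set)"
      by (intro finite_Pow_iff[THEN iffD2] finite_grid_bounded) simp
    show cnt: "countable (Pow (grid n \<inter> cball 0 n) :: (real ^ 'd) set set)"
      by (rule countable_finite[OF fin])
    show "(\<lambda>p. discr n (fst p)) \<in> measurable pair_configurations (count_space (Pow (grid n \<inter> cball 0 n)))"
      by (rule measurable_compose[OF measurable_fst measurable_discr])
    fix Q :: "(real ^ 'd) set"
    show "(\<lambda>p. of_nat (card (cell_pairs z w Q (discr n (snd p)))) :: ennreal) \<in> borel_measurable pair_configurations"
    proof (rule measurable_compose_countable'[where f = "\<lambda>R p. of_nat (card (cell_pairs z w Q R))", OF _ _ cnt])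
      show "(\<lambda>p. discr n (snd p)) \<in> measurable pair_configurations (count_space (Pow (grid n \<inter> cball 0 n)))"
        by (rule measurable_compose[OF measurable_snd measurable_discr])
    qed simp
  qed
  then show ?thesis unfolding transport_def[abs_def] by (intro borel_measurable_liminf)
qed

definition outflow :: "real ^ 'd \<Rightarrow> (real ^ 'd) set \<times> (real ^ 'd) set \<Rightarrow> ennreal" where
  "outflow z p = (\<integral>\<^sup>+w. transport z w p \<partial>count_space (grid 0))"

definition inflow :: "real ^ 'd \<Rightarrow> (real ^ 'd) set \<times> (real ^ 'd) set \<Rightarrow> ennreal" where
  "inflow z p = (\<integral>\<^sup>+w. transport w z p \<partial>count_space (grid 0))"

lemma outflow_eq:
  assumes "generic (X, Y)" shows "outflow z (X, Y) = of_nat (card (matched_in z X Y))"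
  using assms unfolding outflow_def transport_eq[OF assms]
  by (intro sum_card_cell_pairs) (auto simp: generic_def)

lemma inflow_eq:
  assumes "generic (X, Y)" shows "inflow z (X, Y) = of_nat (card (matched_in z Y X))"
  using assms unfolding inflow_def transport_eq[OF assms] card_cell_pairs_swap[of _ _ X Y]
  by (intro sum_card_cell_pairs) (auto simp: generic_def no_ties_swap)

lemma outflow_measurable [measurable]:
  fixes z :: "real ^ 'd"
  shows "outflow z \<in> borel_measurable pair_configurations"
proof -
  interpret sigma_finite_measure "count_space (grid 0 :: (real ^ 'd) set)"
    by (rule sigma_finite_measure_count_space_countable[OF countable_grid])
  have "(\<lambda>(p, w). transport z w p) \<in> borel_measurable (pair_configurations \<Otimes>\<^sub>M count_space (grid 0))"
    unfolding case_prod_beta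
    by (rule measurable_compose_countable'[where f = "\<lambda>w p. transport z w (fst p)" and g = snd and I = "grid 0"])
       (auto intro: countable_grid)
  then show ?thesis
    unfolding outflow_def[abs_def] by (rule borel_measurable_nn_integral)
qed

lemma card_in_cell_measurable [measurable]:
  "(\<lambda>X. of_nat (card (X \<inter> {x. cell 0 x = z})) :: ennreal) \<in> borel_measurable configurations"
  using measurable_card_Int[OF cell_vimage_borel bounded_cell]
  by (rule measurable_compose) simp

text \<open>Phrased through measurable counts to obtain an event; \<open>unmatched_amber_iff\<close>
  relates it to stable pairs on generic configurations.\<close>

definition unmatched_amber :: "((real ^ 'd) set \<times> (real ^ 'd) set) set" where
  "unmatched_amber = {p \<in> space pair_configurations.
     \<exists>z\<in>grid 0. outflow z p < of_nat (card (fst p \<inter> {x. cell 0 x = z}))}"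

lemma unmatched_amber_sets: "unmatched_amber \<in> sets pair_configurations"
proof -
  have "{p \<in> space pair_configurations. outflow z p < of_nat (card (fst p \<inter> {x. cell 0 x = z}))}
      \<in> sets pair_configurations" for z :: "real ^ 'd"
    by measurable
  then have "(\<Union>z\<in>grid 0. {p \<in> space pair_configurations. outflow z p < of_nat (card (fst p \<inter> {x. cell 0 x = z}))})
      \<in> sets (pair_configurations :: ((real ^ 'd) set \<times> (real ^ 'd) set) measure)"
    by (intro sets.countable_UN' countable_grid) auto
  also have "(\<Union>z\<in>grid 0. {p \<in> space pair_configurations. outflow z p < of_nat (card (fst p \<inter> {x. cell 0 x = z}))}) =
      (unmatched_amber :: ((real ^ 'd) set \<times> (real ^ 'd) set) set)"
    by (auto simp: unmatched_amber_def)
  finally show ?thesis .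
qed

lemma unmatched_amber_iff:
  assumes "generic (X, Y)"
  shows "(X, Y) \<in> unmatched_amber \<longleftrightarrow> (\<exists>a\<in>X. \<forall>b. \<not> stable_pair X Y a b)"
proof -
  have lf: "locally_finite_set X" "locally_finite_set Y" using assms by (auto simp: generic_def)
  have "card (matched_in z X Y) < card (X \<inter> {x. cell 0 x = z}) \<longleftrightarrow>
      (\<exists>a\<in>X. cell 0 a = z \<and> (\<forall>b. \<not> stable_pair X Y a b))" for z
  proof
    assume "card (matched_in z X Y) < card (X \<inter> {x. cell 0 x = z})"
    then have "\<not> X \<inter> {x. cell 0 x = z} \<subseteq> matched_in z X Y"
      using card_mono[of "matched_in z X Y" "X \<inter> {x. cell 0 x = z}"]
        finite_subset[OF matched_in_subset finite_Int_cell[OF lf(1)]] by fastforce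
    then show "\<exists>a\<in>X. cell 0 a = z \<and> (\<forall>b. \<not> stable_pair X Y a b)" by (auto simp: matched_in_def)
  next
    assume "\<exists>a\<in>X. cell 0 a = z \<and> (\<forall>b. \<not> stable_pair X Y a b)"
    then have "matched_in z X Y \<subset> X \<inter> {x. cell 0 x = z}" by (auto simp: matched_in_def)
    then show "card (matched_in z X Y) < card (X \<inter> {x. cell 0 x = z})"
      by (rule psubset_card_mono[OF finite_Int_cell[OF lf(1)]])
  qed
  moreover have "(\<exists>z\<in>grid 0. \<exists>a\<in>X. cell 0 a = z \<and> (\<forall>b. \<not> stable_pair X Y a b)) \<longleftrightarrow>
      (\<exists>a\<in>X. \<forall>b. \<not> stable_pair X Y a b)"
    using cell_in_grid by blast
  ultimately show ?thesis
    using lf by (simp add: unmatched_amber_def outflow_eq[OF assms] space_pair_measure space_configurations)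
qed

text \<open>An unmatched \<open>a\<close> forms an unstable pair with every blue point
  \<open>b\<close>. The closer stable pair responsible cannot contain \<open>a\<close>, so it
  contains \<open>b\<close>.\<close>

lemma unmatched_amber_blue_matched:
  assumes "generic (X, Y)" "(X, Y) \<in> unmatched_amber" "b \<in> Y"
  shows "\<exists>a. stable_pair Y X b a"
proof -
  obtain a where a: "a \<in> X" "\<And>b. \<not> stable_pair X Y a b"
    using assms unmatched_amber_iff by blast
  have wf: "wf (descent X Y)" using assms by (simp add: generic_def)
  show ?thesis
    using wf a(1) assms(3) a(2)[of b]
    by (cases rule: unstable_pair_cases) (use a(2) stable_pair_swap in blast)+
qed

section \<open>Mass transport and comparison of the intensities\<close>

context poisson_pair
begin

lemma AE_generic: "AE \<omega> in M. generic (LA \<omega>, LB \<omega>)"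
  using AE_no_ties AE_wf_descent AE_space
  by eventually_elim (auto simp: generic_def locally_finite)

lemma AE_generic_translate: "AE \<omega> in M. generic ((+) t ` LA \<omega>, (+) t ` LB \<omega>)"
proof -
  interpret T: poisson_pair M \<alpha> \<beta> "\<lambda>\<omega>. (+) t ` LA \<omega>" "\<lambda>\<omega>. (+) t ` LB \<omega>"
    by (rule translate)
  show ?thesis by (rule T.AE_generic)
qed

text \<open>Integer translations are those respecting the unit cells. Invariance is asked up to null
  sets because the flows are identified with the matching only on generic configurations, which have
  to be generic before and after the translation.\<close>

definition invariant_event :: "((real ^ 'd) set \<times> (real ^ 'd) set) set \<Rightarrow> bool" where
  "invariant_event W \<longleftrightarrow> W \<in> sets pair_configurations \<and>
     (\<forall>t\<in>grid 0. AE \<omega> in M. ((+) t ` LA \<omega>, (+) t ` LB \<omega>) \<in> W \<longleftrightarrow> (LA \<omega>, LB \<omega>) \<in> W)"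

lemma invariant_unmatched_amber: "invariant_event unmatched_amber"
  unfolding invariant_event_def
proof (intro conjI ballI unmatched_amber_sets)
  fix t :: "real ^ 'd"
  show "AE \<omega> in M. ((+) t ` LA \<omega>, (+) t ` LB \<omega>) \<in> unmatched_amber \<longleftrightarrow> (LA \<omega>, LB \<omega>) \<in> unmatched_amber"
    using AE_generic AE_generic_translate[of t]
  proof eventually_elim
    case (elim \<omega>)
    have "(\<forall>b. \<not> stable_pair ((+) t ` LA \<omega>) ((+) t ` LB \<omega>) (t + a) b) \<longleftrightarrow>
        (\<forall>b. \<not> stable_pair (LA \<omega>) (LB \<omega>) a b)" for a
    proof -
      have "(\<exists>b. stable_pair ((+) t ` LA \<omega>) ((+) t ` LB \<omega>) (t + a) b) \<longleftrightarrow>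
          (\<exists>b. stable_pair (LA \<omega>) (LB \<omega>) a b)"
        using stable_pair_translate[of t "LA \<omega>" "LB \<omega>" a] stable_pair_mem(2) by (metis imageE)
      then show ?thesis by blast
    qed
    then show ?case
      by (simp add: unmatched_amber_iff[OF elim(1)] unmatched_amber_iff[OF elim(2)])
  qed
qed

lemma invariant_event_Compl:
  assumes "invariant_event W" shows "invariant_event (space pair_configurations - W)"
  unfolding invariant_event_def
proof (intro conjI ballI)
  show "space pair_configurations - W \<in> sets pair_configurations"
    using assms by (auto simp: invariant_event_def)
  fix t :: "real ^ 'd" assume "t \<in> grid 0"
  then have "AE \<omega> in M. ((+) t ` LA \<omega>, (+) t ` LB \<omega>) \<in> W \<longleftrightarrow> (LA \<omega>, LB \<omega>) \<in> W"
    using assms by (simp add: invariant_event_def)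
  then show "AE \<omega> in M. ((+) t ` LA \<omega>, (+) t ` LB \<omega>) \<in> space pair_configurations - W \<longleftrightarrow>
      (LA \<omega>, LB \<omega>) \<in> space pair_configurations - W"
    using AE_space
    by eventually_elim
       (simp add: space_pair_measure space_configurations locally_finite locally_finite_translate)
qed

lemma transport_invariant:
  assumes W: "invariant_event W" and t: "t \<in> grid 0"
  shows "(\<integral>\<^sup>+\<omega>. transport (t + z) (t + w) (LA \<omega>, LB \<omega>) * indicator W (LA \<omega>, LB \<omega>) \<partial>M) =
    (\<integral>\<^sup>+\<omega>. transport z w (LA \<omega>, LB \<omega>) * indicator W (LA \<omega>, LB \<omega>) \<partial>M)"
proof -
  have [measurable]: "W \<in> sets pair_configurations" using W by (simp add: invariant_event_def)
  let ?h = "\<lambda>p. transport (t + z) (t + w) p * indicator W p"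
  have "(\<integral>\<^sup>+\<omega>. ?h (LA \<omega>, LB \<omega>) \<partial>M) = (\<integral>\<^sup>+\<omega>. ?h ((+) t ` LA \<omega>, (+) t ` LB \<omega>) \<partial>M)"
    by (rule nn_integral_translate[symmetric]) measurable
  also have "\<dots> = (\<integral>\<^sup>+\<omega>. transport z w (LA \<omega>, LB \<omega>) * indicator W (LA \<omega>, LB \<omega>) \<partial>M)"
  proof (rule nn_integral_cong_AE)
    have "AE \<omega> in M. ((+) t ` LA \<omega>, (+) t ` LB \<omega>) \<in> W \<longleftrightarrow> (LA \<omega>, LB \<omega>) \<in> W"
      using W t by (simp add: invariant_event_def)
    then show "AE \<omega> in M. ?h ((+) t ` LA \<omega>, (+) t ` LB \<omega>) =
        transport z w (LA \<omega>, LB \<omega>) * indicator W (LA \<omega>, LB \<omega>)"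
      using AE_generic AE_generic_translate[of t]
      by eventually_elim (simp add: transport_eq card_cell_pairs_translate[OF t] indicator_def)
  qed
  finally show ?thesis .
qed

text \<open>The expected mass sent between two unit cells depends only on their difference, so
  summing it over all targets of \<open>z\<close> or over all sources of \<open>z\<close> gives the
  same total.\<close>

lemma mass_transport:
  assumes W: "invariant_event W" and z: "z \<in> grid 0"
  shows "(\<integral>\<^sup>+\<omega>. outflow z (LA \<omega>, LB \<omega>) * indicator W (LA \<omega>, LB \<omega>) \<partial>M) =
    (\<integral>\<^sup>+\<omega>. inflow z (LA \<omega>, LB \<omega>) * indicator W (LA \<omega>, LB \<omega>) \<partial>M)"
proof -
  have [measurable]: "W \<in> sets pair_configurations" using W by (simp add: invariant_event_def)
  define m where "m v w = (\<integral>\<^sup>+\<omega>. transport v w (LA \<omega>, LB \<omega>) * indicator W (LA \<omega>, LB \<omega>) \<partial>M)" for v w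
  have meas: "(\<lambda>\<omega>. transport v w (LA \<omega>, LB \<omega>) * indicator W (LA \<omega>, LB \<omega>)) \<in> borel_measurable M" for v w
    by measurable
  have "(\<integral>\<^sup>+\<omega>. outflow z (LA \<omega>, LB \<omega>) * indicator W (LA \<omega>, LB \<omega>) \<partial>M) = (\<integral>\<^sup>+w. m z w \<partial>count_space (grid 0))"
    unfolding outflow_def m_def
    by (subst nn_integral_count_space_nn_integral[OF countable_grid meas, symmetric])
       (simp add: nn_integral_multc)
  \<comment> \<open>Translating by \<open>z - w\<close> carries the source \<open>z\<close> to its
    reflection \<open>2 * z - w\<close> and the target \<open>w\<close> to \<open>z\<close>; the
    reflection permutes the grid.\<close>
  also have "\<dots> = (\<integral>\<^sup>+w. m (z + (z - w)) z \<partial>count_space (grid 0))"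
  proof (intro nn_integral_cong)
    fix w :: "real ^ 'd" assume "w \<in> space (count_space (grid 0))"
    then have "m ((z - w) + z) ((z - w) + w) = m z w"
      unfolding m_def using z by (intro transport_invariant[OF W]) (simp add: grid_diff)
    then show "m z w = m (z + (z - w)) z" by (simp add: add.commute)
  qed
  also have "\<dots> = (\<integral>\<^sup>+w. m w z \<partial>count_space (grid 0))"
  proof (rule nn_integral_bij_count_space)
    show "bij_betw (\<lambda>w. z + (z - w)) (grid 0) (grid 0)"
      by (rule bij_betwI[of _ _ _ "\<lambda>w. z + (z - w)"]) (intro funcsetI grid_add grid_diff z | simp)+
  qed
  also have "\<dots> = (\<integral>\<^sup>+\<omega>. inflow z (LA \<omega>, LB \<omega>) * indicator W (LA \<omega>, LB \<omega>) \<partial>M)"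
    unfolding inflow_def m_def
    by (subst nn_integral_count_space_nn_integral[OF countable_grid meas, symmetric])
       (simp add: nn_integral_multc)
  finally show ?thesis .
qed

text \<open>\<open>pr\<close> selects a colour, so one argument serves both. Invariance makes the
  mean on the event the same for all unit cells, which is what averaging over many of them
  requires.\<close>

lemma mean_on_invariant_event:
  assumes W: "invariant_event W" and z: "z \<in> grid 0"
    and pr: "pr \<in> measurable pair_configurations configurations"
      "\<And>t X Y. pr ((+) t ` X, (+) t ` Y) = (+) t ` pr (X, Y)"
    and pois: "poisson_process M r (\<lambda>\<omega>. pr (LA \<omega>, LB \<omega>))" "0 \<le> r"
  shows "(\<integral>\<^sup>+\<omega>. of_nat (card (pr (LA \<omega>, LB \<omega>) \<inter> {x. cell 0 x = z})) * indicator W (LA \<omega>, LB \<omega>) \<partial>M) =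
    ennreal (r * prob {\<omega> \<in> space M. (LA \<omega>, LB \<omega>) \<in> W})"
proof -
  have [measurable]: "W \<in> sets pair_configurations" using W by (simp add: invariant_event_def)
  note pr(1) [measurable]
  let ?S = "{\<omega> \<in> space M. (LA \<omega>, LB \<omega>) \<in> W}"
  have S: "?S \<in> events" by measurable
  let ?I = "\<lambda>z. \<integral>\<^sup>+\<omega>. of_nat (card (pr (LA \<omega>, LB \<omega>) \<inter> {x. cell 0 x = z})) * indicator W (LA \<omega>, LB \<omega>) \<partial>M"
  have shift: "?I (t + z) = ?I z" if t: "t \<in> grid 0" for t
  proof -
    let ?h = "\<lambda>p. of_nat (card (pr p \<inter> {x. cell 0 x = t + z})) * indicator W p :: ennreal"
    have h: "?h \<in> borel_measurable pair_configurations"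
      using measurable_compose[OF pr(1) card_in_cell_measurable] by measurable
    have vim: "(+) t -` {x. cell 0 x = t + z} = {x. cell 0 x = z}"
      using t by (auto simp: cell_zero_translate)
    have "?I (t + z) = (\<integral>\<^sup>+\<omega>. ?h ((+) t ` LA \<omega>, (+) t ` LB \<omega>) \<partial>M)"
      by (rule nn_integral_translate[OF h, symmetric])
    also have "\<dots> = ?I z"
    proof (rule nn_integral_cong_AE)
      have "AE \<omega> in M. ((+) t ` LA \<omega>, (+) t ` LB \<omega>) \<in> W \<longleftrightarrow> (LA \<omega>, LB \<omega>) \<in> W"
        using W t by (simp add: invariant_event_def)
      then show "AE \<omega> in M. ?h ((+) t ` LA \<omega>, (+) t ` LB \<omega>) =
          of_nat (card (pr (LA \<omega>, LB \<omega>) \<inter> {x. cell 0 x = z})) * indicator W (LA \<omega>, LB \<omega>)"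
        by eventually_elim (simp only: pr(2) card_translate_Int vim indicator_def)
    qed
    finally show ?thesis .
  qed
  \<comment> \<open>Integer multiples of the diagonal vector provide an infinite sequence of
    disjoint unit cells.\<close>
  define t where "t k = ((\<chi> i. real k) :: real ^ 'd)" for k
  have t: "t k \<in> grid 0" for k by (simp add: t_def grid_def)
  have t_inj: "t j + z = t k + z \<longleftrightarrow> j = k" for j k by (auto simp: t_def vec_eq_iff)
  have "?I z = ennreal (r * prob ?S)"
  proof (rule poisson_process_mean_on_event[OF pois S, where Q = "\<lambda>k. {x. cell 0 x = t k + z}"])
    show "measure lborel {x. cell 0 x = t k + z} = 1" for k
      using measure_cell[OF grid_add[OF t z]] by simp
    show "disjoint_family (\<lambda>k. {x. cell 0 x = t k + z})"
      using t_inj by (auto simp: disjoint_family_on_def)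
    show "(\<integral>\<^sup>+\<omega>. of_nat (card (pr (LA \<omega>, LB \<omega>) \<inter> {x. cell 0 x = t k + z})) * indicator ?S \<omega> \<partial>M) = ?I z" for k
      unfolding shift[OF t, of k, symmetric]
      by (intro nn_integral_cong) (auto split: split_indicator)
  qed (auto intro: cell_vimage_borel bounded_cell)
  then show ?thesis .
qed

lemmas mean_amber = mean_on_invariant_event[where pr = fst, simplified, OF _ _ poisson_LA]
lemmas mean_blue = mean_on_invariant_event[where pr = snd, simplified, OF _ _ poisson_LB]

text \<open>On the event every blue point is matched, so the mean inflow is
  \<open>\<beta> * ?p\<close>. It equals the mean outflow, which is at most the mean amber count
  \<open>\<alpha> * ?p\<close>. With \<open>\<alpha> \<le> \<beta>\<close> the outflow is therefore
  almost surely the full amber count there, which the definition of the event forbids.\<close>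

lemma AE_all_matched:
  assumes "\<alpha> \<le> \<beta>"
  shows "AE \<omega> in M. (LA \<omega>, LB \<omega>) \<notin> unmatched_amber"
proof -
  let ?U = "unmatched_amber :: ((real ^ 'd) set \<times> (real ^ 'd) set) set"
  note [measurable] = unmatched_amber_sets
  let ?p = "prob {\<omega> \<in> space M. (LA \<omega>, LB \<omega>) \<in> ?U}"
  have "AE \<omega> in M. (LA \<omega>, LB \<omega>) \<in> ?U \<longrightarrow>
      \<not> outflow z (LA \<omega>, LB \<omega>) < of_nat (card (LA \<omega> \<inter> {x. cell 0 x = z}))"
    if z: "z \<in> grid 0" for z
  proof -
    define f where "f \<omega> = outflow z (LA \<omega>, LB \<omega>) * indicator ?U (LA \<omega>, LB \<omega>)" for \<omega>
    define g :: "'w \<Rightarrow> ennreal"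
      where "g \<omega> = of_nat (card (LA \<omega> \<inter> {x. cell 0 x = z})) * indicator ?U (LA \<omega>, LB \<omega>)" for \<omega>
    have f: "f \<in> borel_measurable M" unfolding f_def[abs_def] by measurable
    have g: "g \<in> borel_measurable M"
      unfolding g_def[abs_def]
      using measurable_compose[OF measurable_LA card_in_cell_measurable] by measurable
    have le: "AE \<omega> in M. f \<omega> \<le> g \<omega>"
      using AE_generic AE_space
      by eventually_elim
         (simp add: f_def g_def outflow_eq card_matched_in_le locally_finite mult_right_mono)
    have int_g: "integral\<^sup>N M g = ennreal (\<alpha> * ?p)"
      unfolding g_def using rates_pos by (intro mean_amber invariant_unmatched_amber z) simp
    have "integral\<^sup>N M f = (\<integral>\<^sup>+\<omega>. inflow z (LA \<omega>, LB \<omega>) * indicator ?U (LA \<omega>, LB \<omega>) \<partial>M)"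
      unfolding f_def by (intro mass_transport invariant_unmatched_amber z)
    also have "\<dots> = (\<integral>\<^sup>+\<omega>. of_nat (card (LB \<omega> \<inter> {x. cell 0 x = z})) * indicator ?U (LA \<omega>, LB \<omega>) \<partial>M)"
    proof (rule nn_integral_cong_AE)
      show "AE \<omega> in M. inflow z (LA \<omega>, LB \<omega>) * indicator ?U (LA \<omega>, LB \<omega>) =
          of_nat (card (LB \<omega> \<inter> {x. cell 0 x = z})) * indicator ?U (LA \<omega>, LB \<omega>)"
        using AE_generic
      proof eventually_elim
        case (elim \<omega>)
        show ?case
        proof (cases "(LA \<omega>, LB \<omega>) \<in> ?U")
          case True
          then have "matched_in z (LB \<omega>) (LA \<omega>) = LB \<omega> \<inter> {x. cell 0 x = z}"
            by (intro matched_in_eq unmatched_amber_blue_matched[OF elim])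
          then show ?thesis by (simp add: inflow_eq[OF elim])
        qed simp
      qed
    qed
    also have "\<dots> = ennreal (\<beta> * ?p)"
      using rates_pos by (intro mean_blue invariant_unmatched_amber z) simp
    finally have int_f: "integral\<^sup>N M f = ennreal (\<beta> * ?p)" .
    \<comment> \<open>Here the critical case \<open>\<alpha> = \<beta>\<close> is included:
      \<open>f \<le> g\<close> almost everywhere with finite integrals, and the reverse inequality
      of the integrals forces \<open>f = g\<close> almost everywhere.\<close>
    have "integral\<^sup>N M g \<le> integral\<^sup>N M f"
      unfolding int_f int_g using assms by (intro ennreal_leI mult_right_mono) auto
    then have "(\<integral>\<^sup>+\<omega>. g \<omega> - f \<omega> \<partial>M) = 0"
      using int_f int_g by (subst nn_integral_diff[OF g f _ le]) (auto simp: diff_eq_0_iff_ennreal)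
    then have "AE \<omega> in M. g \<omega> - f \<omega> = 0"
      using f g by (subst (asm) nn_integral_0_iff_AE) measurable
    then show ?thesis
      by eventually_elim (auto simp: f_def g_def diff_eq_0_iff_ennreal not_less)
  qed
  then have "AE \<omega> in M. \<forall>z\<in>grid 0. (LA \<omega>, LB \<omega>) \<in> ?U \<longrightarrow>
      \<not> outflow z (LA \<omega>, LB \<omega>) < of_nat (card (LA \<omega> \<inter> {x. cell 0 x = z}))"
    by (subst AE_ball_countable[OF countable_grid]) blast
  then show ?thesis by eventually_elim (auto simp: unmatched_amber_def)
qed

text \<open>On the complement every amber point is matched, so the mean outflow is
  \<open>\<alpha> * prob ?S\<close>, while the mean inflow is at most
  \<open>\<beta> * prob ?S\<close>. As the two flows agree in mean,
  \<open>\<alpha> > \<beta>\<close> leaves only probability 0.\<close>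

lemma AE_some_unmatched:
  assumes "\<alpha> > \<beta>"
  shows "AE \<omega> in M. (LA \<omega>, LB \<omega>) \<in> unmatched_amber"
proof -
  let ?W = "space pair_configurations - unmatched_amber :: ((real ^ 'd) set \<times> (real ^ 'd) set) set"
  have W: "invariant_event ?W" by (intro invariant_event_Compl invariant_unmatched_amber)
  then have [measurable]: "?W \<in> sets pair_configurations" by (simp add: invariant_event_def)
  let ?S = "{\<omega> \<in> space M. (LA \<omega>, LB \<omega>) \<in> ?W}"
  have S: "?S \<in> events" by measurable
  have z: "(0 :: real ^ 'd) \<in> grid 0" by (simp add: grid_def)
  have "ennreal (\<alpha> * prob ?S) =
      (\<integral>\<^sup>+\<omega>. of_nat (card (LA \<omega> \<inter> {x. cell 0 x = 0})) * indicator ?W (LA \<omega>, LB \<omega>) \<partial>M)"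
    using rates_pos by (intro mean_amber[symmetric] W z) simp
  also have "\<dots> = (\<integral>\<^sup>+\<omega>. outflow 0 (LA \<omega>, LB \<omega>) * indicator ?W (LA \<omega>, LB \<omega>) \<partial>M)"
  proof (rule nn_integral_cong_AE)
    show "AE \<omega> in M. of_nat (card (LA \<omega> \<inter> {x. cell 0 x = 0})) * indicator ?W (LA \<omega>, LB \<omega>) =
        outflow 0 (LA \<omega>, LB \<omega>) * indicator ?W (LA \<omega>, LB \<omega>)"
      using AE_generic
    proof eventually_elim
      case (elim \<omega>)
      show ?case
      proof (cases "(LA \<omega>, LB \<omega>) \<in> ?W")
        case True
        then have "matched_in 0 (LA \<omega>) (LB \<omega>) = LA \<omega> \<inter> {x. cell 0 x = 0}"
          using unmatched_amber_iff[OF elim] by (intro matched_in_eq) auto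
        then show ?thesis by (simp add: outflow_eq[OF elim])
      qed simp
    qed
  qed
  also have "\<dots> = (\<integral>\<^sup>+\<omega>. inflow 0 (LA \<omega>, LB \<omega>) * indicator ?W (LA \<omega>, LB \<omega>) \<partial>M)"
    by (intro mass_transport W z)
  also have "\<dots> \<le> (\<integral>\<^sup>+\<omega>. of_nat (card (LB \<omega> \<inter> {x. cell 0 x = 0})) * indicator ?W (LA \<omega>, LB \<omega>) \<partial>M)"
  proof (rule nn_integral_mono_AE)
    show "AE \<omega> in M. inflow 0 (LA \<omega>, LB \<omega>) * indicator ?W (LA \<omega>, LB \<omega>) \<le>
        of_nat (card (LB \<omega> \<inter> {x. cell 0 x = 0})) * indicator ?W (LA \<omega>, LB \<omega>)"
      using AE_generic AE_space
      by eventually_elim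
         (intro mult_right_mono, simp_all add: inflow_eq card_matched_in_le locally_finite)
  qed
  also have "\<dots> = ennreal (\<beta> * prob ?S)"
    using rates_pos by (intro mean_blue W z) simp
  finally have le: "\<alpha> * prob ?S \<le> \<beta> * prob ?S"
    using rates_pos by (subst (asm) ennreal_le_iff) auto
  have "\<not> 0 < prob ?S"
    using mult_strict_right_mono[OF assms] le by (meson not_le)
  then have "prob ?S = 0" using measure_nonneg[of M ?S] by linarith
  then have "AE \<omega> in M. \<omega> \<notin> ?S"
    using S by (subst (asm) prob_eq_0) auto
  then show ?thesis
    using AE_space
    by eventually_elim (auto simp: space_pair_measure space_configurations locally_finite)
qed

end

theorem theorem8:
  fixes M :: "'w measure"
    and LA LB :: "'w \<Rightarrow> (real ^ 'd::finite) set"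
    and \<alpha> \<beta> :: real
  assumes "prob_space M"
    and "0 < \<alpha>" and "0 < \<beta>"
    and "poisson_process M \<alpha> LA"
    and "poisson_process M \<beta> LB"
    and "prob_space.indep_var M configurations LA configurations LB"
  shows "(\<alpha> \<le> \<beta> \<longrightarrow> (AE \<omega> in M. game_win_for Bob (LA \<omega>) (LB \<omega>))) \<and>
         (\<alpha> > \<beta> \<longrightarrow> (AE \<omega> in M. game_win_for Alice (LA \<omega>) (LB \<omega>)))"
proof -
  interpret poisson_pair M \<alpha> \<beta> LA LB
    using assms by (intro poisson_pair.intro poisson_pair_axioms.intro)
  have "AE \<omega> in M. game_win_for Bob (LA \<omega>) (LB \<omega>)" if "\<alpha> \<le> \<beta>"
    using AE_all_matched[OF that] AE_generic
  proof eventually_elim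
    case (elim \<omega>)
    then have "\<exists>b. stable_pair (LA \<omega>) (LB \<omega>) a b" if "a \<in> LA \<omega>" for a
      using unmatched_amber_iff[OF elim(2)] that by blast
    then show ?case using elim(2) by (intro Bob_wins) (auto simp: generic_def)
  qed
  moreover have "AE \<omega> in M. game_win_for Alice (LA \<omega>) (LB \<omega>)" if "\<alpha> > \<beta>"
    using AE_some_unmatched[OF that] AE_generic
  proof eventually_elim
    case (elim \<omega>)
    then obtain a where "a \<in> LA \<omega>" "\<And>b. \<not> stable_pair (LA \<omega>) (LB \<omega>) a b"
      using unmatched_amber_iff by blast
    then show ?case using elim(2) by (intro Alice_wins) (auto simp: generic_def)
  qed
  ultimately show ?thesis by blast
qed

end
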